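(* Let $\mathcal{M}$ and $\mathcal{N}$ be countable nonstandard models of $\mathrm{I}\Sigma_1$, let $c\in M$ and $a,b\in N$, and let $I$ be a proper cut shared by $\mathcal{M}$ and $\mathcal{N}$ that is closed under exponentiation. The following are equivalent: (1) There is a proper initial embedding $j:\mathcal{M}\to\mathcal{N}$ such that $j(c)=a$, $j(M)<b$ (i.e. every element of $j(M)$ is below $b$), and $j(i)=i$ for all $i\in I$. (2) $\mathrm{SSy}_I(\mathcal{M})=\mathrm{SSy}_I(\mathcal{N})$, and for all $i\in I$ and all $\Delta_0$-formulae $\delta(x,y,z)$, if $\mathcal{M}\models\exists z\,\delta(i,c,z)$ then $\mathcal{N}\models\exists z<b\,\delta(i,a,z)$.
   Context: $\mathrm{I}\Sigma_1$ is Peano Arithmetic with induction restricted to $\Sigma_1$-formulae. A cut is an initial segment without largest element; $I$ is shared by $\mathcal{M}$ and $\mathcal{N}$ if it is a proper cut of both and the two models induce the same structure on $I$. $I$ is closed under exponentiation if $2^x$ exists and lies in $I$ for every $x\in I$. An embedding $j:\mathcal{M}\to\mathcal{N}$ is an isomorphism onto a submodel of $\mathcal{N}$; it is initial if $j(M)$ is an initial segment of $\mathcal{N}$, and proper if $j(M)\ne N$. Ackermann membership: $xEy$ iff the $x$-th bit of the binary expansion of $y$ is $1$; for $c\in M$, $(c_E)^{\mathcal{M}}:=\{x\in M:\mathcal{M}\models xEc\}$. $\mathrm{SSy}_I(\mathcal{M}):=\{(c_E)^{\mathcal{M}}\cap I: c\in M\}$. *)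

theory Defs
  imports Main "HOL-Library.Countable_Set" "HOL-Library.FuncSet"
begin

section \<open>Structures for the language of arithmetic\<close>

record 'a arith_struct =
  carrier :: "'a set"
  zero :: 'a  ("\<zero>\<index>")
  one :: 'a  ("\<one>\<index>")
  add :: "'a \<Rightarrow> 'a \<Rightarrow> 'a"  (infixl "\<oplus>\<index>" 65)
  mult :: "'a \<Rightarrow> 'a \<Rightarrow> 'a"  (infixl "\<otimes>\<index>" 70)
  less :: "'a \<Rightarrow> 'a \<Rightarrow> bool"  (infix "\<prec>\<index>" 50)

definition standard_model :: "nat arith_struct" where
  "standard_model =
    \<lparr> carrier = UNIV, zero = 0, one = 1, add = (+), mult = (*), less = (<) \<rparr>"

section \<open>Formulas\<close>

text \<open>Variables are de Bruijn indices: under a quantifier, \<open>Var 0\<close> is the bound variable.\<close>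

datatype tm = Var nat | Zero | One | Add tm tm | Mult tm tm

datatype fm = Eq tm tm | Less tm tm | Neg fm | And fm fm | Ex fm

primrec eval_tm :: "'a arith_struct \<Rightarrow> (nat \<Rightarrow> 'a) \<Rightarrow> tm \<Rightarrow> 'a" where
  "eval_tm M s (Var n) = s n"
| "eval_tm M s Zero = \<zero>\<^bsub>M\<^esub>"
| "eval_tm M s One = \<one>\<^bsub>M\<^esub>"
| "eval_tm M s (Add t u) = eval_tm M s t \<oplus>\<^bsub>M\<^esub> eval_tm M s u"
| "eval_tm M s (Mult t u) = eval_tm M s t \<otimes>\<^bsub>M\<^esub> eval_tm M s u"

primrec sat :: "'a arith_struct \<Rightarrow> (nat \<Rightarrow> 'a) \<Rightarrow> fm \<Rightarrow> bool" where
  "sat M s (Eq t u) \<longleftrightarrow> eval_tm M s t = eval_tm M s u"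
| "sat M s (Less t u) \<longleftrightarrow> eval_tm M s t \<prec>\<^bsub>M\<^esub> eval_tm M s u"
| "sat M s (Neg \<phi>) \<longleftrightarrow> \<not> sat M s \<phi>"
| "sat M s (And \<phi> \<psi>) \<longleftrightarrow> sat M s \<phi> \<and> sat M s \<psi>"
| "sat M s (Ex \<phi>) \<longleftrightarrow> (\<exists>x\<in>carrier M. sat M (case_nat x s) \<phi>)"

primrec vars_tm :: "tm \<Rightarrow> nat set" where
  "vars_tm (Var n) = {n}"
| "vars_tm Zero = {}"
| "vars_tm One = {}"
| "vars_tm (Add t u) = vars_tm t \<union> vars_tm u"
| "vars_tm (Mult t u) = vars_tm t \<union> vars_tm u"

primrec free_vars :: "fm \<Rightarrow> nat set" where
  "free_vars (Eq t u) = vars_tm t \<union> vars_tm u"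
| "free_vars (Less t u) = vars_tm t \<union> vars_tm u"
| "free_vars (Neg \<phi>) = free_vars \<phi>"
| "free_vars (And \<phi> \<psi>) = free_vars \<phi> \<union> free_vars \<psi>"
| "free_vars (Ex \<phi>) = {n. Suc n \<in> free_vars \<phi>}"

primrec lift_tm :: "tm \<Rightarrow> tm" where
  "lift_tm (Var n) = Var (Suc n)"
| "lift_tm Zero = Zero"
| "lift_tm One = One"
| "lift_tm (Add t u) = Add (lift_tm t) (lift_tm u)"
| "lift_tm (Mult t u) = Mult (lift_tm t) (lift_tm u)"

text \<open>
  The bounded quantifier \<open>\<exists>v < t. \<phi>\<close>, where \<open>v\<close> does not occur in \<open>t\<close>, is
  \<open>Ex (And (Less (Var 0) (lift_tm t)) \<phi>)\<close>; the lifting ensures the side condition.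
  Bounded universal quantifiers are obtained with \<open>Neg\<close>.
\<close>

inductive Delta0 :: "fm \<Rightarrow> bool" where
  Eq: "Delta0 (Eq t u)"
| Less: "Delta0 (Less t u)"
| Neg: "Delta0 \<phi> \<Longrightarrow> Delta0 (Neg \<phi>)"
| And: "Delta0 \<phi> \<Longrightarrow> Delta0 \<psi> \<Longrightarrow> Delta0 (And \<phi> \<psi>)"
| Bex: "Delta0 \<phi> \<Longrightarrow> Delta0 (Ex (And (Less (Var 0) (lift_tm t)) \<phi>))"

inductive Sigma1 :: "fm \<Rightarrow> bool" where
  Delta0: "Delta0 \<phi> \<Longrightarrow> Sigma1 \<phi>"
| Ex: "Sigma1 \<phi> \<Longrightarrow> Sigma1 (Ex \<phi>)"

section \<open>Models of \<open>I\<Sigma>\<^sub>1\<close>\<close>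

text \<open>
  The induction-free base theory is PA\<open>\<^sup>-\<close>, the theory of nonnegative parts of discretely
  ordered rings.
\<close>

locale PA_minus =
  fixes M :: "'a arith_struct" (structure)
  assumes zero_closed: "\<zero> \<in> carrier M"
    and one_closed: "\<one> \<in> carrier M"
    and add_closed: "\<lbrakk>x \<in> carrier M; y \<in> carrier M\<rbrakk> \<Longrightarrow> x \<oplus> y \<in> carrier M"
    and mult_closed: "\<lbrakk>x \<in> carrier M; y \<in> carrier M\<rbrakk> \<Longrightarrow> x \<otimes> y \<in> carrier M"
    and add_assoc: "\<lbrakk>x \<in> carrier M; y \<in> carrier M; z \<in> carrier M\<rbrakk>
      \<Longrightarrow> (x \<oplus> y) \<oplus> z = x \<oplus> (y \<oplus> z)"
    and add_comm: "\<lbrakk>x \<in> carrier M; y \<in> carrier M\<rbrakk> \<Longrightarrow> x \<oplus> y = y \<oplus> x"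
    and mult_assoc: "\<lbrakk>x \<in> carrier M; y \<in> carrier M; z \<in> carrier M\<rbrakk>
      \<Longrightarrow> (x \<otimes> y) \<otimes> z = x \<otimes> (y \<otimes> z)"
    and mult_comm: "\<lbrakk>x \<in> carrier M; y \<in> carrier M\<rbrakk> \<Longrightarrow> x \<otimes> y = y \<otimes> x"
    and distrib: "\<lbrakk>x \<in> carrier M; y \<in> carrier M; z \<in> carrier M\<rbrakk>
      \<Longrightarrow> x \<otimes> (y \<oplus> z) = x \<otimes> y \<oplus> x \<otimes> z"
    and add_zero: "x \<in> carrier M \<Longrightarrow> x \<oplus> \<zero> = x"
    and mult_zero: "x \<in> carrier M \<Longrightarrow> x \<otimes> \<zero> = \<zero>"
    and mult_one: "x \<in> carrier M \<Longrightarrow> x \<otimes> \<one> = x"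
    and less_trans: "\<lbrakk>x \<in> carrier M; y \<in> carrier M; z \<in> carrier M; x \<prec> y; y \<prec> z\<rbrakk> \<Longrightarrow> x \<prec> z"
    and less_irrefl: "x \<in> carrier M \<Longrightarrow> \<not> x \<prec> x"
    and less_linear: "\<lbrakk>x \<in> carrier M; y \<in> carrier M\<rbrakk> \<Longrightarrow> x \<prec> y \<or> x = y \<or> y \<prec> x"
    and add_mono: "\<lbrakk>x \<in> carrier M; y \<in> carrier M; z \<in> carrier M; x \<prec> y\<rbrakk>
      \<Longrightarrow> x \<oplus> z \<prec> y \<oplus> z"
    and mult_mono: "\<lbrakk>x \<in> carrier M; y \<in> carrier M; z \<in> carrier M; \<zero> \<prec> z; x \<prec> y\<rbrakk>
      \<Longrightarrow> x \<otimes> z \<prec> y \<otimes> z"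
    and less_diff: "\<lbrakk>x \<in> carrier M; y \<in> carrier M; x \<prec> y\<rbrakk> \<Longrightarrow> \<exists>z\<in>carrier M. x \<oplus> z = y"
    and zero_less_one: "\<zero> \<prec> \<one>"
    and discrete: "\<lbrakk>x \<in> carrier M; \<zero> \<prec> x\<rbrakk> \<Longrightarrow> x = \<one> \<or> \<one> \<prec> x"
    and zero_least: "x \<in> carrier M \<Longrightarrow> x = \<zero> \<or> \<zero> \<prec> x"

text \<open>
  In the induction scheme the induction variable is \<open>Var 0\<close>; the assignment \<open>s\<close> supplies
  the parameters.
\<close>

locale ISigma1 = PA_minus +
  assumes Sigma1_induction:
    "\<lbrakk>Sigma1 \<phi>; \<And>n. s n \<in> carrier M;
      sat M (case_nat \<zero> s) \<phi>;
      \<And>x. \<lbrakk>x \<in> carrier M; sat M (case_nat x s) \<phi>\<rbrakk> \<Longrightarrow> sat M (case_nat (x \<oplus> \<one>) s) \<phi>;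
      x \<in> carrier M\<rbrakk>
     \<Longrightarrow> sat M (case_nat x s) \<phi>"

section \<open>Embeddings and cuts\<close>

definition embedding ::
    "'a arith_struct \<Rightarrow> 'b arith_struct \<Rightarrow> ('a \<Rightarrow> 'b) \<Rightarrow> bool" where
  "embedding M N j \<longleftrightarrow>
     j \<in> carrier M \<rightarrow> carrier N \<and>
     inj_on j (carrier M) \<and>
     j \<zero>\<^bsub>M\<^esub> = \<zero>\<^bsub>N\<^esub> \<and>
     j \<one>\<^bsub>M\<^esub> = \<one>\<^bsub>N\<^esub> \<and>
     (\<forall>x\<in>carrier M. \<forall>y\<in>carrier M.
        j (x \<oplus>\<^bsub>M\<^esub> y) = j x \<oplus>\<^bsub>N\<^esub> j y \<and>
        j (x \<otimes>\<^bsub>M\<^esub> y) = j x \<otimes>\<^bsub>N\<^esub> j y \<and>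
        (x \<prec>\<^bsub>M\<^esub> y \<longleftrightarrow> j x \<prec>\<^bsub>N\<^esub> j y))"

definition isomorphic :: "'a arith_struct \<Rightarrow> 'b arith_struct \<Rightarrow> bool" where
  "isomorphic M N \<longleftrightarrow> (\<exists>j. embedding M N j \<and> j ` carrier M = carrier N)"

definition nonstandard :: "'a arith_struct \<Rightarrow> bool" where
  "nonstandard M \<longleftrightarrow> \<not> isomorphic standard_model M"

definition initial_segment :: "'a set \<Rightarrow> 'a arith_struct \<Rightarrow> bool" where
  "initial_segment I M \<longleftrightarrow>
     I \<subseteq> carrier M \<and> I \<noteq> {} \<and>
     (\<forall>x\<in>I. \<forall>y\<in>carrier M. y \<prec>\<^bsub>M\<^esub> x \<longrightarrow> y \<in> I)"

definition cut :: "'a set \<Rightarrow> 'a arith_struct \<Rightarrow> bool" where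
  "cut I M \<longleftrightarrow> initial_segment I M \<and> (\<forall>x\<in>I. \<exists>y\<in>I. x \<prec>\<^bsub>M\<^esub> y)"

definition proper_cut :: "'a set \<Rightarrow> 'a arith_struct \<Rightarrow> bool" where
  "proper_cut I M \<longleftrightarrow> cut I M \<and> I \<noteq> carrier M"

definition proper_initial_embedding ::
    "'a arith_struct \<Rightarrow> 'b arith_struct \<Rightarrow> ('a \<Rightarrow> 'b) \<Rightarrow> bool" where
  "proper_initial_embedding M N j \<longleftrightarrow>
     embedding M N j \<and>
     initial_segment (j ` carrier M) N \<and>
     j ` carrier M \<noteq> carrier N"

text \<open>
  A cut need not be closed under the operations, so the structure induced on it is the
  relational one, given by the graphs of the operations.
\<close>

definition same_structure_on :: "'a set \<Rightarrow> 'a arith_struct \<Rightarrow> 'a arith_struct \<Rightarrow> bool" where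
  "same_structure_on I M N \<longleftrightarrow>
     (\<forall>x\<in>I. x = \<zero>\<^bsub>M\<^esub> \<longleftrightarrow> x = \<zero>\<^bsub>N\<^esub>) \<and>
     (\<forall>x\<in>I. x = \<one>\<^bsub>M\<^esub> \<longleftrightarrow> x = \<one>\<^bsub>N\<^esub>) \<and>
     (\<forall>x\<in>I. \<forall>y\<in>I. x \<prec>\<^bsub>M\<^esub> y \<longleftrightarrow> x \<prec>\<^bsub>N\<^esub> y) \<and>
     (\<forall>x\<in>I. \<forall>y\<in>I. \<forall>z\<in>I. x \<oplus>\<^bsub>M\<^esub> y = z \<longleftrightarrow> x \<oplus>\<^bsub>N\<^esub> y = z) \<and>
     (\<forall>x\<in>I. \<forall>y\<in>I. \<forall>z\<in>I. x \<otimes>\<^bsub>M\<^esub> y = z \<longleftrightarrow> x \<otimes>\<^bsub>N\<^esub> y = z)"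

definition shared_cut :: "'a set \<Rightarrow> 'a arith_struct \<Rightarrow> 'a arith_struct \<Rightarrow> bool" where
  "shared_cut I M N \<longleftrightarrow> proper_cut I M \<and> proper_cut I N \<and> same_structure_on I M N"

section \<open>Exponentiation, Ackermann membership and standard systems\<close>

text \<open>
  Goedel's beta function: \<open>r\<close> is the remainder of \<open>a\<close> modulo \<open>1 + (i + 1) b\<close>.
\<close>

definition beta_graph :: "'a arith_struct \<Rightarrow> 'a \<Rightarrow> 'a \<Rightarrow> 'a \<Rightarrow> 'a \<Rightarrow> bool" where
  "beta_graph M a b i r \<longleftrightarrow>
     r \<in> carrier M \<and>
     (let m = \<one>\<^bsub>M\<^esub> \<oplus>\<^bsub>M\<^esub> (i \<oplus>\<^bsub>M\<^esub> \<one>\<^bsub>M\<^esub>) \<otimes>\<^bsub>M\<^esub> b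
      in r \<prec>\<^bsub>M\<^esub> m \<and> (\<exists>q\<in>carrier M. a = q \<otimes>\<^bsub>M\<^esub> m \<oplus>\<^bsub>M\<^esub> r))"

text \<open>
  \<open>M \<Turnstile> y = 2\<^sup>x\<close>, by the usual arithmetization of primitive recursion: some sequence
  coded in \<open>M\<close> starts with \<open>1\<close>, doubles at each step below \<open>x\<close>, and has \<open>x\<close>-th entry \<open>y\<close>.
\<close>

definition exp_graph :: "'a arith_struct \<Rightarrow> 'a \<Rightarrow> 'a \<Rightarrow> bool" where
  "exp_graph M x y \<longleftrightarrow>
     (\<exists>a\<in>carrier M. \<exists>b\<in>carrier M.
        beta_graph M a b \<zero>\<^bsub>M\<^esub> \<one>\<^bsub>M\<^esub> \<and>
        (\<forall>i\<in>carrier M. i \<prec>\<^bsub>M\<^esub> x \<longrightarrow>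
           (\<exists>u\<in>carrier M. beta_graph M a b i u \<and>
                           beta_graph M a b (i \<oplus>\<^bsub>M\<^esub> \<one>\<^bsub>M\<^esub>) (u \<oplus>\<^bsub>M\<^esub> u))) \<and>
        beta_graph M a b x y)"

definition closed_under_exp :: "'a set \<Rightarrow> 'a arith_struct \<Rightarrow> bool" where
  "closed_under_exp I M \<longleftrightarrow> (\<forall>x\<in>I. \<exists>y\<in>I. exp_graph M x y)"

text \<open>The \<open>x\<close>-th bit of \<open>y\<close> is \<open>1\<close> iff \<open>y = (2 q + 1) 2\<^sup>x + r\<close> for some \<open>q\<close> and \<open>r < 2\<^sup>x\<close>.\<close>

definition ack_mem :: "'a arith_struct \<Rightarrow> 'a \<Rightarrow> 'a \<Rightarrow> bool" where
  "ack_mem M x y \<longleftrightarrow>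
     (\<exists>p\<in>carrier M. \<exists>q\<in>carrier M. \<exists>r\<in>carrier M.
        exp_graph M x p \<and> r \<prec>\<^bsub>M\<^esub> p \<and>
        y = (q \<oplus>\<^bsub>M\<^esub> q \<oplus>\<^bsub>M\<^esub> \<one>\<^bsub>M\<^esub>) \<otimes>\<^bsub>M\<^esub> p \<oplus>\<^bsub>M\<^esub> r)"

definition ack_ext :: "'a arith_struct \<Rightarrow> 'a \<Rightarrow> 'a set" where
  "ack_ext M c = {x \<in> carrier M. ack_mem M x c}"

definition SSy :: "'a set \<Rightarrow> 'a arith_struct \<Rightarrow> 'a set set" where
  "SSy I M = {ack_ext M c \<inter> I | c. c \<in> carrier M}"

end

theory Submission
  imports Defs
begin

text \<open>
  From (1) to (2): initial embeddings preserve \<open>\<Delta>\<^sub>0\<close> formulas in both directions and \<open>\<Sigma>\<^sub>1\<close> formulas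
  upwards. For \<open>e \<in> M - I\<close>, a code in \<open>N\<close> can be cut off below the image under \<open>j\<close> of \<open>2\<^sup>e\<close>, and then
  it lies in the range of \<open>j\<close>.

  From (2) to (1): a back-and-forth construction builds tuples \<open>u\<close> in \<open>M\<close> and \<open>v\<close> in \<open>N\<close>, starting with
  \<open>c\<close> and \<open>a\<close>, such that \<open>\<exists>z. \<delta>(i, u, z)\<close> in \<open>M\<close> implies \<open>\<exists>z < b. \<delta>(i, v, z)\<close> in \<open>N\<close> for all \<open>i \<in> I\<close>
  and all \<open>\<Delta>\<^sub>0\<close> formulas \<open>\<delta>\<close>. A single universal relation \<open>V\<close> replaces the quantification over \<open>\<delta>\<close>, so that
  the formulas to be preserved form a \<open>\<Sigma>\<^sub>1\<close> subset of \<open>I\<close>; its code is transferred along the common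
  standard system, and new elements are found by overspill.

  All of this takes place in models whose carrier is the type \<open>nat\<close>; two bijections that agree
  on \<open>I\<close> reduce the general case to this one.
\<close>

section \<open>The ordered semiring of a model\<close>

text \<open>Only Sigma1 induction is available, so each construction has to keep the predicate it
  inducts on Sigma1. The condition carried through the back-and-forth is asymmetric for this reason:
  truth in \<open>M\<close> is an unbounded existential, truth in \<open>N\<close> is existence
  below the fixed \<open>b\<close>, and so the statements subjected to overspill in \<open>N\<close>
  and to underspill in \<open>M\<close> are Sigma1. Such a statement cannot quantify over all
  formulas, which forces a universal relation. It is built from truth tables for finite structures
  \<open>[0, w)\<close>; these only have to be correct at standard formula codes, so no syntax of
  nonstandard formulas is developed. Tables, comprehension and standard systems rest on Ackermann
  bits, hence on exponentiation, whose totality comes from the beta function. Closure of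
  \<open>I\<close> under exponentiation keeps codes of bounded subsets of \<open>I\<close> inside
  \<open>I\<close>, where they can serve as parameters. The carrier is a whole type because the
  algebra is taken from a type class locale, and it is finally \<open>nat\<close> because both
  models then come with an enumeration.\<close>

definition le :: "'a arith_struct \<Rightarrow> 'a \<Rightarrow> 'a \<Rightarrow> bool"  (infix "\<preceq>\<index>" 50) where
  "x \<preceq>\<^bsub>M\<^esub> y \<longleftrightarrow> x \<prec>\<^bsub>M\<^esub> y \<or> x = y"

definition monus :: "'a arith_struct \<Rightarrow> 'a \<Rightarrow> 'a \<Rightarrow> 'a"  (infixl "\<ominus>\<index>" 65) where
  "y \<ominus>\<^bsub>M\<^esub> x = (if x \<preceq>\<^bsub>M\<^esub> y then SOME z. x \<oplus>\<^bsub>M\<^esub> z = y else \<zero>\<^bsub>M\<^esub>)"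

text \<open>A universal carrier removes the membership premises and lets the structure interpret a
  class locale, whose laws range over a whole type.\<close>

locale model = ISigma1 +
  assumes carrier_UNIV: "carrier M = UNIV"
begin

lemma add_lcancel: "x \<oplus> z = x \<oplus> z' \<Longrightarrow> z = z'"
  by (metis UNIV_I add_comm add_mono carrier_UNIV less_irrefl less_linear)

lemma add_monus: "x \<preceq> y \<Longrightarrow> x \<oplus> (y \<ominus> x) = y"
  unfolding monus_def le_def
  by (smt (verit) UNIV_I add_zero carrier_UNIV less_diff someI_ex)

lemma monus_unique: "x \<oplus> z = y \<Longrightarrow> y \<ominus> x = z"
proof -
  assume *: "x \<oplus> z = y"
  have "x \<preceq> y"
    using zero_least[of z] add_mono[of \<zero> z x] * add_comm add_zero carrier_UNIV
    unfolding le_def by (metis UNIV_I)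
  then show ?thesis using * add_monus add_lcancel by blast
qed

lemma le_ex: "x \<preceq> y \<longleftrightarrow> (\<exists>z. y = x \<oplus> z)"
  using add_monus
    zero_least add_mono[of \<zero> _ x] add_comm add_zero carrier_UNIV
    unfolding le_def by (metis UNIV_I)

lemma monus_zero: "\<not> x \<preceq> y \<Longrightarrow> y \<ominus> x = \<zero>"
  by (simp add: monus_def)

lemma model_ab: "(x \<oplus> y) \<oplus> z = x \<oplus> (y \<oplus> z)" "x \<oplus> y = y \<oplus> x"
  "(x \<otimes> y) \<otimes> z = x \<otimes> (y \<otimes> z)" "x \<otimes> y = y \<otimes> x"
  "x \<otimes> (y \<oplus> z) = x \<otimes> y \<oplus> x \<otimes> z"
  "x \<oplus> \<zero> = x" "x \<otimes> \<zero> = \<zero>" "x \<otimes> \<one> = x" "\<not> x \<prec> x"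
  using add_assoc add_comm mult_assoc mult_comm distrib add_zero mult_zero mult_one less_irrefl
    carrier_UNIV by auto

lemma mult_pos: "x \<noteq> \<zero> \<Longrightarrow> y \<noteq> \<zero> \<Longrightarrow> x \<otimes> y \<noteq> \<zero>"
  using zero_least[of x] zero_least[of y] mult_mono[of \<zero> x y] model_ab carrier_UNIV
  by (metis UNIV_I)

text \<open>The library's lemmas on ordered semirings become available under the prefix
  \<open>sr\<close>. The class demands a truncated subtraction, for which \<open>monus\<close> was
  introduced.\<close>

sublocale sr: linordered_semidom where plus = "(\<oplus>)" and zero = \<zero> and times = "(\<otimes>)"
  and one = \<one> and minus = "(\<ominus>)" and less_eq = "(\<preceq>)" and less = "(\<prec>)"
proof unfold_locales
  fix a b c
  show "a \<oplus> b \<oplus> c = a \<oplus> (b \<oplus> c)" "a \<oplus> b = b \<oplus> a" "a \<otimes> b \<otimes> c = a \<otimes> (b \<otimes> c)"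
    "a \<otimes> b = b \<otimes> a" "\<zero> \<oplus> a = a" "\<zero> \<otimes> a = \<zero>" "a \<otimes> \<zero> = \<zero>" "\<one> \<otimes> a = a"
    "(a \<oplus> b) \<otimes> c = a \<otimes> c \<oplus> b \<otimes> c"
    "a \<otimes> (b \<oplus> c) = a \<otimes> b \<oplus> a \<otimes> c"
    using model_ab by metis+
  show "a \<oplus> b \<ominus> a = b" by (rule monus_unique) simp
  show "a \<ominus> b \<ominus> c = a \<ominus> (b \<oplus> c)"
  proof (cases "b \<oplus> c \<preceq> a")
    case True
    then obtain d where "a = b \<oplus> c \<oplus> d" using le_ex by blast
    then show ?thesis by (metis model_ab(1) monus_unique)
  next
    case False
    then have "\<not> c \<preceq> a \<ominus> b" if "b \<preceq> a"
      using that by (metis add_monus le_ex model_ab(1))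
    moreover have "c \<preceq> \<zero> \<Longrightarrow> c = \<zero>" using le_def model_ab zero_least
      by (metis UNIV_I carrier_UNIV le_ex less_trans)
    ultimately show ?thesis using False
      by (metis le_ex model_ab(6) monus_unique monus_zero)
  qed
  show "\<zero> \<noteq> \<one>" using zero_less_one model_ab(9) by metis
  show "a \<noteq> \<zero> \<Longrightarrow> b \<noteq> \<zero> \<Longrightarrow> a \<otimes> b \<noteq> \<zero>" by (rule mult_pos)
  show lin: "a \<preceq> b \<or> b \<preceq> a" using less_linear le_def carrier_UNIV by (metis UNIV_I)
  show tr: "a \<preceq> b \<Longrightarrow> b \<preceq> c \<Longrightarrow> a \<preceq> c" by (metis le_ex model_ab(1))
  have tr': "a \<prec> b \<Longrightarrow> \<not> b \<prec> a" for a b using less_trans[of a b a] model_ab(9) carrier_UNIV by auto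
  show "a \<preceq> a" by (simp add: le_def)
  show "(a \<prec> b) = (a \<preceq> b \<and> \<not> b \<preceq> a)" using tr' model_ab(9) unfolding le_def by metis
  show "a \<preceq> b \<Longrightarrow> b \<preceq> a \<Longrightarrow> a = b" using tr' unfolding le_def by metis
  show "a \<preceq> b \<Longrightarrow> c \<oplus> a \<preceq> c \<oplus> b" by (metis le_ex model_ab(1))
  show "a \<otimes> (b \<ominus> c) = a \<otimes> b \<ominus> a \<otimes> c"
  proof (cases "c \<preceq> b")
    case True
    then show ?thesis by (metis add_monus model_ab(5) monus_unique)
  next
    case False
    then obtain d where d: "c = b \<oplus> d" using lin le_ex unfolding le_def
      by (metis UNIV_I carrier_UNIV less_diff less_linear)
    have "b \<otimes> a \<ominus> c \<otimes> a = \<zero>"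
    proof (cases "a \<otimes> c \<preceq> a \<otimes> b")
      case True
      with d have "a \<otimes> c = a \<otimes> b"
        by (metis le_def le_ex model_ab(5) tr')
      then show ?thesis by (metis model_ab(4,6) monus_unique)
    qed (metis model_ab(4) monus_zero)
    with False show ?thesis by (metis model_ab(4,7) monus_zero)
  qed
  show "a \<prec> b \<Longrightarrow> \<zero> \<prec> c \<Longrightarrow> c \<otimes> a \<prec> c \<otimes> b"
    using mult_mono[of a b c] model_ab(4) carrier_UNIV by (metis UNIV_I)
  show "\<zero> \<prec> \<one>" by (rule zero_less_one)
  show "b \<preceq> a \<Longrightarrow> a \<ominus> b \<oplus> b = a" using add_monus model_ab(2) by metis
qed

lemma zero_le [simp]: "\<zero> \<preceq> x"
  by (metis UNIV_I carrier_UNIV le_def zero_least)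

lemma not_less_zero [simp]: "\<not> x \<prec> \<zero>"
  using zero_le sr.not_less by blast

lemma less_Suc: "x \<prec> y \<oplus> \<one> \<longleftrightarrow> x \<preceq> y"
proof
  assume *: "x \<prec> y \<oplus> \<one>"
  show "x \<preceq> y"
  proof (rule ccontr)
    assume "\<not> x \<preceq> y"
    then obtain d where d: "x = y \<oplus> d" "d \<noteq> \<zero>"
      by (metis le_ex sr.add_0_right sr.order.refl sr.le_cases)
    then have "\<one> \<preceq> d" using discrete[of d] zero_least[of d] carrier_UNIV le_def by auto
    with * d show False using sr.not_less by auto
  qed
qed (metis sr.add_le_less_mono sr.add_0_right sr.zero_less_one)

lemma Suc_le: "x \<oplus> \<one> \<preceq> y \<longleftrightarrow> x \<prec> y"
  using less_Suc[of y x] sr.not_less by blast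

lemma zero_or_Suc: "x = \<zero> \<or> (\<exists>y. x = y \<oplus> \<one>)"
  using Suc_le[of \<zero> x] le_ex[of \<one> x] by (metis le_def sr.add.commute sr.add_0 zero_le)

end

section \<open>Uniform definability\<close>

primrec subst_tm :: "(nat \<Rightarrow> tm) \<Rightarrow> tm \<Rightarrow> tm" where
  "subst_tm \<sigma> (Var n) = \<sigma> n"
| "subst_tm \<sigma> Zero = Zero"
| "subst_tm \<sigma> One = One"
| "subst_tm \<sigma> (Add t u) = Add (subst_tm \<sigma> t) (subst_tm \<sigma> u)"
| "subst_tm \<sigma> (Mult t u) = Mult (subst_tm \<sigma> t) (subst_tm \<sigma> u)"

primrec subst_fm :: "fm \<Rightarrow> (nat \<Rightarrow> tm) \<Rightarrow> fm" where
  "subst_fm (Eq t u) \<sigma> = Eq (subst_tm \<sigma> t) (subst_tm \<sigma> u)"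
| "subst_fm (Less t u) \<sigma> = Less (subst_tm \<sigma> t) (subst_tm \<sigma> u)"
| "subst_fm (Neg \<phi>) \<sigma> = Neg (subst_fm \<phi> \<sigma>)"
| "subst_fm (And \<phi> \<psi>) \<sigma> = And (subst_fm \<phi> \<sigma>) (subst_fm \<psi> \<sigma>)"
| "subst_fm (Ex \<phi>) \<sigma> = Ex (subst_fm \<phi> (case_nat (Var 0) (\<lambda>n. lift_tm (\<sigma> n))))"

lemma eval_lift_tm [simp]: "eval_tm M (case_nat x s) (lift_tm t) = eval_tm M s t"
  by (induction t) auto

lemma eval_subst_tm: "eval_tm M s (subst_tm \<sigma> t) = eval_tm M (\<lambda>n. eval_tm M s (\<sigma> n)) t"
  by (induction t) auto

lemma sat_subst_fm: "sat M s (subst_fm \<phi> \<sigma>) = sat M (\<lambda>n. eval_tm M s (\<sigma> n)) \<phi>"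
proof (induction \<phi> arbitrary: s \<sigma>)
  case (Ex \<phi>)
  have "(\<lambda>n. eval_tm M (case_nat x s) (case_nat (Var 0) (\<lambda>n. lift_tm (\<sigma> n)) n))
    = case_nat x (\<lambda>n. eval_tm M s (\<sigma> n))" for x
    by (auto split: nat.split)
  with Ex show ?case by simp
qed (auto simp: eval_subst_tm)

text \<open>A lifted bound stays a lifted term under substitution, so the shape that
  \<open>Delta0\<close> requires of bounded quantifiers survives.\<close>

lemma subst_lift_tm:
  "subst_tm (case_nat (Var 0) (\<lambda>n. lift_tm (\<sigma> n))) (lift_tm t) = lift_tm (subst_tm \<sigma> t)"
  by (induction t) auto

lemma Delta0_subst_fm: "Delta0 \<phi> \<Longrightarrow> Delta0 (subst_fm \<phi> \<sigma>)"
proof (induction arbitrary: \<sigma> rule: Delta0.induct)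
  case (Bex \<phi> t)
  then show ?case using Delta0.Bex by (simp add: subst_lift_tm)
qed (auto intro: Delta0.intros)

lemma vars_subst_tm: "vars_tm (subst_tm \<sigma> t) = (\<Union>n\<in>vars_tm t. vars_tm (\<sigma> n))"
  by (induction t) auto

lemma vars_lift_tm: "vars_tm (lift_tm t) = Suc ` vars_tm t"
  by (induction t) auto

lemma free_vars_subst_fm:
  "free_vars (subst_fm \<phi> \<sigma>) = (\<Union>n\<in>free_vars \<phi>. vars_tm (\<sigma> n))"
proof (induction \<phi> arbitrary: \<sigma>)
  case (Ex \<phi>)
  have *: "Suc n \<in> vars_tm (case_nat (Var 0) (\<lambda>n. lift_tm (\<sigma> n)) m)
    \<longleftrightarrow> (\<exists>k. m = Suc k \<and> n \<in> vars_tm (\<sigma> k))" for n m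
    by (cases m) (auto simp: vars_lift_tm)
  show ?case
  proof (rule set_eqI)
    fix n
    have "n \<in> free_vars (subst_fm (fm.Ex \<phi>) \<sigma>)
      \<longleftrightarrow> (\<exists>m\<in>free_vars \<phi>. Suc n \<in> vars_tm (case_nat (Var 0) (\<lambda>n. lift_tm (\<sigma> n)) m))"
      by (simp add: Ex.IH)
    also have "\<dots> \<longleftrightarrow> (\<exists>m\<in>free_vars \<phi>. \<exists>k. m = Suc k \<and> n \<in> vars_tm (\<sigma> k))"
      by (simp only: *)
    also have "\<dots> \<longleftrightarrow> n \<in> (\<Union>n\<in>free_vars (fm.Ex \<phi>). vars_tm (\<sigma> n))" by auto
    finally show "n \<in> free_vars (subst_fm (fm.Ex \<phi>) \<sigma>)
      \<longleftrightarrow> n \<in> (\<Union>n\<in>free_vars (fm.Ex \<phi>). vars_tm (\<sigma> n))" .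
  qed
qed (auto simp: vars_subst_tm)

lemma eval_tm_cong: "(\<And>n. n \<in> vars_tm t \<Longrightarrow> s n = s' n) \<Longrightarrow> eval_tm M s t = eval_tm M s' t"
  by (induction t) auto

text \<open>Assignments are total, and a list \<open>(!) [...]\<close> has unspecified values past
  its end. A bound on the free variables makes these values immaterial.\<close>

lemma sat_cong: "(\<And>n. n \<in> free_vars \<phi> \<Longrightarrow> s n = s' n) \<Longrightarrow> sat M s \<phi> = sat M s' \<phi>"
proof (induction \<phi> arbitrary: s s')
  case (Eq t u)
  have "eval_tm M s t = eval_tm M s' t" by (rule eval_tm_cong) (simp add: Eq)
  moreover have "eval_tm M s u = eval_tm M s' u" by (rule eval_tm_cong) (simp add: Eq)
  ultimately show ?case by simp
next
  case (Less t u)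
  have "eval_tm M s t = eval_tm M s' t" by (rule eval_tm_cong) (simp add: Less)
  moreover have "eval_tm M s u = eval_tm M s' u" by (rule eval_tm_cong) (simp add: Less)
  ultimately show ?case by simp
next
  case (Neg \<phi>)
  have "sat M s \<phi> = sat M s' \<phi>" by (rule Neg.IH) (simp add: Neg.prems)
  then show ?case by simp
next
  case (And \<phi> \<psi>)
  have "sat M s \<phi> = sat M s' \<phi>" by (rule And.IH(1)) (simp add: And.prems)
  moreover have "sat M s \<psi> = sat M s' \<psi>" by (rule And.IH(2)) (simp add: And.prems)
  ultimately show ?case by simp
next
  case (Ex \<phi>)
  have "sat M (case_nat x s) \<phi> = sat M (case_nat x s') \<phi>" for x
    by (rule Ex.IH) (auto simp: Ex.prems split: nat.split)
  then show ?case by simp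
qed

text \<open>
  Definability is uniform: one formula has to define the relation in every model whose carrier
  is the whole type, so that a definable relation can be evaluated in two models at once.
  \<open>D0\<close>, \<open>S1\<close> and \<open>D1\<close> are the \<open>\<Delta>\<^sub>0\<close>, \<open>\<Sigma>\<^sub>1\<close> and \<open>\<Delta>\<^sub>1\<close> relations on assignments, \<open>F1\<close> the functions
  with a \<open>\<Sigma>\<^sub>1\<close> graph; these are total because HOL functions are. As in the formulas, a quantified
  variable becomes variable 0 of the extended assignment.
\<close>

type_synonym 'b tmfun = "'b arith_struct \<Rightarrow> (nat \<Rightarrow> 'b) \<Rightarrow> 'b"
type_synonym 'b rel = "'b arith_struct \<Rightarrow> (nat \<Rightarrow> 'b) \<Rightarrow> bool"

definition trm :: "'b tmfun \<Rightarrow> bool" where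
  "trm f \<longleftrightarrow> (\<exists>t. \<forall>M s. f M s = eval_tm M s t)"

definition D0 :: "'b rel \<Rightarrow> bool" where
  "D0 P \<longleftrightarrow> (\<exists>\<phi>. Delta0 \<phi> \<and> (\<forall>M s. model M \<longrightarrow> P M s = sat M s \<phi>))"

definition S1 :: "'b rel \<Rightarrow> bool" where
  "S1 P \<longleftrightarrow> (\<exists>Q. D0 Q \<and> (\<forall>M s. model M \<longrightarrow> P M s = (\<exists>z. Q M (case_nat z s))))"

definition D1 :: "'b rel \<Rightarrow> bool" where
  "D1 P \<longleftrightarrow> S1 P \<and> S1 (\<lambda>M s. \<not> P M s)"

definition F1 :: "'b tmfun \<Rightarrow> bool" where
  "F1 f \<longleftrightarrow> S1 (\<lambda>M s. s 0 = f M (\<lambda>n. s (Suc n)))"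

lemma trm_var: "trm (\<lambda>M s. s n)"
  unfolding trm_def by (rule exI[of _ "Var n"]) simp
lemma trm_zero: "trm (\<lambda>M s. \<zero>\<^bsub>M\<^esub>)"
  unfolding trm_def by (rule exI[of _ "Zero"]) simp
lemma trm_one: "trm (\<lambda>M s. \<one>\<^bsub>M\<^esub>)"
  unfolding trm_def by (rule exI[of _ "One"]) simp
lemma trm_add: "trm f \<Longrightarrow> trm g \<Longrightarrow> trm (\<lambda>M s. f M s \<oplus>\<^bsub>M\<^esub> g M s)"
  unfolding trm_def by (metis eval_tm.simps(4))
lemma trm_mult: "trm f \<Longrightarrow> trm g \<Longrightarrow> trm (\<lambda>M s. f M s \<otimes>\<^bsub>M\<^esub> g M s)"
  unfolding trm_def by (metis eval_tm.simps(5))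

lemma trm_ren: assumes "trm f" shows "trm (\<lambda>M s. f M (\<lambda>n. s (\<rho> n)))"
proof -
  obtain t where "\<And>M s. f M s = eval_tm M s t" using assms unfolding trm_def by auto
  then show ?thesis
    unfolding trm_def by (intro exI[of _ "subst_tm (\<lambda>n. Var (\<rho> n)) t"]) (simp add: eval_subst_tm)
qed

lemmas trm_intros = trm_var trm_zero trm_one trm_add trm_mult

lemma D0_eq: "trm f \<Longrightarrow> trm g \<Longrightarrow> D0 (\<lambda>M s. f M s = g M s)"
  unfolding trm_def D0_def by (metis Delta0.Eq sat.simps(1))
lemma D0_less: "trm f \<Longrightarrow> trm g \<Longrightarrow> D0 (\<lambda>M s. f M s \<prec>\<^bsub>M\<^esub> g M s)"
  unfolding trm_def D0_def by (metis Delta0.Less sat.simps(2))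
lemma D0_not: "D0 P \<Longrightarrow> D0 (\<lambda>M s. \<not> P M s)"
  unfolding D0_def by (metis Delta0.Neg sat.simps(3))
lemma D0_and: "D0 P \<Longrightarrow> D0 Q \<Longrightarrow> D0 (\<lambda>M s. P M s \<and> Q M s)"
  unfolding D0_def by (metis Delta0.And sat.simps(4))
lemma D0_cong: "D0 P \<Longrightarrow> (\<And>M s. model M \<Longrightarrow> P M s = Q M s) \<Longrightarrow> D0 Q"
  unfolding D0_def by metis
lemma D0_or: "D0 P \<Longrightarrow> D0 Q \<Longrightarrow> D0 (\<lambda>M s. P M s \<or> Q M s)"
  by (rule D0_cong[OF D0_not[OF D0_and[OF D0_not D0_not]]]) auto
text \<open>\<open>Q\<close> takes the bound element and the outer assignment separately. With the
  premise stated through \<open>s 0\<close> and \<open>\<lambda>n. s (Suc n)\<close>, higher-order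
  unification finds \<open>Q\<close> in a goal, and definability follows by \<open>intro\<close>
  along the syntax.\<close>

lemma D0_bex:
  assumes "trm f" "D0 (\<lambda>M s. Q M (s 0) (\<lambda>n. s (Suc n)))"
  shows "D0 (\<lambda>M s. \<exists>x. x \<prec>\<^bsub>M\<^esub> f M s \<and> Q M x s)"
proof -
  from assms obtain t \<phi> where t: "\<And>M s. f M s = eval_tm M s t"
    and \<phi>: "Delta0 \<phi>" "\<And>M s. model M \<Longrightarrow> Q M (s 0) (\<lambda>n. s (Suc n)) = sat M s \<phi>"
    unfolding trm_def D0_def by metis
  have "sat M (case_nat x s) \<phi> = Q M x s" if "model M" for M x s
    using \<phi>(2)[OF that, of "case_nat x s"] by simp
  then show ?thesis
    unfolding D0_def using Delta0.Bex[OF \<phi>(1), of t] t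
    by (intro exI[of _ "fm.Ex (fm.And (fm.Less (Var 0) (lift_tm t)) \<phi>)"])
      (auto simp: model.carrier_UNIV)
qed
lemma D0_ball:
  assumes "trm f" "D0 (\<lambda>M s. Q M (s 0) (\<lambda>n. s (Suc n)))"
  shows "D0 (\<lambda>M s. \<forall>x. x \<prec>\<^bsub>M\<^esub> f M s \<longrightarrow> Q M x s)"
  by (rule D0_cong[OF D0_not[OF D0_bex[OF assms(1) D0_not[OF assms(2)]]]]) auto

lemma D0_subst:
  assumes "D0 P" "\<And>n. trm (\<sigma> n)"
  shows "D0 (\<lambda>M s. P M (\<lambda>n. \<sigma> n M s))"
proof -
  from assms(2) obtain \<tau> where \<tau>: "\<And>n M s. \<sigma> n M s = eval_tm M s (\<tau> n)"
    unfolding trm_def by metis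
  from assms(1) obtain \<phi> where "Delta0 \<phi>" "\<And>M s. model M \<Longrightarrow> P M s = sat M s \<phi>"
    unfolding D0_def by metis
  then show ?thesis
    unfolding D0_def using \<tau> by (intro exI[of _ "subst_fm \<phi> \<tau>"]) (simp add: Delta0_subst_fm sat_subst_fm)
qed

lemma D0_ren: "D0 P \<Longrightarrow> D0 (\<lambda>M s. P M (\<lambda>n. s (\<rho> n)))"
  using D0_subst[of P "\<lambda>n M s. s (\<rho> n)"] trm_var by blast

text \<open>Under additional quantifiers the variables of a relation are displaced;
  \<open>\<rho>\<close> lists where each of them now stands.\<close>

lemma D0_renI:
  assumes "D0 Q" "\<And>s. (\<lambda>n. s (\<rho> n)) = \<sigma> s" shows "D0 (\<lambda>M s. Q M (\<sigma> s))"
  using D0_ren[OF assms(1), of \<rho>] unfolding assms(2) .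

section \<open>Sigma1 relations: closure properties, induction and collection\<close>

lemma S1_cong: "S1 P \<Longrightarrow> (\<And>M s. model M \<Longrightarrow> P M s = Q M s) \<Longrightarrow> S1 Q"
  unfolding S1_def by metis

lemma S1_D0: assumes "D0 P" shows "S1 P"
proof -
  have "D0 (\<lambda>M s. P M (\<lambda>n. s (Suc n)))" by (rule D0_ren[OF assms])
  then show ?thesis unfolding S1_def by (rule exI[where x="\<lambda>M s. P M (\<lambda>n. s (Suc n))", OF conjI]) simp
qed

lemma S1_D0_ex:
  assumes "D0 (\<lambda>M s. Q M (s 0) (\<lambda>n. s (Suc n)))"
  shows "S1 (\<lambda>M s. \<exists>x. Q M x s)"
  unfolding S1_def
proof (intro exI conjI allI impI)
  show "D0 (\<lambda>M s. Q M (s 0) (\<lambda>n. s (Suc n)))" by (rule assms)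
qed simp

lemma S1_ren: assumes "S1 P" shows "S1 (\<lambda>M s. P M (\<lambda>n. s (\<rho> n)))"
proof -
  obtain Q where Q: "D0 Q" "\<And>M s. model M \<Longrightarrow> P M s = (\<exists>z. Q M (case_nat z s))"
    using assms unfolding S1_def by auto
  have "S1 (\<lambda>M s. \<exists>z. Q M (case_nat z (\<lambda>n. s (\<rho> n))))"
    apply (rule S1_D0_ex)
    apply (rule D0_renI[OF Q(1), of "case_nat 0 (\<lambda>n. Suc (\<rho> n))"])
    apply (auto split: nat.split)
    done
  then show ?thesis by (rule S1_cong) (simp add: Q)
qed

context model
begin

lemma ub2: "\<exists>B. x \<prec> B \<and> y \<prec> B"
  by (metis less_Suc sr.add.commute le_ex sr.add.assoc)

text \<open>All inductions inside a model take this form. \<open>P\<close> is a relation on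
  arbitrary models, since \<open>S1\<close> speaks of all of them; the parameters are packed into
  \<open>s\<close>, often as a list.\<close>

lemma S1_induct:
  assumes "S1 (\<lambda>M s. P M (s 0) (\<lambda>n. s (Suc n)))"
    and "P M \<zero> s" "\<And>x. P M x s \<Longrightarrow> P M (x \<oplus> \<one>) s"
  shows "P M x s"
proof -
  obtain Q where Q: "D0 Q" "\<And>M s. model M \<Longrightarrow> P M (s 0) (\<lambda>n. s (Suc n)) = (\<exists>z. Q M (case_nat z s))"
    using assms(1) unfolding S1_def by auto
  obtain \<phi> where \<phi>: "Delta0 \<phi>" "\<And>M s. model M \<Longrightarrow> Q M s = sat M s \<phi>"
    using Q(1) unfolding D0_def by metis
  have *: "sat M (case_nat x s) (fm.Ex \<phi>) = P M x s" for x
    using Q(2)[OF model_axioms, of "case_nat x s"] \<phi>(2)[OF model_axioms] carrier_UNIV by simp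
  show ?thesis
    using Sigma1_induction[of "fm.Ex \<phi>" s x] assms(2,3) \<phi>(1)
    unfolding * carrier_UNIV by (simp add: Sigma1.intros)
qed

end

text \<open>One bound \<open>B\<close> above both the element and the hidden witness of
  \<open>P\<close> turns two unbounded quantifiers into one.\<close>

lemma S1_ex:
  assumes "S1 (\<lambda>M s. P M (s 0) (\<lambda>n. s (Suc n)))"
  shows "S1 (\<lambda>M s. \<exists>x. P M x s)"
proof -
  obtain Q where Q: "D0 Q" "\<And>M s. model M \<Longrightarrow> P M (s 0) (\<lambda>n. s (Suc n)) = (\<exists>z. Q M (case_nat z s))"
    using assms unfolding S1_def by auto
  have "S1 (\<lambda>M s. \<exists>B x. x \<prec>\<^bsub>M\<^esub> B \<and> (\<exists>z. z \<prec>\<^bsub>M\<^esub> B \<and> Q M (case_nat z (case_nat x s))))"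
    apply (intro S1_D0_ex D0_bex trm_intros)
    apply (rule D0_renI[OF Q(1), of "case_nat 0 (case_nat 1 (\<lambda>n. n+3))"])
    apply (auto split: nat.split simp: numeral_3_eq_3)
    done
  then show ?thesis
  proof (rule S1_cong)
    fix M :: "'a arith_struct" and s assume "model M"
    then interpret model M .
    have "P M x s = (\<exists>z. Q M (case_nat z (case_nat x s)))" for x
      using Q(2)[OF model_axioms, of "case_nat x s"] by simp
    then show "(\<exists>B x. x \<prec>\<^bsub>M\<^esub> B \<and> (\<exists>z. z \<prec>\<^bsub>M\<^esub> B \<and> Q M (case_nat z (case_nat x s)))) = (\<exists>x. P M x s)"
      by (metis ub2)
  qed
qed

lemma S1_and:
  assumes "S1 P" "S1 Q" shows "S1 (\<lambda>M s. P M s \<and> Q M s)"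
proof -
  obtain P' where P: "D0 P'" "\<And>M s. model M \<Longrightarrow> P M s = (\<exists>z. P' M (case_nat z s))"
    using assms(1) unfolding S1_def by auto
  obtain Q' where Q: "D0 Q'" "\<And>M s. model M \<Longrightarrow> Q M s = (\<exists>z. Q' M (case_nat z s))"
    using assms(2) unfolding S1_def by auto
  have "S1 (\<lambda>M s. \<exists>x y. P' M (case_nat x s) \<and> Q' M (case_nat y s))"
    apply (intro S1_ex S1_D0 D0_and)
    apply (rule D0_renI[OF P(1), of "case_nat 1 (\<lambda>n. n+2)"])
    apply (auto split: nat.split)[1]
    apply (rule D0_renI[OF Q(1), of "case_nat 0 (\<lambda>n. n+2)"])
    apply (auto split: nat.split)[1]
    done
  then show ?thesis by (rule S1_cong) (auto simp: P Q)
qed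

lemma S1_or:
  assumes "S1 P" "S1 Q" shows "S1 (\<lambda>M s. P M s \<or> Q M s)"
proof -
  obtain P' where P: "D0 P'" "\<And>M s. model M \<Longrightarrow> P M s = (\<exists>z. P' M (case_nat z s))"
    using assms(1) unfolding S1_def by auto
  obtain Q' where Q: "D0 Q'" "\<And>M s. model M \<Longrightarrow> Q M s = (\<exists>z. Q' M (case_nat z s))"
    using assms(2) unfolding S1_def by auto
  have "S1 (\<lambda>M s. \<exists>x. P' M (case_nat x s) \<or> Q' M (case_nat x s))"
    apply (intro S1_ex S1_D0 D0_or)
    apply (rule D0_cong[OF P(1)])
    apply (rule arg_cong[of _ _ "P' _"])
    apply (auto split: nat.split)[1]
    apply (rule D0_cong[OF Q(1)])
    apply (rule arg_cong[of _ _ "Q' _"])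
    apply (auto split: nat.split)[1]
    done
  then show ?thesis by (rule S1_cong) (auto simp: P Q)
qed

context model
begin

lemma D0_collection:
  assumes "D0 Q" "\<forall>x. x \<prec>\<^bsub>M\<^esub> y \<longrightarrow> (\<exists>z. Q M (case_nat z (case_nat x s)))"
  shows "\<exists>B. \<forall>x. x \<prec>\<^bsub>M\<^esub> y \<longrightarrow> (\<exists>z. z \<prec>\<^bsub>M\<^esub> B \<and> Q M (case_nat z (case_nat x s)))"
proof -
  \<comment> \<open>The first entry of the assignment holds \<open>y\<close>. The disjunct that
    \<open>y\<close> is below \<open>v\<close> makes the predicate true past \<open>y\<close>, so
    the induction can run through the whole model.\<close>
  let ?P = "\<lambda>M v s. \<exists>B. s 0 \<prec>\<^bsub>M\<^esub> v \<or> (\<forall>x. x \<prec>\<^bsub>M\<^esub> v \<longrightarrow>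
      (\<exists>z. z \<prec>\<^bsub>M\<^esub> B \<and> Q M (case_nat z (case_nat x (\<lambda>n. s (Suc n))))))"
  have "?P M y (case_nat y s)"
  proof (rule S1_induct[where P = ?P])
    show "S1 (\<lambda>M s. ?P M (s 0) (\<lambda>n. s (Suc n)))"
      apply (intro S1_D0_ex D0_bex D0_ball D0_or D0_less trm_intros)
      \<comment> \<open>The variables stand in the order \<open>z\<close>, \<open>x\<close>,
        \<open>B\<close>, \<open>v\<close>, \<open>y\<close>, so the original assignment starts at
        index 5.\<close>
      apply (rule D0_renI[OF assms(1), of "case_nat 0 (case_nat 1 (\<lambda>n. n+5))"])
      apply (auto split: nat.split simp: eval_nat_numeral)
      done
  next
    show "?P M \<zero> (case_nat y s)" by auto
  next
    fix v assume "?P M v (case_nat y s)"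
    then obtain B where B: "y \<prec> v \<or> (\<forall>x. x \<prec> v \<longrightarrow> (\<exists>z. z \<prec> B \<and> Q M (case_nat z (case_nat x s))))"
      by auto
    have "y \<prec> v \<oplus> \<one> \<or> v \<prec> y" using less_Suc sr.not_less by blast
    then show "?P M (v \<oplus> \<one>) (case_nat y s)"
    proof
      assume v: "v \<prec> y"
      then obtain z where z: "Q M (case_nat z (case_nat v s))" using assms(2) by blast
      obtain B' where B': "B \<prec> B'" "z \<prec> B'" using ub2 by blast
      have "\<exists>z. z \<prec> B' \<and> Q M (case_nat z (case_nat x s))" if "x \<prec> v \<oplus> \<one>" for x
      proof (cases "x = v")
        case False
        then have "x \<prec> v" using that less_Suc sr.le_less by blast
        then show ?thesis using B v B' sr.less_trans sr.less_asym by blast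
      qed (use z B' in blast)
      then show ?thesis by auto
    qed auto
  qed
  then show ?thesis by simp
qed

end

text \<open>Collection moves the hidden existential quantifier of \<open>P\<close> in front of the
  bounded universal one.\<close>

lemma S1_ball_trm:
  assumes "trm f" "S1 (\<lambda>M s. P M (s 0) (\<lambda>n. s (Suc n)))"
  shows "S1 (\<lambda>M s. \<forall>x. x \<prec>\<^bsub>M\<^esub> f M s \<longrightarrow> P M x s)"
proof -
  obtain Q where Q: "D0 Q" "\<And>M s. model M \<Longrightarrow> P M (s 0) (\<lambda>n. s (Suc n)) = (\<exists>z. Q M (case_nat z s))"
    using assms(2) unfolding S1_def by auto
  have Q': "P M x s = (\<exists>z. Q M (case_nat z (case_nat x s)))" if "model M" for M x s
    using Q(2)[OF that, of "case_nat x s"] by simp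
  have "trm (\<lambda>M s. f M (\<lambda>n. s (Suc n)))"
    by (rule trm_ren[OF assms(1)])
  then have "S1 (\<lambda>M s. \<exists>B. \<forall>x. x \<prec>\<^bsub>M\<^esub> f M s \<longrightarrow> (\<exists>z. z \<prec>\<^bsub>M\<^esub> B \<and> Q M (case_nat z (case_nat x s))))"
    apply (intro S1_D0_ex D0_bex D0_ball trm_intros)
    apply assumption
    apply (rule D0_renI[OF Q(1), of "case_nat 0 (case_nat 1 (\<lambda>n. n+3))"])
    apply (auto split: nat.split simp: eval_nat_numeral)
    done
  then show ?thesis
  proof (rule S1_cong)
    fix M :: "'a arith_struct" and s assume M: "model M"
    show "(\<exists>B. \<forall>x. x \<prec>\<^bsub>M\<^esub> f M s \<longrightarrow> (\<exists>z. z \<prec>\<^bsub>M\<^esub> B \<and> Q M (case_nat z (case_nat x s))))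
      = (\<forall>x. x \<prec>\<^bsub>M\<^esub> f M s \<longrightarrow> P M x s)" (is "?L = ?R")
    proof
      assume ?R
      then show ?L using model.D0_collection[OF M Q(1), of "f M s" s] Q'[OF M] by simp
    qed (auto simp: Q'[OF M])
  qed
qed

section \<open>Functions with Sigma1 graph and Delta1 relations\<close>

lemma F1_trm: "trm f \<Longrightarrow> F1 f"
  unfolding F1_def by (rule S1_D0[OF D0_eq[OF trm_var trm_ren]])

lemma F1_at: assumes "F1 f" shows "S1 (\<lambda>M s. s k = f M (\<lambda>n. s (\<rho> n)))"
  using S1_ren[OF assms[unfolded F1_def], of "case_nat k \<rho>"] by simp

lemma F1_ren: "F1 f \<Longrightarrow> F1 (\<lambda>M s. f M (\<lambda>n. s (\<rho> n)))"
  unfolding F1_def[of "\<lambda>M s. f M (\<lambda>n. s (\<rho> n))"] by (rule F1_at)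

text \<open>A value of a function with Sigma1 graph is named by an existential quantifier. As the
  function is total, the same works for the negation of \<open>P\<close>, and so Delta1 relations
  are closed under such substitutions as well.\<close>

lemma S1_subst2:
  assumes "S1 (\<lambda>M s. P M (s 0) (s 1))" "F1 f0" "F1 f1"
  shows "S1 (\<lambda>M s. P M (f0 M s) (f1 M s))"
proof -
  have "S1 (\<lambda>M s. \<exists>y0 y1. y0 = f0 M s \<and> y1 = f1 M s \<and> P M y0 y1)"
    using S1_ren[OF assms(1), of "case_nat 1 (case_nat 0 (\<lambda>_. 0))"]
    by (intro S1_ex S1_and
      F1_at[OF assms(2), of "(Suc 0)" "\<lambda>n. Suc (Suc n)"]
      F1_at[OF assms(3), of "0" "\<lambda>n. Suc (Suc n)"])
      (simp add: eval_nat_numeral)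
  then show ?thesis by simp
qed

lemma D1_subst2:
  assumes "D1 (\<lambda>M s. P M (s 0) (s 1))" "F1 f0" "F1 f1"
  shows "D1 (\<lambda>M s. P M (f0 M s) (f1 M s))"
  using S1_subst2[of P, OF _ assms(2-)] S1_subst2[of "\<lambda>M y0 y1. \<not> P M y0 y1", OF _ assms(2-)]
    assms(1) unfolding D1_def by simp

lemma S1_subst3:
  assumes "S1 (\<lambda>M s. P M (s 0) (s 1) (s 2))" "F1 f0" "F1 f1" "F1 f2"
  shows "S1 (\<lambda>M s. P M (f0 M s) (f1 M s) (f2 M s))"
proof -
  have "S1 (\<lambda>M s. \<exists>y0 y1 y2. y0 = f0 M s \<and> y1 = f1 M s \<and> y2 = f2 M s \<and> P M y0 y1 y2)"
    using S1_ren[OF assms(1), of "case_nat 2 (case_nat 1 (case_nat 0 (\<lambda>_. 0)))"]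
    by (intro S1_ex S1_and
      F1_at[OF assms(2), of "(Suc (Suc 0))" "\<lambda>n. Suc (Suc (Suc n))"]
      F1_at[OF assms(3), of "(Suc 0)" "\<lambda>n. Suc (Suc (Suc n))"]
      F1_at[OF assms(4), of "0" "\<lambda>n. Suc (Suc (Suc n))"])
      (simp add: eval_nat_numeral)
  then show ?thesis by simp
qed

lemma D1_subst3:
  assumes "D1 (\<lambda>M s. P M (s 0) (s 1) (s 2))" "F1 f0" "F1 f1" "F1 f2"
  shows "D1 (\<lambda>M s. P M (f0 M s) (f1 M s) (f2 M s))"
  using S1_subst3[of P, OF _ assms(2-)] S1_subst3[of "\<lambda>M y0 y1 y2. \<not> P M y0 y1 y2", OF _ assms(2-)]
    assms(1) unfolding D1_def by simp

lemma S1_subst4: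
  assumes "S1 (\<lambda>M s. P M (s 0) (s 1) (s 2) (s 3))" "F1 f0" "F1 f1" "F1 f2" "F1 f3"
  shows "S1 (\<lambda>M s. P M (f0 M s) (f1 M s) (f2 M s) (f3 M s))"
proof -
  have "S1 (\<lambda>M s. \<exists>y0 y1 y2 y3. y0 = f0 M s \<and> y1 = f1 M s \<and> y2 = f2 M s \<and> y3 = f3 M s \<and> P M y0 y1 y2 y3)"
    using S1_ren[OF assms(1), of "case_nat 3 (case_nat 2 (case_nat 1 (case_nat 0 (\<lambda>_. 0))))"]
    by (intro S1_ex S1_and
      F1_at[OF assms(2), of "(Suc (Suc (Suc 0)))" "\<lambda>n. Suc (Suc (Suc (Suc n)))"]
      F1_at[OF assms(3), of "(Suc (Suc 0))" "\<lambda>n. Suc (Suc (Suc (Suc n)))"]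
      F1_at[OF assms(4), of "(Suc 0)" "\<lambda>n. Suc (Suc (Suc (Suc n)))"]
      F1_at[OF assms(5), of "0" "\<lambda>n. Suc (Suc (Suc (Suc n)))"])
      (simp add: eval_nat_numeral)
  then show ?thesis by simp
qed

lemma D1_subst4:
  assumes "D1 (\<lambda>M s. P M (s 0) (s 1) (s 2) (s 3))" "F1 f0" "F1 f1" "F1 f2" "F1 f3"
  shows "D1 (\<lambda>M s. P M (f0 M s) (f1 M s) (f2 M s) (f3 M s))"
  using S1_subst4[of P, OF _ assms(2-)] S1_subst4[of "\<lambda>M y0 y1 y2 y3. \<not> P M y0 y1 y2 y3", OF _ assms(2-)]
    assms(1) unfolding D1_def by simp

lemma F1_subst1:
  assumes "F1 (\<lambda>M s. h M (s 0))" "F1 f0"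
  shows "F1 (\<lambda>M s. h M (f0 M s))"
proof -
  have "S1 (\<lambda>M s. s 0 = h M (s 1))"
    using assms(1) by (simp add: F1_def eval_nat_numeral)
  then show ?thesis
    unfolding F1_def by (rule S1_subst2[where P = "\<lambda>M x y0. x = h M y0", OF _ F1_trm[OF trm_var] F1_ren[OF assms(2)]])
qed

lemma F1_subst2:
  assumes "F1 (\<lambda>M s. h M (s 0) (s 1))" "F1 f0" "F1 f1"
  shows "F1 (\<lambda>M s. h M (f0 M s) (f1 M s))"
proof -
  have "S1 (\<lambda>M s. s 0 = h M (s 1) (s 2))"
    using assms(1) by (simp add: F1_def eval_nat_numeral)
  then show ?thesis
    unfolding F1_def by (rule S1_subst3[where P = "\<lambda>M x y0 y1. x = h M y0 y1", OF _ F1_trm[OF trm_var] F1_ren[OF assms(2)] F1_ren[OF assms(3)]])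
qed

lemmas F1_var = F1_trm[OF trm_var]
  and F1_zero = F1_trm[OF trm_zero]
  and F1_one = F1_trm[OF trm_one]

lemma F1_add: "F1 f \<Longrightarrow> F1 g \<Longrightarrow> F1 (\<lambda>M s. f M s \<oplus>\<^bsub>M\<^esub> g M s)"
  by (rule F1_subst2[where h = "add", OF F1_trm]) (intro trm_intros)

lemma F1_mult: "F1 f \<Longrightarrow> F1 g \<Longrightarrow> F1 (\<lambda>M s. f M s \<otimes>\<^bsub>M\<^esub> g M s)"
  by (rule F1_subst2[where h = "mult", OF F1_trm]) (intro trm_intros)

lemmas F1_intros = F1_var F1_zero F1_one F1_add F1_mult

lemma D1_D0: "D0 P \<Longrightarrow> D1 P"
  unfolding D1_def by (intro conjI S1_D0 D0_not)

lemma S1_D1: "D1 P \<Longrightarrow> S1 P"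
  unfolding D1_def by simp

lemma S1_not: "D1 P \<Longrightarrow> S1 (\<lambda>M s. \<not> P M s)"
  unfolding D1_def by simp

lemma D1_eq: "F1 f \<Longrightarrow> F1 g \<Longrightarrow> D1 (\<lambda>M s. f M s = g M s)"
  by (rule D1_subst2[where P = "\<lambda>M. (=)", OF D1_D0]) (intro D0_eq trm_intros)

lemma D1_less: "F1 f \<Longrightarrow> F1 g \<Longrightarrow> D1 (\<lambda>M s. f M s \<prec>\<^bsub>M\<^esub> g M s)"
  by (rule D1_subst2[where P = "less", OF D1_D0]) (intro D0_less trm_intros)

lemma D1_not: "D1 P \<Longrightarrow> D1 (\<lambda>M s. \<not> P M s)"
  unfolding D1_def by simp

lemma D1_and: "D1 P \<Longrightarrow> D1 Q \<Longrightarrow> D1 (\<lambda>M s. P M s \<and> Q M s)"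
  using S1_and[of P Q] S1_or[of "\<lambda>M s. \<not> P M s" "\<lambda>M s. \<not> Q M s"] unfolding D1_def by simp

lemma D1_or: "D1 P \<Longrightarrow> D1 Q \<Longrightarrow> D1 (\<lambda>M s. P M s \<or> Q M s)"
  using S1_or[of P Q] S1_and[of "\<lambda>M s. \<not> P M s" "\<lambda>M s. \<not> Q M s"] unfolding D1_def by simp

lemma D1_cong: "D1 P \<Longrightarrow> (\<And>M s. model M \<Longrightarrow> P M s = Q M s) \<Longrightarrow> D1 Q"
  unfolding D1_def by (metis (mono_tags, lifting) S1_cong)

lemma D1_imp: "D1 P \<Longrightarrow> D1 Q \<Longrightarrow> D1 (\<lambda>M s. P M s \<longrightarrow> Q M s)"
  by (rule D1_cong[OF D1_or[OF D1_not]]) auto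

lemma D1_iff: assumes "D1 P" "D1 Q" shows "D1 (\<lambda>M s. P M s \<longleftrightarrow> Q M s)"
  by (rule D1_cong[OF D1_and[OF D1_imp[OF assms] D1_imp[OF assms(2,1)]]]) auto

lemma D1_le: "F1 f \<Longrightarrow> F1 g \<Longrightarrow> D1 (\<lambda>M s. f M s \<preceq>\<^bsub>M\<^esub> g M s)"
  unfolding le_def by (intro D1_or D1_less D1_eq)

lemma S1_ball:
  assumes "F1 f" "S1 (\<lambda>M s. P M (s 0) (\<lambda>n. s (Suc n)))"
  shows "S1 (\<lambda>M s. \<forall>x. x \<prec>\<^bsub>M\<^esub> f M s \<longrightarrow> P M x s)"
proof -
  have "S1 (\<lambda>M s. P M (s 0) (\<lambda>n. s (Suc (Suc n))))"
    using S1_ren[OF assms(2), of "case_nat 0 (\<lambda>n. Suc (Suc n))"] by simp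
  then have "S1 (\<lambda>M s. \<exists>y. y = f M s \<and> (\<forall>x. x \<prec>\<^bsub>M\<^esub> y \<longrightarrow> P M x s))"
    by (intro S1_ex S1_and F1_at[OF assms(1), of 0 Suc] S1_ball_trm trm_intros)
  then show ?thesis by simp
qed

lemma S1_imp: "D1 P \<Longrightarrow> S1 Q \<Longrightarrow> S1 (\<lambda>M s. P M s \<longrightarrow> Q M s)"
  by (rule S1_cong[OF S1_or[OF S1_not]]) auto

lemma S1_bex:
  assumes "F1 f" "S1 (\<lambda>M s. P M (s 0) (\<lambda>n. s (Suc n)))"
  shows "S1 (\<lambda>M s. \<exists>x. x \<prec>\<^bsub>M\<^esub> f M s \<and> P M x s)"
  by (intro S1_ex S1_and S1_D1[OF D1_less] F1_ren[OF assms(1)] F1_intros assms)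

lemma D1_bex:
  assumes "F1 f" "D1 (\<lambda>M s. P M (s 0) (\<lambda>n. s (Suc n)))"
  shows "D1 (\<lambda>M s. \<exists>x. x \<prec>\<^bsub>M\<^esub> f M s \<and> P M x s)"
proof -
  have "S1 (\<lambda>M s. \<forall>x. x \<prec>\<^bsub>M\<^esub> f M s \<longrightarrow> \<not> P M x s)"
    using assms unfolding D1_def by (intro S1_ball) auto
  then show ?thesis using S1_bex[of f P] assms unfolding D1_def by simp
qed

lemma D1_ball:
  assumes "F1 f" "D1 (\<lambda>M s. P M (s 0) (\<lambda>n. s (Suc n)))"
  shows "D1 (\<lambda>M s. \<forall>x. x \<prec>\<^bsub>M\<^esub> f M s \<longrightarrow> P M x s)"
  by (rule D1_cong[OF D1_not[OF D1_bex[OF assms(1) D1_not[OF assms(2)]]]]) auto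

lemmas D1_intros = D1_eq D1_less D1_le D1_not D1_and D1_or D1_imp D1_iff D1_bex D1_ball
lemmas S1_intros = S1_D1[OF D1_eq] S1_D1[OF D1_less] S1_D1[OF D1_le] S1_not S1_and S1_or S1_imp
  S1_ex S1_ball

section \<open>Least and greatest elements and collection for Sigma1 relations\<close>

context model
begin

text \<open>The usual argument inducts on the absence of elements below a point, a Pi1 statement.
  Counting down stays Sigma1: without a least element there is, for each \<open>x\<close>, an
  element of \<open>P\<close> that lies at least \<open>x\<close> below \<open>a\<close>.\<close>

lemma S1_least:
  assumes "S1 (\<lambda>M s. P M (s 0) (\<lambda>n. s (Suc n)))" "P M a s"
  shows "\<exists>x. P M x s \<and> (\<forall>y. y \<prec> x \<longrightarrow> \<not> P M y s)"
proof (rule ccontr)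
  assume *: "\<not> ?thesis"
  let ?Q = "\<lambda>M x s. \<exists>y. P M y (\<lambda>n. s (Suc n)) \<and> y \<oplus>\<^bsub>M\<^esub> x \<preceq>\<^bsub>M\<^esub> s 0"
  have "?Q M (a \<oplus> \<one>) (case_nat a s)"
  proof (rule S1_induct[where P = ?Q])
    show "S1 (\<lambda>M s. ?Q M (s 0) (\<lambda>n. s (Suc n)))"
      using S1_ren[OF assms(1), of "case_nat 0 (\<lambda>n. n + 3)"]
      by (intro S1_intros F1_intros) (simp add: eval_nat_numeral)
    show "?Q M \<zero> (case_nat a s)" using assms(2) by auto
    fix x assume "?Q M x (case_nat a s)"
    then obtain y where y: "P M y s" "y \<oplus> x \<preceq> a" by auto
    with * obtain z where "P M z s" "z \<prec> y" by blast
    moreover from this y have "z \<oplus> (x \<oplus> \<one>) \<preceq> a"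
      by (metis Suc_le sr.add.assoc sr.add_strict_right_mono sr.le_less_trans sr.not_less)
    ultimately show "?Q M (x \<oplus> \<one>) (case_nat a s)" by auto
  qed
  then obtain y where "y \<oplus> (a \<oplus> \<one>) \<preceq> a" by auto
  then have "a \<prec> a" by (metis Suc_le le_ex sr.add.commute sr.order_trans)
  then show False by simp
qed

text \<open>Without a greatest element, the Sigma1 statement that some element of \<open>P\<close>
  is at least \<open>x\<close> would pass from \<open>x\<close> to \<open>x \<oplus> \<one>\<close>
  and so beyond \<open>e\<close>.\<close>

lemma S1_greatest:
  assumes "S1 (\<lambda>M s. P M (s 0) (\<lambda>n. s (Suc n)))" "P M a s" "\<And>x. P M x s \<Longrightarrow> x \<preceq> e"
  shows "\<exists>x. P M x s \<and> (\<forall>y. P M y s \<longrightarrow> y \<preceq> x)"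
proof (rule ccontr)
  assume *: "\<not> ?thesis"
  let ?Q = "\<lambda>M x s. \<exists>y. P M y s \<and> x \<preceq>\<^bsub>M\<^esub> y"
  have "?Q M (e \<oplus> \<one>) s"
  proof (rule S1_induct[where P = ?Q])
    show "S1 (\<lambda>M s. ?Q M (s 0) (\<lambda>n. s (Suc n)))"
      using S1_ren[OF assms(1), of "case_nat 0 (\<lambda>n. n + 2)"]
      by (intro S1_intros F1_intros) (simp add: eval_nat_numeral)
    show "?Q M \<zero> s" using assms(2) by auto
    fix x assume "?Q M x s"
    then show "?Q M (x \<oplus> \<one>) s" using * Suc_le sr.le_less_trans sr.not_less by meson
  qed
  then show False using assms(3) Suc_le sr.not_less sr.order_trans by blast
qed

lemma S1_collection:
  assumes "S1 (\<lambda>M s. R M (s 0) (s 1) (\<lambda>n. s (Suc (Suc n))))" "\<And>x. x \<prec> y \<Longrightarrow> \<exists>w. R M x w s"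
  shows "\<exists>B. \<forall>x. x \<prec> y \<longrightarrow> (\<exists>w. w \<prec> B \<and> R M x w s)"
proof -
  obtain Q where Q: "D0 Q"
    "\<And>M s. model M \<Longrightarrow> R M (s 0) (s 1) (\<lambda>n. s (Suc (Suc n))) = (\<exists>z. Q M (case_nat z s))"
    using assms(1) unfolding S1_def by auto
  have R: "R M x w s = (\<exists>z. Q M (case_nat z (case_nat x (case_nat w s))))" for x w
    using Q(2)[OF model_axioms, of "case_nat x (case_nat w s)"] by simp
  \<comment> \<open>\<open>D0_collection\<close> bounds a single witness. Here this witness is an
    element above both \<open>w\<close> and the hidden \<open>z\<close>.\<close>
  let ?Q = "\<lambda>M s. \<exists>w. w \<prec>\<^bsub>M\<^esub> s 0 \<and> (\<exists>z. z \<prec>\<^bsub>M\<^esub> s 0 \<and>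
    Q M (case_nat z (case_nat (s 1) (case_nat w (\<lambda>n. s (Suc (Suc n)))))))"
  have "D0 ?Q"
    apply (intro D0_bex trm_intros)
    apply (rule D0_renI[OF Q(1), of "case_nat 0 (case_nat 3 (case_nat 1 (\<lambda>n. n+4)))"])
    apply (auto split: nat.split simp: eval_nat_numeral)
    done
  moreover have "\<exists>z. ?Q M (case_nat z (case_nat x s))" if "x \<prec> y" for x
    using assms(2)[OF that] ub2 unfolding R by simp metis
  ultimately obtain B where B: "\<forall>x. x \<prec> y \<longrightarrow> (\<exists>z. z \<prec> B \<and> ?Q M (case_nat z (case_nat x s)))"
    using D0_collection[of ?Q y s] by blast
  have "\<exists>w. w \<prec> B \<and> R M x w s" if "x \<prec> y" for x
  proof -
    from B that obtain z where z: "z \<prec> B" "?Q M (case_nat z (case_nat x s))" by blast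
    then obtain w z' where "w \<prec> z" "Q M (case_nat z' (case_nat x (case_nat w s)))" by auto
    with z R sr.less_trans show ?thesis by blast
  qed
  then show ?thesis by blast
qed

end

section \<open>Pairing and Goedel's beta function\<close>

text \<open>A polynomial pairing, hence available as a term: the value lies between
  \<open>(x + y)^2\<close> and the next square, which determines \<open>x + y\<close> and then
  \<open>x\<close>.\<close>

definition pair :: "'a arith_struct \<Rightarrow> 'a \<Rightarrow> 'a \<Rightarrow> 'a" where
  "pair M x y = (x \<oplus>\<^bsub>M\<^esub> y) \<otimes>\<^bsub>M\<^esub> (x \<oplus>\<^bsub>M\<^esub> y) \<oplus>\<^bsub>M\<^esub> x"

lemma F1_pair: "F1 f \<Longrightarrow> F1 g \<Longrightarrow> F1 (\<lambda>M s. pair M (f M s) (g M s))"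
  unfolding pair_def by (intro F1_intros)

definition exp2 :: "'a arith_struct \<Rightarrow> 'a \<Rightarrow> 'a" where
  "exp2 M x = (THE y. exp_graph M x y)"

context model
begin

lemmas alg = sr.distrib_left sr.distrib_right sr.add.assoc sr.add.commute sr.add.left_commute
  sr.mult.assoc sr.mult.commute sr.mult.left_commute

lemma le_add1 [simp]: "x \<preceq> x \<oplus> y" and le_add2 [simp]: "x \<preceq> y \<oplus> x"
  using le_ex sr.add.commute by blast+

lemma le_square: "x \<preceq> x \<otimes> x"
  using zero_or_Suc[of x]
proof
  assume "\<exists>y. x = y \<oplus> \<one>"
  then obtain y where "x = y \<oplus> \<one>" ..
  then have "x \<otimes> x = x \<oplus> y \<otimes> x" by (simp add: alg)
  then show ?thesis using le_ex by blast
qed simp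

lemma pair_ge: "x \<preceq> pair M x y" "y \<preceq> pair M x y"
  unfolding pair_def using le_square[of "x \<oplus> y"] le_add1 le_add2 sr.order_trans by meson+

lemma pair_gt: "x \<noteq> \<zero> \<Longrightarrow> y \<prec> pair M x y"
  unfolding pair_def using le_square[of "x \<oplus> y"]
  by (metis le_add2 le_def sr.add_cancel_right_right sr.le_less_trans sr.less_add_same_cancel1 zero_le
      sr.order_trans)

lemma pair_mono: "x \<preceq> x' \<Longrightarrow> y \<preceq> y' \<Longrightarrow> pair M x y \<preceq> pair M x' y'"
  unfolding pair_def by (intro sr.add_mono sr.mult_mono) auto

lemma less_ex: "x \<prec> y \<longleftrightarrow> (\<exists>d. y = x \<oplus> d \<oplus> \<one>)"
proof
  assume "x \<prec> y"
  then have "x \<oplus> \<one> \<preceq> y" by (simp add: Suc_le)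
  then show "\<exists>d. y = x \<oplus> d \<oplus> \<one>" using le_ex by (metis sr.add.commute sr.add.left_commute)
qed (auto simp: less_Suc)

lemma pair_sum_less: "x \<oplus> y \<prec> x' \<oplus> y' \<Longrightarrow> pair M x y \<prec> pair M x' y'"
proof -
  assume "x \<oplus> y \<prec> x' \<oplus> y'"
  then obtain d where "x' \<oplus> y' = x \<oplus> y \<oplus> d \<oplus> \<one>" using less_ex by auto
  then have "pair M x' y' = pair M x y \<oplus> (d \<otimes> d \<oplus> (x \<oplus> y) \<otimes> (d \<oplus> d) \<oplus> y \<oplus> (x \<oplus> y) \<oplus> (d \<oplus> d) \<oplus> x') \<oplus> \<one>"
    by (simp add: pair_def alg)
  then show ?thesis using less_ex by blast
qed

lemma pair_inject [simp]: "pair M x y = pair M x' y' \<longleftrightarrow> x = x' \<and> y = y'"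
proof
  assume *: "pair M x y = pair M x' y'"
  then have "x \<oplus> y = x' \<oplus> y'"
    using pair_sum_less sr.less_irrefl sr.neq_iff by metis
  with * show "x = x' \<and> y = y'" unfolding pair_def by auto
qed auto

section \<open>Division with remainder and the beta function\<close>

lemma div_ex: assumes "m \<noteq> \<zero>" shows "\<exists>q r. r \<prec> m \<and> a = q \<otimes> m \<oplus> r"
proof -
  let ?P = "\<lambda>M a s. \<exists>q r. r \<prec>\<^bsub>M\<^esub> s 0 \<and> a = q \<otimes>\<^bsub>M\<^esub> s 0 \<oplus>\<^bsub>M\<^esub> r"
  have "?P M a (\<lambda>_. m)"
  proof (rule S1_induct[where P = ?P])
    show "S1 (\<lambda>M s. ?P M (s 0) (\<lambda>n. s (Suc n)))" by (intro S1_intros F1_intros)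
    show "?P M \<zero> (\<lambda>_. m)" using assms by (metis sr.add_0_right sr.mult_zero_left zero_le le_def)
    fix a assume "?P M a (\<lambda>_. m)"
    then obtain q r where r: "r \<prec> m" "a = q \<otimes> m \<oplus> r" by blast
    show "?P M (a \<oplus> \<one>) (\<lambda>_. m)"
    proof (cases "r \<oplus> \<one> = m")
      case True
      have "a \<oplus> \<one> = q \<otimes> m \<oplus> (r \<oplus> \<one>)" using r by (simp only: sr.add.assoc)
      then have "a \<oplus> \<one> = (q \<oplus> \<one>) \<otimes> m \<oplus> \<zero>" unfolding True by (simp add: sr.distrib_right)
      then show ?thesis using r by (metis le_def sr.le_less_trans zero_le)
    next
      case False
      then have "r \<oplus> \<one> \<prec> m" using r Suc_le le_def by metis
      then show ?thesis using r sr.add.assoc by metis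
    qed
  qed
  then show ?thesis .
qed

lemma div_unique_le:
  assumes "q \<otimes> m \<oplus> r = q' \<otimes> m \<oplus> r'" "r \<prec> m" shows "q' \<preceq> q"
proof (rule ccontr)
  assume "\<not> q' \<preceq> q"
  then obtain d where "q' = q \<oplus> d \<oplus> \<one>" using less_ex sr.not_less by blast
  with assms(1) have "q \<otimes> m \<oplus> r = q \<otimes> m \<oplus> (m \<oplus> (d \<otimes> m \<oplus> r'))" by (simp add: alg)
  then have "r = m \<oplus> (d \<otimes> m \<oplus> r')" using add_lcancel by blast
  then show False using assms(2) le_add1 sr.not_less by metis
qed

lemma div_unique:
  assumes "q \<otimes> m \<oplus> r = q' \<otimes> m \<oplus> r'" "r \<prec> m" "r' \<prec> m" shows "q = q'" "r = r'"
proof -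
  show "q = q'" using div_unique_le[OF assms(1,2)] div_unique_le[OF assms(1)[symmetric] assms(3)]
    by (rule sr.order.antisym[rotated])
  then show "r = r'" using assms(1) add_lcancel by blast
qed

lemma beta_graph_iff: "beta_graph M a b i r \<longleftrightarrow>
    r \<prec> \<one> \<oplus> (i \<oplus> \<one>) \<otimes> b \<and> (\<exists>q. a = q \<otimes> (\<one> \<oplus> (i \<oplus> \<one>) \<otimes> b) \<oplus> r)"
  by (simp add: beta_graph_def carrier_UNIV Let_def)

lemma modulus_nonzero: "\<one> \<oplus> x \<noteq> \<zero>"
  by (metis le_add1 sr.not_le sr.zero_less_one)

lemma beta_ex: "\<exists>r. beta_graph M a b i r"
  using div_ex[OF modulus_nonzero] unfolding beta_graph_iff by metis

lemma beta_unique: "beta_graph M a b i r \<Longrightarrow> beta_graph M a b i r' \<Longrightarrow> r = r'"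
  unfolding beta_graph_iff using div_unique(2) by metis

end

lemma S1_beta_aux: "S1 (\<lambda>M s. beta_graph M (s 0) (s 1) (s 2) (s 3))"
proof -
  have "S1 (\<lambda>M s. s 3 \<prec>\<^bsub>M\<^esub> \<one>\<^bsub>M\<^esub> \<oplus>\<^bsub>M\<^esub> (s 2 \<oplus>\<^bsub>M\<^esub> \<one>\<^bsub>M\<^esub>) \<otimes>\<^bsub>M\<^esub> s 1 \<and>
    (\<exists>q. s 0 = q \<otimes>\<^bsub>M\<^esub> (\<one>\<^bsub>M\<^esub> \<oplus>\<^bsub>M\<^esub> (s 2 \<oplus>\<^bsub>M\<^esub> \<one>\<^bsub>M\<^esub>) \<otimes>\<^bsub>M\<^esub> s 1) \<oplus>\<^bsub>M\<^esub> s 3))"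
    by (intro S1_intros F1_intros)
  then show ?thesis by (rule S1_cong) (simp add: model.beta_graph_iff)
qed

lemmas S1_beta = S1_subst4[where P = beta_graph, OF S1_beta_aux]

section \<open>Chinese remaindering: extending a coded sequence\<close>

context model
begin

text \<open>A substitute for the factorial in the theory of the beta function: the induction only
  needs that some \<open>D\<close> exists, and its step multiplies \<open>D\<close> by
  \<open>x \<oplus> \<one>\<close>.\<close>

lemma common_multiple: "\<exists>D. D \<noteq> \<zero> \<and> (\<forall>i. i \<prec> x \<longrightarrow> (\<exists>t. D = (i \<oplus> \<one>) \<otimes> t))"
proof -
  let ?P = "\<lambda>M x s. \<exists>D. D \<noteq> \<zero>\<^bsub>M\<^esub> \<and> (\<forall>i. i \<prec>\<^bsub>M\<^esub> x \<longrightarrow> (\<exists>t. D = (i \<oplus>\<^bsub>M\<^esub> \<one>\<^bsub>M\<^esub>) \<otimes>\<^bsub>M\<^esub> t))"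
  have "?P M x (\<lambda>_. \<zero>)"
  proof (rule S1_induct[where P = ?P])
    show "S1 (\<lambda>M s. ?P M (s 0) (\<lambda>n. s (Suc n)))" by (intro S1_intros D1_intros F1_intros)
    show "?P M \<zero> (\<lambda>_. \<zero>)" using sr.zero_neq_one not_less_zero by metis
    fix x assume "?P M x (\<lambda>_. \<zero>)"
    then obtain D where D: "D \<noteq> \<zero>" "\<And>i. i \<prec> x \<Longrightarrow> \<exists>t. D = (i \<oplus> \<one>) \<otimes> t" by blast
    have "\<exists>t. D \<otimes> (x \<oplus> \<one>) = (i \<oplus> \<one>) \<otimes> t" if "i \<prec> x \<oplus> \<one>" for i
    proof (cases "i = x")
      case False
      then have "i \<prec> x" using that less_Suc le_def by metis
      then obtain t where "D = (i \<oplus> \<one>) \<otimes> t" using D(2) by blast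
      then show ?thesis using sr.mult.assoc by metis
    qed (use sr.mult.commute in blast)
    moreover have "D \<otimes> (x \<oplus> \<one>) \<noteq> \<zero>" using D(1) modulus_nonzero sr.add.commute mult_pos by metis
    ultimately show "?P M (x \<oplus> \<one>) (\<lambda>_. \<zero>)" by blast
  qed
  then show ?thesis .
qed

text \<open>
  For the moduli \<open>m\<^sub>i = 1 + (i + 1) b\<close> one has \<open>(j + 1) m\<^sub>i = (i + 1) m\<^sub>j + (j - i)\<close>. If \<open>j - i\<close> divides
  \<open>b\<close>, it is invertible modulo \<open>m\<^sub>j\<close>, because \<open>(j + 1) b\<close> is \<open>-1\<close> there. Negative residues are
  avoided by writing \<open>-1\<close> as \<open>m\<^sub>j - 1 = (j + 1) b\<close>.
\<close>

lemma moduli_coprime: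
  assumes "j = i \<oplus> \<delta>" "b = \<delta> \<otimes> t" "b \<noteq> \<zero>"
  shows "\<exists>u v. u \<otimes> (\<one> \<oplus> (i \<oplus> \<one>) \<otimes> b) = v \<otimes> (\<one> \<oplus> (j \<oplus> \<one>) \<otimes> b) \<oplus> \<one>"
proof -
  let ?mi = "\<one> \<oplus> (i \<oplus> \<one>) \<otimes> b" and ?mj = "\<one> \<oplus> (j \<oplus> \<one>) \<otimes> b" and ?w = "(j \<oplus> \<one>) \<otimes> b"
  let ?A = "(i \<oplus> \<one>) \<otimes> (j \<oplus> \<one>) \<otimes> t"
  obtain w where w: "?w = w \<oplus> \<one>"
    using zero_or_Suc[of ?w] assms(3) modulus_nonzero sr.add.commute mult_pos by metis
  have aux: "X \<otimes> y \<otimes> p = (A \<otimes> y \<oplus> w) \<otimes> q \<oplus> \<one>"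
    if "p \<otimes> X \<otimes> y = q \<otimes> (A \<otimes> y) \<oplus> (w \<otimes> q \<oplus> \<one>)" for p q X y A
    using that by (simp add: alg)
  have "?mi \<otimes> (j \<oplus> \<one>) = ?mj \<otimes> (i \<oplus> \<one>) \<oplus> \<delta>" using assms(1) by (simp add: alg)
  then have "?mi \<otimes> (j \<oplus> \<one>) \<otimes> ((j \<oplus> \<one>) \<otimes> t) = (?mj \<otimes> (i \<oplus> \<one>) \<oplus> \<delta>) \<otimes> ((j \<oplus> \<one>) \<otimes> t)" by simp
  also have "\<dots> = ?mj \<otimes> ?A \<oplus> (j \<oplus> \<one>) \<otimes> (\<delta> \<otimes> t)"
    by (simp only: sr.distrib_right sr.mult.assoc sr.mult.left_commute)
  also have "\<dots> = ?mj \<otimes> ?A \<oplus> ?w" by (simp only: assms(2)[symmetric])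
  finally have "?mi \<otimes> ((j \<oplus> \<one>) \<otimes> ((j \<oplus> \<one>) \<otimes> t)) \<otimes> ?w = (?mj \<otimes> ?A \<oplus> ?w) \<otimes> ?w"
    by (simp only: sr.mult.assoc)
  also have "\<dots> = ?mj \<otimes> (?A \<otimes> ?w) \<oplus> ?w \<otimes> ?w"
    by (simp only: sr.distrib_right sr.mult.assoc)
  also have "?w \<otimes> ?w = w \<otimes> ?mj \<oplus> \<one>" unfolding w by (simp add: alg del: sr.one_add_one)
  finally have "((j \<oplus> \<one>) \<otimes> ((j \<oplus> \<one>) \<otimes> t)) \<otimes> ?w \<otimes> ?mi = (?A \<otimes> ?w \<oplus> w) \<otimes> ?mj \<oplus> \<one>"
    by (rule aux)
  then show ?thesis by blast
qed

text \<open>\<open>u\<close> inverts \<open>P\<close> modulo \<open>m\<close>, and \<open>w\<close>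
  is \<open>-1\<close> modulo \<open>m\<close>. Adding \<open>P\<close> times \<open>u\<close> times
  \<open>r - \<rho>\<close> changes the residue of \<open>a\<close> from \<open>\<rho>\<close> to
  \<open>r\<close>; the summand \<open>\<rho> \<otimes> w\<close> stands for
  \<open>-\<rho>\<close>.\<close>

lemma crt_step:
  assumes a: "a = q \<otimes> m \<oplus> \<rho>" and m: "m = \<one> \<oplus> w" and u: "u \<otimes> P = v \<otimes> m \<oplus> \<one>"
  shows "a \<oplus> P \<otimes> (u \<otimes> (r \<oplus> \<rho> \<otimes> w)) = (q \<oplus> v \<otimes> (r \<oplus> \<rho> \<otimes> w) \<oplus> \<rho>) \<otimes> m \<oplus> r"
proof -
  have "P \<otimes> (u \<otimes> (r \<oplus> \<rho> \<otimes> w)) = (u \<otimes> P) \<otimes> (r \<oplus> \<rho> \<otimes> w)"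
    by (simp only: sr.mult.assoc sr.mult.commute sr.mult.left_commute)
  also have "\<dots> = v \<otimes> (r \<oplus> \<rho> \<otimes> w) \<otimes> m \<oplus> (r \<oplus> \<rho> \<otimes> w)"
    unfolding u by (simp add: alg)
  finally show ?thesis unfolding a by (simp add: m alg)
qed

lemma coprime_mult:
  assumes "u \<otimes> P = v \<otimes> m \<oplus> \<one>" "u' \<otimes> P' = v' \<otimes> m \<oplus> \<one>"
  shows "(u \<otimes> u') \<otimes> (P \<otimes> P') = (v \<otimes> v' \<otimes> m \<oplus> v \<oplus> v') \<otimes> m \<oplus> \<one>"
proof -
  have "(u \<otimes> u') \<otimes> (P \<otimes> P') = (u \<otimes> P) \<otimes> (u' \<otimes> P')"
    by (simp only: sr.mult.assoc sr.mult.commute sr.mult.left_commute)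
  then show ?thesis unfolding assms by (simp add: alg)
qed

text \<open>The old moduli may be too small or not coprime to each other, so the extended sequence
  is coded afresh by Chinese remaindering over new moduli.\<close>

lemma beta_append:
  "\<exists>a' b'. (\<forall>i r. i \<preceq> x \<longrightarrow> beta_graph M a b i r \<longrightarrow> beta_graph M a' b' i r) \<and>
    beta_graph M a' b' (x \<oplus> \<one>) y"
proof -
  obtain D where D: "D \<noteq> \<zero>" "\<And>i. i \<prec> x \<oplus> \<one> \<Longrightarrow> \<exists>t. D = (i \<oplus> \<one>) \<otimes> t"
    using common_multiple by blast
  \<comment> \<open>\<open>D\<close> makes every positive difference of indices up to
    \<open>x \<oplus> \<one>\<close> divide \<open>b'\<close>, hence the moduli coprime; the other
    factor makes them exceed the old entries and \<open>y\<close>.\<close>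
  define b' where "b' = D \<otimes> (b \<oplus> y \<oplus> \<one>)"
  define m where "m i = \<one> \<oplus> (i \<oplus> \<one>) \<otimes> b'" for i
  define R where "R i r \<longleftrightarrow> (if i \<preceq> x then beta_graph M a b i r else r = y)" for i r
  have b'0: "b' \<noteq> \<zero>"
    unfolding b'_def using D(1) modulus_nonzero sr.add.commute mult_pos by metis
  have "b \<oplus> y \<oplus> \<one> \<preceq> b'"
  proof -
    obtain d where "D = d \<oplus> \<one>" using D(1) zero_or_Suc by blast
    then have "b' = b \<oplus> y \<oplus> \<one> \<oplus> d \<otimes> (b \<oplus> y \<oplus> \<one>)"
      unfolding b'_def by (simp add: alg del: sr.one_add_one)
    then show ?thesis using le_ex by blast
  qed
  then have "b \<preceq> b'" and y_less: "y \<prec> b'"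
    by (meson le_add1 le_add2 sr.order_trans, meson le_add2 less_Suc sr.less_le_trans)
  have b'_less: "b' \<prec> m i" for i
    unfolding m_def by (simp add: less_Suc sr.add.commute[of \<one>] sr.distrib_right)
  have R_less: "r \<prec> m i" if "R i r" for i r
  proof (cases "i \<preceq> x")
    case True
    have "\<one> \<oplus> (i \<oplus> \<one>) \<otimes> b \<preceq> m i"
      unfolding m_def using \<open>b \<preceq> b'\<close> by (intro sr.add_mono sr.mult_mono) auto
    then show ?thesis using that True sr.less_le_trans unfolding R_def beta_graph_iff by auto
  next
    case False
    then show ?thesis using that y_less b'_less sr.less_trans unfolding R_def by metis
  qed
  have R_ex: "\<exists>r. R i r" for i unfolding R_def using beta_ex[of a b i] by auto
  have coprime: "\<exists>u v. u \<otimes> m i = v \<otimes> m j \<oplus> \<one>" if "i \<prec> j" "j \<preceq> x \<oplus> \<one>" for i j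
  proof -
    obtain d where d: "j = i \<oplus> (d \<oplus> \<one>)" using less_ex \<open>i \<prec> j\<close> sr.add.assoc by metis
    then have "d \<prec> x \<oplus> \<one>"
      using that(2) by (metis le_add2 less_Suc sr.add.assoc sr.less_le_trans)
    then obtain t where "D = (d \<oplus> \<one>) \<otimes> t" using D(2) by blast
    then have "b' = (d \<oplus> \<one>) \<otimes> (t \<otimes> (b \<oplus> y \<oplus> \<one>))" unfolding b'_def by (simp only: sr.mult.assoc)
    then show ?thesis using moduli_coprime[OF d _ b'0] unfolding m_def by blast
  qed
  let ?m = "\<lambda>M i b'. \<one>\<^bsub>M\<^esub> \<oplus>\<^bsub>M\<^esub> (i \<oplus>\<^bsub>M\<^esub> \<one>\<^bsub>M\<^esub>) \<otimes>\<^bsub>M\<^esub> b'"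
  let ?s = "(!) [a, b, b', x, y]"
  \<comment> \<open>This is the predicate \<open>Cd\<close> introduced next, written as a uniform
    relation with \<open>a\<close>, \<open>b\<close>, \<open>b'\<close>, \<open>x\<close>,
    \<open>y\<close> as parameters 0 to 4.\<close>
  let ?P = "\<lambda>M k s. s 3 \<oplus>\<^bsub>M\<^esub> \<one>\<^bsub>M\<^esub> \<oplus>\<^bsub>M\<^esub> \<one>\<^bsub>M\<^esub> \<prec>\<^bsub>M\<^esub> k \<or> (\<exists>a' P.
      (\<forall>i. i \<prec>\<^bsub>M\<^esub> k \<longrightarrow> (\<exists>r. (i \<preceq>\<^bsub>M\<^esub> s 3 \<and> beta_graph M (s 0) (s 1) i r \<or> \<not> i \<preceq>\<^bsub>M\<^esub> s 3 \<and> r = s 4)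
        \<and> (\<exists>q. a' = q \<otimes>\<^bsub>M\<^esub> ?m M i (s 2) \<oplus>\<^bsub>M\<^esub> r))) \<and>
      (\<forall>i. i \<prec>\<^bsub>M\<^esub> k \<longrightarrow> (\<exists>t. P = t \<otimes>\<^bsub>M\<^esub> ?m M i (s 2))) \<and>
      (\<forall>j. j \<prec>\<^bsub>M\<^esub> s 3 \<oplus>\<^bsub>M\<^esub> \<one>\<^bsub>M\<^esub> \<oplus>\<^bsub>M\<^esub> \<one>\<^bsub>M\<^esub> \<longrightarrow> (j \<prec>\<^bsub>M\<^esub> k \<or> (\<exists>u v. u \<otimes>\<^bsub>M\<^esub> P = v \<otimes>\<^bsub>M\<^esub> ?m M j (s 2) \<oplus>\<^bsub>M\<^esub> \<one>\<^bsub>M\<^esub>))))"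
  \<comment> \<open>\<open>P\<close> stands for the product of the first \<open>k\<close> moduli.
    Instead of coding a product, the invariant keeps the two properties that are used: divisibility
    by the moduli already treated and invertibility modulo the remaining ones.\<close>
  define C where "C k a' P \<longleftrightarrow> (\<forall>i. i \<prec> k \<longrightarrow> (\<exists>r. R i r \<and> (\<exists>q. a' = q \<otimes> m i \<oplus> r))) \<and>
      (\<forall>i. i \<prec> k \<longrightarrow> (\<exists>t. P = t \<otimes> m i)) \<and>
      (\<forall>j. j \<preceq> x \<oplus> \<one> \<longrightarrow> j \<prec> k \<or> (\<exists>u v. u \<otimes> P = v \<otimes> m j \<oplus> \<one>))" for k a' P
  define Cd where "Cd k \<longleftrightarrow> x \<oplus> \<one> \<oplus> \<one> \<prec> k \<or> (\<exists>a' P. C k a' P)" for k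
  have P: "?P M k ?s = Cd k" for k
    by (simp add: Cd_def C_def m_def R_def if_bool_eq_disj less_Suc cong: conj_cong)
  have base: "Cd \<zero>"
  proof -
    have "\<one> \<otimes> \<one> = \<zero> \<otimes> m j \<oplus> \<one>" for j by simp
    then have "C \<zero> \<zero> \<one>" unfolding C_def by (metis not_less_zero)
    then show ?thesis unfolding Cd_def by blast
  qed
  have step: "Cd (k \<oplus> \<one>)" if Cd: "Cd k" for k
  proof -
    from Cd show ?thesis unfolding Cd_def[of k]
    proof (elim disjE exE)
      assume "x \<oplus> \<one> \<oplus> \<one> \<prec> k"
      then have "x \<oplus> \<one> \<oplus> \<one> \<prec> k \<oplus> \<one>" using le_add1 sr.less_le_trans by blast
      then show ?thesis unfolding Cd_def by (rule disjI1)
    next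
      fix a' P assume "C k a' P"
      then have C1: "\<And>i. i \<prec> k \<Longrightarrow> \<exists>r. R i r \<and> (\<exists>q. a' = q \<otimes> m i \<oplus> r)"
        and C2: "\<And>i. i \<prec> k \<Longrightarrow> \<exists>t. P = t \<otimes> m i"
        and C3: "\<And>j. j \<preceq> x \<oplus> \<one> \<Longrightarrow> \<not> j \<prec> k \<Longrightarrow> \<exists>u v. u \<otimes> P = v \<otimes> m j \<oplus> \<one>"
        unfolding C_def by blast+
      show ?thesis
      proof (cases "k \<preceq> x \<oplus> \<one>")
        case False
        then have "x \<oplus> \<one> \<prec> k" by simp
        then show ?thesis unfolding Cd_def by simp
      next
        case True
        then obtain u v where u: "u \<otimes> P = v \<otimes> m k \<oplus> \<one>" using C3 sr.less_irrefl by blast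
        obtain r where r: "R k r" using R_ex by blast
        obtain q \<rho> where q: "a' = q \<otimes> m k \<oplus> \<rho>" using div_ex[OF modulus_nonzero] unfolding m_def by blast
        define w where "w = (k \<oplus> \<one>) \<otimes> b'"
        define c where "c = u \<otimes> (r \<oplus> \<rho> \<otimes> w)"
        have new: "a' \<oplus> P \<otimes> c = (q \<oplus> v \<otimes> (r \<oplus> \<rho> \<otimes> w) \<oplus> \<rho>) \<otimes> m k \<oplus> r"
          unfolding c_def using crt_step[OF q _ u] by (simp add: m_def w_def)
        have "C (k \<oplus> \<one>) (a' \<oplus> P \<otimes> c) (P \<otimes> m k)"
          unfolding C_def
        proof (intro conjI allI impI)
          fix i assume i: "i \<prec> k \<oplus> \<one>"
          show "\<exists>r. R i r \<and> (\<exists>q. a' \<oplus> P \<otimes> c = q \<otimes> m i \<oplus> r)"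
          proof (cases "i = k")
            case True
            then show ?thesis using new r by blast
          next
            case False
            with i have "i \<prec> k" using less_Suc le_def by metis
            then obtain r' q' t where "R i r'" "a' = q' \<otimes> m i \<oplus> r'" "P = t \<otimes> m i"
              using C1 C2 by meson
            moreover from this have "a' \<oplus> P \<otimes> c = (q' \<oplus> t \<otimes> c) \<otimes> m i \<oplus> r'" by (simp add: alg)
            ultimately show ?thesis by blast
          qed
          show "\<exists>t. P \<otimes> m k = t \<otimes> m i"
          proof (cases "i = k")
            case False
            with i have "i \<prec> k" using less_Suc le_def by metis
            then obtain t where "P = t \<otimes> m i" using C2 by blast
            then have "P \<otimes> m k = (t \<otimes> m k) \<otimes> m i"
              by (simp only: sr.mult.assoc sr.mult.commute sr.mult.left_commute)
            then show ?thesis by blast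
          qed blast
        next
          fix j assume j: "j \<preceq> x \<oplus> \<one>"
          show "j \<prec> k \<oplus> \<one> \<or> (\<exists>u v. u \<otimes> (P \<otimes> m k) = v \<otimes> m j \<oplus> \<one>)"
          proof (cases "j \<preceq> k")
            case False
            then have "k \<prec> j" by simp
            moreover from C3 j False obtain u v where "u \<otimes> P = v \<otimes> m j \<oplus> \<one>"
              using sr.less_imp_le by blast
            ultimately show ?thesis using coprime_mult coprime[OF _ j] by blast
          qed (simp add: less_Suc)
        qed
        then show ?thesis unfolding Cd_def by blast
      qed
    qed
  qed
  have "?P M (x \<oplus> \<one> \<oplus> \<one>) ?s"
  proof (rule S1_induct[where P = ?P])
    show "S1 (\<lambda>M s. ?P M (s 0) (\<lambda>n. s (Suc n)))" by (intro S1_intros S1_beta D1_intros F1_intros)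
    show "?P M \<zero> ?s" by (simp only: P base)
    show "?P M (k \<oplus> \<one>) ?s" if "?P M k ?s" for k using that by (simp only: P step)
  qed
  then have "Cd (x \<oplus> \<one> \<oplus> \<one>)" by (simp only: P)
  then have "\<exists>a' P. C (x \<oplus> \<one> \<oplus> \<one>) a' P" unfolding Cd_def by simp
  then obtain a' P where a': "C (x \<oplus> \<one> \<oplus> \<one>) a' P" by blast
  have "beta_graph M a' b' i r" if "i \<preceq> x \<oplus> \<one>" "R i r" for i r
  proof -
    have "i \<prec> x \<oplus> \<one> \<oplus> \<one>" using that(1) by (simp only: less_Suc)
    then obtain r' q where "R i r'" "a' = q \<otimes> m i \<oplus> r'" using a' unfolding C_def by blast
    moreover have "r = r'" using that(2) \<open>R i r'\<close> beta_unique unfolding R_def by metis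
    ultimately show ?thesis using R_less[OF that(2)] unfolding beta_graph_iff m_def by blast
  qed
  moreover have "\<not> x \<oplus> \<one> \<preceq> x" by (simp add: Suc_le)
  moreover have "i \<preceq> x \<oplus> \<one>" if "i \<preceq> x" for i using that le_add1 sr.order_trans by blast
  ultimately have "(\<forall>i r. i \<preceq> x \<longrightarrow> beta_graph M a b i r \<longrightarrow> beta_graph M a' b' i r) \<and>
    beta_graph M a' b' (x \<oplus> \<one>) y" unfolding R_def by auto
  then show ?thesis by blast
qed

end

section \<open>Exponentiation and Ackermann membership\<close>

context model
begin

lemma exp_graph_iff: "exp_graph M x y \<longleftrightarrow> (\<exists>a b. beta_graph M a b \<zero> \<one> \<and>
    (\<forall>i. i \<prec> x \<longrightarrow> (\<exists>u. beta_graph M a b i u \<and> beta_graph M a b (i \<oplus> \<one>) (u \<oplus> u))) \<and>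
    beta_graph M a b x y)"
  by (simp add: exp_graph_def carrier_UNIV)

end

lemma S1_exp_graph_aux: "S1 (\<lambda>M s. exp_graph M (s 0) (s 1))"
proof -
  have "S1 (\<lambda>M s. \<exists>a b. beta_graph M a b \<zero>\<^bsub>M\<^esub> \<one>\<^bsub>M\<^esub> \<and>
    (\<forall>i. i \<prec>\<^bsub>M\<^esub> s 0 \<longrightarrow>
      (\<exists>u. beta_graph M a b i u \<and> beta_graph M a b (i \<oplus>\<^bsub>M\<^esub> \<one>\<^bsub>M\<^esub>) (u \<oplus>\<^bsub>M\<^esub> u))) \<and>
    beta_graph M a b (s 0) (s 1))"
    by (intro S1_intros S1_beta F1_intros)
  then show ?thesis by (rule S1_cong) (simp add: model.exp_graph_iff)
qed

lemmas S1_exp_graph = S1_subst2[where P = exp_graph, OF S1_exp_graph_aux]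

context model
begin

lemma exp_graph_zero: "exp_graph M \<zero> \<one>"
proof -
  have "beta_graph M \<one> \<one> \<zero> \<one>"
    unfolding beta_graph_iff by (auto simp: less_Suc intro: exI[of _ \<zero>] simp del: sr.one_add_one)
  then show ?thesis unfolding exp_graph_iff by auto
qed

lemma exp_graph_Suc: assumes "exp_graph M x y" shows "exp_graph M (x \<oplus> \<one>) (y \<oplus> y)"
proof -
  obtain a b where ab: "beta_graph M a b \<zero> \<one>" "beta_graph M a b x y"
    "\<And>i. i \<prec> x \<Longrightarrow> \<exists>u. beta_graph M a b i u \<and> beta_graph M a b (i \<oplus> \<one>) (u \<oplus> u)"
    using assms unfolding exp_graph_iff by blast
  obtain a' b' where ab': "\<And>i r. i \<preceq> x \<Longrightarrow> beta_graph M a b i r \<Longrightarrow> beta_graph M a' b' i r"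
    "beta_graph M a' b' (x \<oplus> \<one>) (y \<oplus> y)"
    using beta_append[of x a b "y \<oplus> y"] by blast
  have "\<exists>u. beta_graph M a' b' i u \<and> beta_graph M a' b' (i \<oplus> \<one>) (u \<oplus> u)" if "i \<prec> x \<oplus> \<one>" for i
  proof (cases "i = x")
    case True
    then show ?thesis using ab' ab(2) by auto
  next
    case False
    then have "i \<prec> x" using that less_Suc le_def by metis
    then show ?thesis using ab(3)[of i] ab'(1) Suc_le sr.less_imp_le by blast
  qed
  then show ?thesis unfolding exp_graph_iff using ab ab' by (metis zero_le)
qed

lemma exp_graph_ex: "\<exists>y. exp_graph M x y"
proof -
  let ?P = "\<lambda>M x s. \<exists>y. exp_graph M x y"
  have "?P M x (\<lambda>_. \<zero>)"
    by (rule S1_induct[where P = ?P])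
      (intro S1_intros S1_exp_graph F1_intros, blast intro: exp_graph_zero, blast dest: exp_graph_Suc)
  then show ?thesis .
qed

lemma exp_graph_unique: assumes "exp_graph M x y" "exp_graph M x y'" shows "y = y'"
proof -
  obtain a b where ab: "beta_graph M a b \<zero> \<one>" "beta_graph M a b x y"
    "\<And>i. i \<prec> x \<Longrightarrow> \<exists>u. beta_graph M a b i u \<and> beta_graph M a b (i \<oplus> \<one>) (u \<oplus> u)"
    using assms unfolding exp_graph_iff by blast
  obtain a' b' where ab': "beta_graph M a' b' \<zero> \<one>" "beta_graph M a' b' x y'"
    "\<And>i. i \<prec> x \<Longrightarrow> \<exists>u. beta_graph M a' b' i u \<and> beta_graph M a' b' (i \<oplus> \<one>) (u \<oplus> u)"
    using assms unfolding exp_graph_iff by blast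
  \<comment> \<open>Agreement of the two sequences at \<open>i\<close> is expressed by a common
    value, which is Sigma1; past \<open>x\<close> it holds by default.\<close>
  let ?P = "\<lambda>M i s. s 4 \<prec>\<^bsub>M\<^esub> i \<or> (\<exists>u. beta_graph M (s 0) (s 1) i u \<and> beta_graph M (s 2) (s 3) i u)"
  let ?s = "(!) [a, b, a', b', x]"
  have "?P M x ?s"
  proof (rule S1_induct[where P = ?P])
    show "S1 (\<lambda>M s. ?P M (s 0) (\<lambda>n. s (Suc n)))" by (intro S1_intros S1_beta F1_intros)
    show "?P M \<zero> ?s" using ab(1) ab'(1) by auto
    fix i assume i: "?P M i ?s"
    show "?P M (i \<oplus> \<one>) ?s"
    proof (cases "i \<prec> x")
      case True
      with i obtain u where u: "beta_graph M a b i u" "beta_graph M a' b' i u"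
        using sr.less_asym by auto
      with ab(3)[OF True] ab'(3)[OF True] beta_unique show ?thesis by simp metis
    next
      case False
      then have "x \<prec> i \<oplus> \<one>" by (simp add: less_Suc)
      then show ?thesis by simp
    qed
  qed
  then obtain u where "beta_graph M a b x u" "beta_graph M a' b' x u" by auto
  then show ?thesis using beta_unique ab(2) ab'(2) by metis
qed

lemma exp_graph_eq: "exp_graph M x y \<longleftrightarrow> y = exp2 M x"
  unfolding exp2_def using exp_graph_ex exp_graph_unique by (metis (mono_tags, lifting) theI)

lemma exp2_zero [simp]: "exp2 M \<zero> = \<one>"
  using exp_graph_zero exp_graph_eq by simp

lemma exp2_Suc: "exp2 M (x \<oplus> \<one>) = exp2 M x \<oplus> exp2 M x"
  using exp_graph_Suc exp_graph_eq by simp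

end

lemma F1_exp2: "F1 f \<Longrightarrow> F1 (\<lambda>M s. exp2 M (f M s))"
proof (rule F1_subst1[where h = exp2])
  show "F1 (\<lambda>M s. exp2 M (s 0))"
    unfolding F1_def
    by (rule S1_cong[OF S1_exp_graph[OF F1_var[of 1] F1_var[of 0]]]) (simp add: model.exp_graph_eq)
qed

context model
begin

lemma exp2_add: "exp2 M (x \<oplus> y) = exp2 M x \<otimes> exp2 M y"
proof -
  let ?P = "\<lambda>M y s. exp2 M (s 0 \<oplus>\<^bsub>M\<^esub> y) = exp2 M (s 0) \<otimes>\<^bsub>M\<^esub> exp2 M y"
  have "?P M y (\<lambda>_. x)"
  proof (rule S1_induct[where P = ?P])
    show "S1 (\<lambda>M s. ?P M (s 0) (\<lambda>n. s (Suc n)))" by (intro S1_intros F1_exp2 F1_intros)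
  qed (auto simp: exp2_Suc sr.distrib_left simp flip: sr.add.assoc)
  then show ?thesis .
qed

lemma less_exp2: "x \<prec> exp2 M x"
proof -
  let ?P = "\<lambda>M x (s::nat\<Rightarrow>'a). x \<prec>\<^bsub>M\<^esub> exp2 M x"
  have "?P M x (\<lambda>_. x)"
  proof (rule S1_induct[where P = ?P])
    show "S1 (\<lambda>M s. ?P M (s 0) (\<lambda>n. s (Suc n)))" by (intro S1_intros F1_exp2 F1_intros)
    fix x assume x: "x \<prec> exp2 M x"
    then have "\<one> \<preceq> exp2 M x" by (metis Suc_le sr.add_0 sr.le_less_trans zero_le)
    with x show "x \<oplus> \<one> \<prec> exp2 M (x \<oplus> \<one>)" unfolding exp2_Suc by (rule sr.add_less_le_mono)
  qed simp
  then show ?thesis .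
qed

lemma exp2_nonzero [simp]: "exp2 M x \<noteq> \<zero>"
  using less_exp2[of x] by auto

lemma exp2_pos [simp]: "\<zero> \<prec> exp2 M x"
  using exp2_nonzero zero_le le_def by metis

lemma exp2_less_factor: assumes "x \<prec> y" shows "\<exists>t. t \<noteq> \<zero> \<and> exp2 M y = (exp2 M x \<oplus> exp2 M x) \<otimes> t"
proof -
  obtain d where "y = (x \<oplus> \<one>) \<oplus> d" using assms less_ex by (metis sr.add.assoc sr.add.commute)
  then have "exp2 M y = (exp2 M x \<oplus> exp2 M x) \<otimes> exp2 M d" by (simp only: exp2_add[of "x \<oplus> \<one>"] exp2_Suc)
  then show ?thesis using exp2_nonzero by blast
qed

section \<open>Binary digits\<close>

lemma ack_mem_iff: "ack_mem M x y \<longleftrightarrow>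
    (\<exists>q r. r \<prec> exp2 M x \<and> y = (q \<oplus> q \<oplus> \<one>) \<otimes> exp2 M x \<oplus> r)"
  unfolding ack_mem_def by (simp add: carrier_UNIV exp_graph_eq)

lemma even_odd: "\<exists>q'. q = q' \<oplus> q' \<or> q = q' \<oplus> q' \<oplus> \<one>"
proof -
  have "\<one> \<oplus> \<one> \<noteq> \<zero>" by (rule modulus_nonzero)
  then obtain q' r where r: "r \<prec> \<one> \<oplus> \<one>" "q = q' \<otimes> (\<one> \<oplus> \<one>) \<oplus> r" using div_ex by blast
  have "r = \<zero> \<or> r = \<one>"
    using r(1) zero_or_Suc[of r] by (metis less_Suc le_def not_less_zero sr.add_0 sr.add_less_cancel_right)
  then show ?thesis using r(2) by (metis sr.distrib_left sr.mult_1_right sr.add_0_right)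
qed

lemma even_not_odd: "q \<oplus> q \<noteq> q' \<oplus> q' \<oplus> \<one>"
proof
  assume *: "q \<oplus> q = q' \<oplus> q' \<oplus> \<one>"
  have "\<zero> \<prec> \<one> \<oplus> \<one>" "\<one> \<prec> \<one> \<oplus> \<one>" by (simp_all add: less_Suc del: sr.one_add_one)
  from div_unique(2)[OF _ this, of q q'] * show False
    by (simp add: sr.distrib_left del: sr.one_add_one)
qed

text \<open>A digit is 0 when the quotient by the power of two is even, and this is again an
  existential statement. It is the second half of the proof that \<open>ack_mem\<close> is
  Delta1.\<close>

lemma not_ack_mem_iff: "\<not> ack_mem M x y \<longleftrightarrow>
    (\<exists>q r. r \<prec> exp2 M x \<and> y = (q \<oplus> q) \<otimes> exp2 M x \<oplus> r)"
proof
  assume *: "\<not> ack_mem M x y"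
  obtain q r where "r \<prec> exp2 M x" "y = q \<otimes> exp2 M x \<oplus> r" using div_ex exp2_nonzero by blast
  with * even_odd[of q] show "\<exists>q r. r \<prec> exp2 M x \<and> y = (q \<oplus> q) \<otimes> exp2 M x \<oplus> r"
    unfolding ack_mem_iff by blast
next
  assume "\<exists>q r. r \<prec> exp2 M x \<and> y = (q \<oplus> q) \<otimes> exp2 M x \<oplus> r"
  then show "\<not> ack_mem M x y" unfolding ack_mem_iff using div_unique(1) even_not_odd by metis
qed

end

lemma D1_ack_aux: "D1 (\<lambda>M s. ack_mem M (s 0) (s 1))"
  unfolding D1_def
proof
  have "S1 (\<lambda>M s. \<exists>q r. r \<prec>\<^bsub>M\<^esub> exp2 M (s 0) \<and>
    s 1 = (q \<oplus>\<^bsub>M\<^esub> q \<oplus>\<^bsub>M\<^esub> \<one>\<^bsub>M\<^esub>) \<otimes>\<^bsub>M\<^esub> exp2 M (s 0) \<oplus>\<^bsub>M\<^esub> r)"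
    by (intro S1_intros F1_exp2 F1_intros)
  then show "S1 (\<lambda>M s. ack_mem M (s 0) (s 1))" by (rule S1_cong) (simp add: model.ack_mem_iff)
  have "S1 (\<lambda>M s. \<exists>q r. r \<prec>\<^bsub>M\<^esub> exp2 M (s 0) \<and>
    s 1 = (q \<oplus>\<^bsub>M\<^esub> q) \<otimes>\<^bsub>M\<^esub> exp2 M (s 0) \<oplus>\<^bsub>M\<^esub> r)"
    by (intro S1_intros F1_exp2 F1_intros)
  then show "S1 (\<lambda>M s. \<not> ack_mem M (s 0) (s 1))" by (rule S1_cong) (simp add: model.not_ack_mem_iff)
qed

lemmas D1_ack = D1_subst2[where P = ack_mem, OF D1_ack_aux]

section \<open>Adding a bit without carry, and comprehension\<close>

context model
begin

text \<open>The model is cut into blocks of length \<open>p \<oplus> p\<close>. An element in the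
  lower half of a block stays in the block when \<open>p\<close> is added, and so below every
  multiple of the block length that was above it.\<close>

lemma add_below_multiple:
  assumes "q \<otimes> (p \<oplus> p) \<oplus> r \<prec> t \<otimes> (p \<oplus> p)" "r \<prec> p"
  shows "q \<otimes> (p \<oplus> p) \<oplus> r \<oplus> p \<prec> t \<otimes> (p \<oplus> p)"
proof -
  have "q \<prec> t"
  proof (rule ccontr)
    assume "\<not> q \<prec> t"
    then have "t \<otimes> (p \<oplus> p) \<preceq> q \<otimes> (p \<oplus> p)" by (intro sr.mult_right_mono) auto
    then have "t \<otimes> (p \<oplus> p) \<preceq> q \<otimes> (p \<oplus> p) \<oplus> r" using le_add1 sr.order_trans by blast
    then show False using assms(1) by simp
  qed
  then have "(q \<oplus> \<one>) \<otimes> (p \<oplus> p) \<preceq> t \<otimes> (p \<oplus> p)" by (intro sr.mult_right_mono) (auto simp: Suc_le)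
  moreover have "q \<otimes> (p \<oplus> p) \<oplus> r \<oplus> p \<prec> (q \<oplus> \<one>) \<otimes> (p \<oplus> p)"
    using assms(2) by (simp add: sr.distrib_right sr.add.assoc)
  ultimately show ?thesis using sr.less_le_trans by blast
qed

text \<open>Switching on a bit that is off causes no carry: for \<open>z\<close> below
  \<open>x\<close> only the quotient changes, for \<open>z\<close> above \<open>x\<close> only the
  remainder, which stays below \<open>exp2 M z\<close>. The digit \<open>p\<close> is left arbitrary
  so that 0 and 1 are treated together.\<close>

lemma add_bit_digit:
  assumes x: "\<not> ack_mem M x c" and z: "z \<noteq> x"
    and c: "c = (q \<oplus> q \<oplus> p) \<otimes> exp2 M z \<oplus> r" "r \<prec> exp2 M z"
  shows "\<exists>q' r'. r' \<prec> exp2 M z \<and> c \<oplus> exp2 M x = (q' \<oplus> q' \<oplus> p) \<otimes> exp2 M z \<oplus> r'"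
proof (cases "z \<prec> x")
  case True
  then obtain t where t: "exp2 M x = (exp2 M z \<oplus> exp2 M z) \<otimes> t" using exp2_less_factor by blast
  have "c \<oplus> exp2 M x = ((q \<oplus> t) \<oplus> (q \<oplus> t) \<oplus> p) \<otimes> exp2 M z \<oplus> r"
    unfolding c(1) t by (simp add: alg)
  then show ?thesis using c(2) by blast
next
  case False
  with z have "x \<prec> z" by simp
  let ?p = "exp2 M x"
  obtain t where t: "exp2 M z = (?p \<oplus> ?p) \<otimes> t" using \<open>x \<prec> z\<close> exp2_less_factor by blast
  obtain q0 r0 where r0: "r0 \<prec> ?p" "c = (q0 \<oplus> q0) \<otimes> ?p \<oplus> r0" using x not_ack_mem_iff by blast
  have "?p \<oplus> ?p \<noteq> \<zero>" using exp2_Suc exp2_nonzero by metis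
  then obtain q1 r1 where r1: "r1 \<prec> ?p \<oplus> ?p" "r = q1 \<otimes> (?p \<oplus> ?p) \<oplus> r1" using div_ex by blast
  have "((q \<oplus> q \<oplus> p) \<otimes> t \<oplus> q1) \<otimes> (?p \<oplus> ?p) \<oplus> r1 = c"
    unfolding c(1) t r1(2) by (simp add: alg)
  also have "c = q0 \<otimes> (?p \<oplus> ?p) \<oplus> r0" unfolding r0(2) by (simp add: alg)
  finally have eq: "((q \<oplus> q \<oplus> p) \<otimes> t \<oplus> q1) \<otimes> (?p \<oplus> ?p) \<oplus> r1 = q0 \<otimes> (?p \<oplus> ?p) \<oplus> r0" .
  have "r0 \<prec> ?p \<oplus> ?p" using r0(1) le_add1 sr.less_le_trans by blast
  from div_unique(2)[OF eq r1(1) this] have "r1 = r0" .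
  then have "r \<oplus> ?p \<prec> exp2 M z"
    using add_below_multiple[of q1 ?p r0 t] r0(1) c(2) r1(2) t sr.mult.commute by metis
  moreover have "c \<oplus> ?p = (q \<oplus> q \<oplus> p) \<otimes> exp2 M z \<oplus> (r \<oplus> ?p)"
    unfolding c(1) by (simp only: sr.add.assoc)
  ultimately show ?thesis by blast
qed

lemma ack_mem_add_bit:
  assumes "\<not> ack_mem M x c"
  shows "ack_mem M z (c \<oplus> exp2 M x) \<longleftrightarrow> z = x \<or> ack_mem M z c"
proof (cases "z = x")
  case True
  obtain q r where "r \<prec> exp2 M x" "c = (q \<oplus> q) \<otimes> exp2 M x \<oplus> r"
    using assms not_ack_mem_iff by blast
  moreover from this have "c \<oplus> exp2 M x = (q \<oplus> q \<oplus> \<one>) \<otimes> exp2 M x \<oplus> r" by (simp add: alg)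
  ultimately show ?thesis using True ack_mem_iff by blast
next
  case False
  show ?thesis
  proof
    assume *: "ack_mem M z (c \<oplus> exp2 M x)"
    show "z = x \<or> ack_mem M z c"
    proof (rule ccontr)
      assume "\<not> ?thesis"
      then obtain q r where "r \<prec> exp2 M z" "c = (q \<oplus> q \<oplus> \<zero>) \<otimes> exp2 M z \<oplus> r"
        using not_ack_mem_iff by auto
      from add_bit_digit[OF assms False this(2,1)] have "\<not> ack_mem M z (c \<oplus> exp2 M x)"
        unfolding not_ack_mem_iff by simp
      then show False using * by blast
    qed
  next
    assume "z = x \<or> ack_mem M z c"
    then obtain q r where "r \<prec> exp2 M z" "c = (q \<oplus> q \<oplus> \<one>) \<otimes> exp2 M z \<oplus> r"
      using False ack_mem_iff by auto
    from add_bit_digit[OF assms False this(2,1)] show "ack_mem M z (c \<oplus> exp2 M x)"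
      unfolding ack_mem_iff by simp
  qed
qed

lemma add_bit_less:
  assumes "\<not> ack_mem M x c" "x \<prec> e" "c \<prec> exp2 M e" shows "c \<oplus> exp2 M x \<prec> exp2 M e"
proof -
  obtain q r where r: "r \<prec> exp2 M x" "c = (q \<oplus> q) \<otimes> exp2 M x \<oplus> r"
    using assms(1) not_ack_mem_iff by blast
  then have "c = q \<otimes> (exp2 M x \<oplus> exp2 M x) \<oplus> r" by (simp add: alg)
  moreover obtain t where "exp2 M e = t \<otimes> (exp2 M x \<oplus> exp2 M x)"
    using exp2_less_factor[OF assms(2)] sr.mult.commute by metis
  ultimately show ?thesis using add_below_multiple r(1) assms(3) by metis
qed

text \<open>
  The code is the greatest \<open>c < 2\<^sup>e\<close> all of whose bits below \<open>e\<close> satisfy the predicate: a missing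
  bit could be added to it.
\<close>

lemma S1_comprehension:
  assumes "S1 (\<lambda>M s. P M (s 0) (\<lambda>n. s (Suc n)))"
  shows "\<exists>c. c \<prec> exp2 M e \<and> (\<forall>x. x \<prec> e \<longrightarrow> (ack_mem M x c \<longleftrightarrow> P M x s))"
proof -
  let ?P = "\<lambda>M c s. c \<prec>\<^bsub>M\<^esub> exp2 M (s 0) \<and>
    (\<forall>x. x \<prec>\<^bsub>M\<^esub> s 0 \<longrightarrow> (ack_mem M x c \<longrightarrow> P M x (\<lambda>n. s (Suc n))))"
  have "\<exists>c. ?P M c (case_nat e s) \<and> (\<forall>y. ?P M y (case_nat e s) \<longrightarrow> y \<preceq> c)"
  proof (rule S1_greatest[where P = ?P])
    have "S1 (\<lambda>M s. P M (s 0) (\<lambda>n. s (Suc (Suc (Suc n)))))"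
      using S1_ren[OF assms, of "case_nat 0 (\<lambda>n. Suc (Suc (Suc n)))"] by simp
    then show "S1 (\<lambda>M s. ?P M (s 0) (\<lambda>n. s (Suc n)))"
      by (intro S1_intros D1_ack F1_exp2 F1_intros)
    have "\<not> ack_mem M x \<zero>" for x
      unfolding not_ack_mem_iff by (intro exI[of _ \<zero>]) simp
    then show "?P M \<zero> (case_nat e s)" by simp
    show "?P M x (case_nat e s) \<Longrightarrow> x \<preceq> exp2 M e" for x using sr.less_imp_le by simp
  qed
  then obtain c where c: "c \<prec> exp2 M e" "\<And>x. x \<prec> e \<Longrightarrow> ack_mem M x c \<Longrightarrow> P M x s"
    "\<And>y. y \<prec> exp2 M e \<Longrightarrow> (\<And>x. x \<prec> e \<Longrightarrow> ack_mem M x y \<Longrightarrow> P M x s) \<Longrightarrow> y \<preceq> c"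
    by auto
  have "ack_mem M x c" if "x \<prec> e" "P M x s" for x
  proof (rule ccontr)
    assume "\<not> ack_mem M x c"
    then have "c \<oplus> exp2 M x \<preceq> c"
      using add_bit_less ack_mem_add_bit c(1,2) that by (intro c(3)) auto
    then show False using exp2_pos[of x] sr.not_le by (metis sr.less_add_same_cancel1)
  qed
  then show ?thesis using c(1,2) by blast
qed

end

section \<open>A universal relation\<close>

primrec num :: "'a arith_struct \<Rightarrow> nat \<Rightarrow> 'a" where
  "num M 0 = \<zero>\<^bsub>M\<^esub>"
| "num M (Suc n) = num M n \<oplus>\<^bsub>M\<^esub> \<one>\<^bsub>M\<^esub>"

text \<open>
  Tags are nonzero, since \<open>pair 0 0 = 0\<close> and a node has to exceed its components.
\<close>

definition node :: "'a arith_struct \<Rightarrow> nat \<Rightarrow> 'a \<Rightarrow> 'a \<Rightarrow> 'a" where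
  "node M k a b = pair M (num M k) (pair M a b)"

text \<open>Variables are coded in unary, so that looking one up in an assignment is a local
  condition: the clause for a successor drops the first entry of the assignment.\<close>

primrec var_code :: "'a arith_struct \<Rightarrow> nat \<Rightarrow> 'a" where
  "var_code M 0 = node M 1 \<zero>\<^bsub>M\<^esub> \<zero>\<^bsub>M\<^esub>"
| "var_code M (Suc n) = node M 2 (var_code M n) \<zero>\<^bsub>M\<^esub>"

primrec tm_code :: "'a arith_struct \<Rightarrow> tm \<Rightarrow> 'a" where
  "tm_code M (Var n) = var_code M n"
| "tm_code M Zero = node M 3 \<zero>\<^bsub>M\<^esub> \<zero>\<^bsub>M\<^esub>"
| "tm_code M One = node M 4 \<zero>\<^bsub>M\<^esub> \<zero>\<^bsub>M\<^esub>"
| "tm_code M (Add t u) = node M 5 (tm_code M t) (tm_code M u)"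
| "tm_code M (Mult t u) = node M 6 (tm_code M t) (tm_code M u)"

primrec fm_code :: "'a arith_struct \<Rightarrow> fm \<Rightarrow> 'a" where
  "fm_code M (Eq t u) = node M 7 (tm_code M t) (tm_code M u)"
| "fm_code M (Less t u) = node M 8 (tm_code M t) (tm_code M u)"
| "fm_code M (Neg \<phi>) = node M 9 (fm_code M \<phi>) \<zero>\<^bsub>M\<^esub>"
| "fm_code M (And \<phi> \<psi>) = node M 10 (fm_code M \<phi>) (fm_code M \<psi>)"
| "fm_code M (Ex \<phi>) = node M 11 (fm_code M \<phi>) \<zero>\<^bsub>M\<^esub>"

primrec asg_code :: "'a arith_struct \<Rightarrow> nat \<Rightarrow> (nat \<Rightarrow> 'a) \<Rightarrow> 'a" where
  "asg_code M 0 s = \<zero>\<^bsub>M\<^esub>"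
| "asg_code M (Suc k) s = pair M (s 0) (asg_code M k (\<lambda>n. s (Suc n)))"

text \<open>
  A table of width \<open>w\<close> records truth in the finite structure \<open>[0, w)\<close>. An entry at \<open>e\<close> and \<open>x\<close> says
  that the formula \<open>e\<close> holds at the assignment \<open>x\<close>, or, for a term \<open>e\<close> and \<open>x = pair v s\<close>, that \<open>v\<close>
  is the value of \<open>e\<close> at \<open>s\<close>. Nothing is required of nonstandard codes beyond the local
  conditions in \<open>clause\<close>.
\<close>

context
  fixes M :: "'a arith_struct" (structure)
begin

definition entry :: "'a \<Rightarrow> 'a \<Rightarrow> 'a \<Rightarrow> 'a \<Rightarrow> bool" where
  "entry w H e x \<longleftrightarrow> x \<prec> w \<and> ack_mem M (pair M e x) H"

definition clause :: "'a \<Rightarrow> 'a \<Rightarrow> 'a \<Rightarrow> 'a \<Rightarrow> bool" where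
  "clause w H e x \<longleftrightarrow>
    (\<exists>v. v \<prec> w \<and> (\<exists>s. s \<prec> w \<and>
      e = node M 1 \<zero> \<zero> \<and> x = pair M v (pair M v s))) \<or>
    (\<exists>a. a \<prec> e \<and> (\<exists>v. v \<prec> w \<and> (\<exists>y. y \<prec> w \<and> (\<exists>s. s \<prec> w \<and>
      e = node M 2 a \<zero> \<and> x = pair M v (pair M y s) \<and> entry w H a (pair M v s))))) \<or>
    (\<exists>s. s \<prec> w \<and> e = node M 3 \<zero> \<zero> \<and> x = pair M \<zero> s) \<or>
    (\<exists>s. s \<prec> w \<and> e = node M 4 \<zero> \<zero> \<and> x = pair M \<one> s) \<or>
    (\<exists>a. a \<prec> e \<and> (\<exists>b. b \<prec> e \<and> (\<exists>u. u \<prec> w \<and> (\<exists>v. v \<prec> w \<and> (\<exists>s. s \<prec> w \<and>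
      e = node M 5 a b \<and> x = pair M (u \<oplus> v) s \<and>
      entry w H a (pair M u s) \<and> entry w H b (pair M v s)))))) \<or>
    (\<exists>a. a \<prec> e \<and> (\<exists>b. b \<prec> e \<and> (\<exists>u. u \<prec> w \<and> (\<exists>v. v \<prec> w \<and> (\<exists>s. s \<prec> w \<and>
      e = node M 6 a b \<and> x = pair M (u \<otimes> v) s \<and>
      entry w H a (pair M u s) \<and> entry w H b (pair M v s)))))) \<or>
    (\<exists>a. a \<prec> e \<and> (\<exists>b. b \<prec> e \<and> (\<exists>v. v \<prec> w \<and>
      e = node M 7 a b \<and> entry w H a (pair M v x) \<and> entry w H b (pair M v x)))) \<or>
    (\<exists>a. a \<prec> e \<and> (\<exists>b. b \<prec> e \<and> (\<exists>u. u \<prec> w \<and> (\<exists>v. v \<prec> w \<and>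
      e = node M 8 a b \<and> u \<prec> v \<and> entry w H a (pair M u x) \<and> entry w H b (pair M v x))))) \<or>
    (\<exists>a. a \<prec> e \<and> e = node M 9 a \<zero> \<and> \<not> entry w H a x) \<or>
    (\<exists>a. a \<prec> e \<and> (\<exists>b. b \<prec> e \<and>
      e = node M 10 a b \<and> entry w H a x \<and> entry w H b x)) \<or>
    (\<exists>a. a \<prec> e \<and> (\<exists>v. v \<prec> w \<and> e = node M 11 a \<zero> \<and> entry w H a (pair M v x)))"

definition table :: "'a \<Rightarrow> 'a \<Rightarrow> 'a \<Rightarrow> bool" where
  "table w H n \<longleftrightarrow>
    (\<forall>e. e \<prec> n \<longrightarrow> (\<forall>x. x \<prec> w \<longrightarrow> (entry w H e x \<longleftrightarrow> clause w H e x)))"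

end

section \<open>Definability and existence of truth tables\<close>

lemma trm_num: "trm (\<lambda>M s. num M k)"
  by (induction k) (simp_all add: trm_intros)

lemma F1_node: "F1 f \<Longrightarrow> F1 g \<Longrightarrow> F1 (\<lambda>M s. node M k (f M s) (g M s))"
  unfolding node_def by (intro F1_pair F1_trm[OF trm_num])

lemma D1_entry: "F1 f \<Longrightarrow> F1 g \<Longrightarrow> F1 h \<Longrightarrow> F1 k \<Longrightarrow>
    D1 (\<lambda>M s. entry M (f M s) (g M s) (h M s) (k M s))"
  unfolding entry_def by (intro D1_intros D1_ack F1_pair)

lemma D1_clause_aux: "D1 (\<lambda>M s. clause M (s 0) (s 1) (s 2) (s 3))"
  unfolding clause_def by (intro D1_intros D1_entry F1_node F1_pair F1_intros)

lemmas D1_clause = D1_subst4[where P = clause, OF D1_clause_aux]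

lemma D1_table_aux: "D1 (\<lambda>M s. table M (s 0) (s 1) (s 2))"
  unfolding table_def by (intro D1_intros D1_entry D1_clause F1_intros)

lemmas D1_table = D1_subst3[where P = table, OF D1_table_aux]

text \<open>A clause consults the table only at smaller codes. A table can therefore be extended
  code by code without disturbing the conditions already met.\<close>

lemma clause_cong:
  assumes "\<And>a x. a \<prec>\<^bsub>M\<^esub> e \<Longrightarrow> entry M w H a x \<longleftrightarrow> entry M w H' a x"
  shows "clause M w H e x \<longleftrightarrow> clause M w H' e x"
  unfolding clause_def
  by (intro disj_cong ex_cong1 conj_cong refl arg_cong[where f = Not] assms) assumption+

context model
begin

lemma num_less: "num M k \<prec> num M (Suc (k + d))"
proof (induction d)
  case (Suc d)
  then show ?case by (simp add: less_Suc sr.less_imp_le)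
qed (simp add: less_Suc)

lemma num_inject [simp]: "num M k = num M l \<longleftrightarrow> k = l"
proof
  assume *: "num M k = num M l"
  show "k = l"
  proof (rule ccontr)
    assume "k \<noteq> l"
    then have "(\<exists>d. l = Suc (k + d)) \<or> (\<exists>d. k = Suc (l + d))"
      by (metis less_imp_Suc_add linorder_neqE_nat)
    then show False using num_less * sr.less_irrefl by metis
  qed
qed simp

lemma node_inject [simp]: "node M k a b = node M l c d \<longleftrightarrow> k = l \<and> a = c \<and> b = d"
  by (auto simp: node_def)

lemma less_node: assumes "k \<noteq> 0" shows "a \<prec> node M k a b" "b \<prec> node M k a b"
proof -
  have "num M k \<noteq> \<zero>" using num_inject[of k 0] assms by simp
  then have "pair M a b \<prec> node M k a b" unfolding node_def by (rule pair_gt)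
  then show "a \<prec> node M k a b" "b \<prec> node M k a b" using pair_ge sr.le_less_trans by blast+
qed

text \<open>Injectivity of \<open>node\<close> leaves one disjunct, and the bounds on the subcodes
  hold by \<open>less_node\<close>.\<close>

lemma clause_node:
  "clause M w H (node M 1 a b) x \<longleftrightarrow> a = \<zero> \<and> b = \<zero> \<and>
    (\<exists>v s. v \<prec> w \<and> s \<prec> w \<and> x = pair M v (pair M v s))"
  "clause M w H (node M 2 a b) x \<longleftrightarrow> b = \<zero> \<and>
    (\<exists>v y s. v \<prec> w \<and> y \<prec> w \<and> s \<prec> w \<and> x = pair M v (pair M y s) \<and> entry M w H a (pair M v s))"
  "clause M w H (node M 3 a b) x \<longleftrightarrow> a = \<zero> \<and> b = \<zero> \<and> (\<exists>s. s \<prec> w \<and> x = pair M \<zero> s)"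
  "clause M w H (node M 4 a b) x \<longleftrightarrow> a = \<zero> \<and> b = \<zero> \<and> (\<exists>s. s \<prec> w \<and> x = pair M \<one> s)"
  "clause M w H (node M 5 a b) x \<longleftrightarrow> (\<exists>u v s. u \<prec> w \<and> v \<prec> w \<and> s \<prec> w \<and>
    x = pair M (u \<oplus> v) s \<and> entry M w H a (pair M u s) \<and> entry M w H b (pair M v s))"
  "clause M w H (node M 6 a b) x \<longleftrightarrow> (\<exists>u v s. u \<prec> w \<and> v \<prec> w \<and> s \<prec> w \<and>
    x = pair M (u \<otimes> v) s \<and> entry M w H a (pair M u s) \<and> entry M w H b (pair M v s))"
  "clause M w H (node M 7 a b) x \<longleftrightarrow> (\<exists>v. v \<prec> w \<and>
    entry M w H a (pair M v x) \<and> entry M w H b (pair M v x))"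
  "clause M w H (node M 8 a b) x \<longleftrightarrow> (\<exists>u v. u \<prec> w \<and> v \<prec> w \<and> u \<prec> v \<and>
    entry M w H a (pair M u x) \<and> entry M w H b (pair M v x))"
  "clause M w H (node M 9 a b) x \<longleftrightarrow> b = \<zero> \<and> \<not> entry M w H a x"
  "clause M w H (node M 10 a b) x \<longleftrightarrow> entry M w H a x \<and> entry M w H b x"
  "clause M w H (node M 11 a b) x \<longleftrightarrow> b = \<zero> \<and> (\<exists>v. v \<prec> w \<and> entry M w H a (pair M v x))"
  unfolding clause_def
  by (auto simp: less_node) (metis less_node zero_neq_numeral)+

lemma table_ex: "\<exists>H. table M w H n"
proof -
  let ?P = "\<lambda>M n s. \<exists>H. table M (s 0) H n"
  have "?P M n (\<lambda>_. w)"
  proof (rule S1_induct[where P = ?P])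
    show "S1 (\<lambda>M s. ?P M (s 0) (\<lambda>n. s (Suc n)))" by (intro S1_ex S1_D1[OF D1_table] F1_intros)
    show "?P M \<zero> (\<lambda>_. w)" by (simp add: table_def)
    fix n assume "?P M n (\<lambda>_. w)"
    then obtain H where H: "table M w H n" by blast
    \<comment> \<open>The new table keeps the entries for codes below \<open>n\<close> and decides
      those for \<open>n\<close> by their clause in the old table. All of them are at most
      \<open>pair M n w\<close>, by monotonicity of pairing.\<close>
    let ?Q = "\<lambda>M y s. (\<exists>x. x \<prec>\<^bsub>M\<^esub> s 0 \<and> y = pair M (s 2) x \<and> clause M (s 0) (s 1) (s 2) x) \<or>
      (\<exists>e. e \<prec>\<^bsub>M\<^esub> s 2 \<and> (\<exists>x. x \<prec>\<^bsub>M\<^esub> s 0 \<and> y = pair M e x \<and> ack_mem M y (s 1)))"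
    have "S1 (\<lambda>M s. ?Q M (s 0) (\<lambda>n. s (Suc n)))"
      by (intro S1_intros S1_D1[OF D1_ack] S1_D1[OF D1_clause] F1_pair F1_intros)
    from S1_comprehension[OF this, of "pair M n w \<oplus> \<one>" "(!) [w, H, n]"]
    obtain H' where H': "\<And>y. y \<preceq> pair M n w \<Longrightarrow> ack_mem M y H' \<longleftrightarrow>
      (\<exists>x. x \<prec> w \<and> y = pair M n x \<and> clause M w H n x) \<or>
      (\<exists>e. e \<prec> n \<and> (\<exists>x. x \<prec> w \<and> y = pair M e x \<and> ack_mem M y H))"
      by (auto simp: less_Suc)
    have entry: "entry M w H' e x \<longleftrightarrow>
        (if e = n then x \<prec> w \<and> clause M w H n x else entry M w H e x)" if "e \<preceq> n" for e x
    proof (cases "x \<prec> w")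
      case True
      then have "pair M e x \<preceq> pair M n w" using pair_mono that sr.less_imp_le by blast
      from H'[OF this] show ?thesis using True that by (auto simp: entry_def le_def)
    qed (simp add: entry_def)
    have "table M w H' (n \<oplus> \<one>)"
      unfolding table_def less_Suc
    proof (intro allI impI)
      fix e x assume ex: "e \<preceq> n" "x \<prec> w"
      have "entry M w H' a y \<longleftrightarrow> entry M w H a y" if "a \<prec> e" for a y
        using entry[of a y] that ex(1) sr.less_le_trans sr.less_imp_le sr.less_irrefl by metis
      then have "clause M w H' e x \<longleftrightarrow> clause M w H e x" by (intro clause_cong) auto
      then show "entry M w H' e x \<longleftrightarrow> clause M w H' e x"
        using entry[OF ex(1)] ex H by (auto simp: table_def le_def)
    qed
    then show "?P M (n \<oplus> \<one>) (\<lambda>_. w)" by blast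
  qed
  then show ?thesis .
qed

end

section \<open>Correctness of sufficiently wide tables\<close>

primrec grow :: "'a arith_struct \<Rightarrow> nat \<Rightarrow> 'a \<Rightarrow> 'a" where
  "grow M 0 x = x"
| "grow M (Suc n) x = pair M (grow M n x) (grow M n x) \<oplus>\<^bsub>M\<^esub> \<one>\<^bsub>M\<^esub>"

text \<open>Counts the applications of \<open>grow\<close> to the assignment code that bound the
  value of a term; \<open>pair\<close> dominates sums and products. \<open>One\<close> needs one
  application because the assignment code may be zero.\<close>

primrec tm_depth :: "tm \<Rightarrow> nat" where
  "tm_depth (Var n) = 0"
| "tm_depth Zero = 0"
| "tm_depth One = 1"
| "tm_depth (Add t u) = Suc (max (tm_depth t) (tm_depth u))"
| "tm_depth (Mult t u) = Suc (max (tm_depth t) (tm_depth u))"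

lemma tm_depth_lift [simp]: "tm_depth (lift_tm t) = tm_depth t"
  by (induction t) auto

context model
begin

lemma pair_less_grow: "x \<preceq> grow M n z \<Longrightarrow> y \<preceq> grow M n z \<Longrightarrow> pair M x y \<prec> grow M (Suc n) z"
  by (simp add: less_Suc pair_mono)

lemma grow_mono_index: "m \<le> n \<Longrightarrow> grow M m x \<preceq> grow M n x"
proof (induction n)
  case (Suc n)
  have "grow M n x \<preceq> grow M (Suc n) x"
    using pair_ge(1) le_add1 sr.order_trans by (metis grow.simps(2))
  with Suc show ?case by (metis le_Suc_eq sr.order.refl sr.order_trans)
qed simp

lemma le_grow [simp]: "x \<preceq> grow M n x"
  using grow_mono_index[of 0 n x] by simp

lemma grow_mono: "x \<preceq> y \<Longrightarrow> grow M n x \<preceq> grow M n y"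
  by (induction n) (auto simp: pair_mono)

lemma grow_add: "grow M m (grow M n x) = grow M (m + n) x"
  by (induction m) auto

lemma add_le_pair: "x \<oplus> y \<preceq> pair M x y"
  unfolding pair_def using le_square le_add1 sr.order_trans by blast

lemma mult_le_pair: "x \<otimes> y \<preceq> pair M x y"
proof -
  have "x \<otimes> y \<preceq> (x \<oplus> y) \<otimes> (x \<oplus> y)" by (intro sr.mult_mono) auto
  then show ?thesis unfolding pair_def using le_add1 sr.order_trans by blast
qed

lemma component_le_asg_code: "i < k \<Longrightarrow> s i \<preceq> asg_code M k s"
proof (induction k arbitrary: i s)
  case (Suc k)
  show ?case
  proof (cases i)
    case (Suc j)
    then have "s i \<preceq> asg_code M k (\<lambda>n. s (Suc n))" using Suc.IH[of j "\<lambda>n. s (Suc n)"] Suc.prems by simp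
    then show ?thesis using pair_ge(2) sr.order_trans by simp
  qed (simp add: pair_ge)
qed simp

lemma eval_le_grow: "vars_tm t \<subseteq> {..<k} \<Longrightarrow> eval_tm M s t \<preceq> grow M (tm_depth t) (asg_code M k s)"
proof (induction t)
  case (Add t u)
  let ?n = "max (tm_depth t) (tm_depth u)"
  have "eval_tm M s t \<preceq> grow M ?n (asg_code M k s)" "eval_tm M s u \<preceq> grow M ?n (asg_code M k s)"
    using Add grow_mono_index[of _ ?n] sr.order_trans by (fastforce)+
  then show ?case
    using pair_less_grow add_le_pair sr.le_less_trans sr.less_imp_le by simp (metis grow.simps(2))
next
  case (Mult t u)
  let ?n = "max (tm_depth t) (tm_depth u)"
  have "eval_tm M s t \<preceq> grow M ?n (asg_code M k s)" "eval_tm M s u \<preceq> grow M ?n (asg_code M k s)"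
    using Mult grow_mono_index[of _ ?n] sr.order_trans by (fastforce)+
  then show ?case
    using pair_less_grow mult_le_pair sr.le_less_trans sr.less_imp_le by simp (metis grow.simps(2))
qed (auto simp: component_le_asg_code)

lemma table_entry: "table M w H n \<Longrightarrow> e \<prec> n \<Longrightarrow> entry M w H e x \<longleftrightarrow> x \<prec> w \<and> clause M w H e x"
  unfolding table_def entry_def by blast

lemma entry_var:
  assumes "table M w H n"
  shows "var_code M i \<prec> n \<Longrightarrow> i < k \<Longrightarrow>
    entry M w H (var_code M i) (pair M v (asg_code M k s)) \<longleftrightarrow>
      v = s i \<and> pair M v (asg_code M k s) \<prec> w"
proof (induction i arbitrary: k s)
  case 0
  then obtain k' where k: "k = Suc k'" using gr0_implies_Suc by blast
  have "v \<prec> w \<and> asg_code M k' (\<lambda>n. s (Suc n)) \<prec> w" if "pair M v (asg_code M k s) \<prec> w"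
    using that pair_ge sr.le_less_trans unfolding k by (metis asg_code.simps(2))
  then show ?case
    unfolding table_entry[OF assms 0(1)] unfolding var_code.simps clause_node k by auto
next
  case (Suc i)
  then obtain k' where k: "k = Suc k'" "i < k'" by (metis Suc_less_eq2)
  have "var_code M i \<prec> n" using Suc.prems(1) less_node(1)[of 2] sr.less_trans by fastforce
  note IH = Suc.IH[OF this k(2), of "\<lambda>n. s (Suc n)"]
  have "v \<prec> w \<and> s 0 \<prec> w \<and> asg_code M k' (\<lambda>n. s (Suc n)) \<prec> w \<and> pair M v (asg_code M k' (\<lambda>n. s (Suc n))) \<prec> w"
    if "pair M v (asg_code M k s) \<prec> w"
    using that pair_ge sr.le_less_trans pair_mono sr.order.refl unfolding k by (metis asg_code.simps(2))
  then show ?case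
    unfolding table_entry[OF assms Suc(2)] unfolding var_code.simps clause_node k using IH by auto
qed

text \<open>The width is arbitrary: a narrow table may lack the value of a term but never holds a
  wrong one. The guard \<open>b = b\<close> in \<open>guarded\<close> depends on this.\<close>

lemma entry_tm_sound:
  assumes "table M w H n"
  shows "tm_code M t \<prec> n \<Longrightarrow> vars_tm t \<subseteq> {..<k} \<Longrightarrow>
    entry M w H (tm_code M t) (pair M v (asg_code M k s)) \<Longrightarrow> v = eval_tm M s t"
proof (induction t arbitrary: v)
  case (Var i)
  then show ?case using entry_var[OF assms] by simp
next
  case (Add t u)
  have "tm_code M t \<prec> n" "tm_code M u \<prec> n"
    using Add.prems(1) less_node[of 5] sr.less_trans by fastforce+
  then show ?case
    using Add.IH Add.prems(2,3) unfolding table_entry[OF assms Add.prems(1)]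
    unfolding tm_code.simps clause_node by auto
next
  case (Mult t u)
  have "tm_code M t \<prec> n" "tm_code M u \<prec> n"
    using Mult.prems(1) less_node[of 6] sr.less_trans by fastforce+
  then show ?case
    using Mult.IH Mult.prems(2,3) unfolding table_entry[OF assms Mult.prems(1)]
    unfolding tm_code.simps clause_node by auto
qed (auto simp: table_entry[OF assms] clause_node)

text \<open>The value paired with the assignment has to be below \<open>w\<close>, which costs the
  additional \<open>Suc\<close>.\<close>

lemma entry_tm_complete:
  assumes "table M w H n"
  shows "tm_code M t \<prec> n \<Longrightarrow> vars_tm t \<subseteq> {..<k} \<Longrightarrow>
    grow M (Suc (tm_depth t)) (asg_code M k s) \<prec> w \<Longrightarrow>
    entry M w H (tm_code M t) (pair M (eval_tm M s t) (asg_code M k s))"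
proof (induction t)
  case (Var i)
  have "pair M (s i) (asg_code M k s) \<prec> grow M (Suc 0) (asg_code M k s)"
    using component_le_asg_code Var.prems(2) by (intro pair_less_grow) auto
  then have "pair M (s i) (asg_code M k s) \<prec> w"
    using Var.prems(3) sr.less_trans unfolding tm_depth.simps by blast
  then show ?case using entry_var[OF assms] Var.prems by simp
next
  case Zero
  have "pair M \<zero> (asg_code M k s) \<prec> grow M (Suc 0) (asg_code M k s)"
    by (intro pair_less_grow) auto
  then have *: "pair M \<zero> (asg_code M k s) \<prec> w"
    using Zero.prems(3) sr.less_trans unfolding tm_depth.simps by blast
  then have "asg_code M k s \<prec> w" using pair_ge sr.le_less_trans by blast
  with * show ?case using Zero.prems by (simp add: table_entry[OF assms] clause_node)
next
  case One
  have "pair M \<one> (asg_code M k s) \<prec> grow M (Suc 1) (asg_code M k s)"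
    using eval_le_grow[of One k s] le_grow[of "asg_code M k s" 1] by (intro pair_less_grow) auto
  then have *: "pair M \<one> (asg_code M k s) \<prec> w"
    using One.prems(3) sr.less_trans unfolding tm_depth.simps by blast
  then have "asg_code M k s \<prec> w" using pair_ge sr.le_less_trans by blast
  with * show ?case using One.prems by (simp add: table_entry[OF assms] clause_node)
next
  case (Add t u)
  let ?\<sigma> = "asg_code M k s"
  have w: "grow M m ?\<sigma> \<prec> w" if "m \<le> Suc (tm_depth (Add t u))" for m
    using grow_mono_index[OF that] Add.prems(3) sr.le_less_trans by blast
  have tu: "entry M w H (tm_code M t) (pair M (eval_tm M s t) ?\<sigma>)"
    "entry M w H (tm_code M u) (pair M (eval_tm M s u) ?\<sigma>)"
    using Add.IH(1)[OF sr.less_trans[OF _ Add.prems(1)]] Add.IH(2)[OF sr.less_trans[OF _ Add.prems(1)]]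
      Add.prems(2) w[of "Suc (tm_depth t)"] w[of "Suc (tm_depth u)"]
    by (simp_all add: less_node)
  have "eval_tm M s t \<prec> w" "eval_tm M s u \<prec> w" "?\<sigma> \<prec> w"
    using tu pair_ge sr.le_less_trans unfolding entry_def by blast+
  moreover have "pair M (eval_tm M s (Add t u)) ?\<sigma> \<prec> w"
    using pair_less_grow[OF eval_le_grow[OF Add.prems(2)] le_grow] Add.prems(3) sr.less_trans by blast
  ultimately show ?case
    unfolding table_entry[OF assms Add.prems(1)] unfolding tm_code.simps clause_node
    using tu by auto
next
  case (Mult t u)
  let ?\<sigma> = "asg_code M k s"
  have w: "grow M m ?\<sigma> \<prec> w" if "m \<le> Suc (tm_depth (Mult t u))" for m
    using grow_mono_index[OF that] Mult.prems(3) sr.le_less_trans by blast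
  have tu: "entry M w H (tm_code M t) (pair M (eval_tm M s t) ?\<sigma>)"
    "entry M w H (tm_code M u) (pair M (eval_tm M s u) ?\<sigma>)"
    using Mult.IH(1)[OF sr.less_trans[OF _ Mult.prems(1)]] Mult.IH(2)[OF sr.less_trans[OF _ Mult.prems(1)]]
      Mult.prems(2) w[of "Suc (tm_depth t)"] w[of "Suc (tm_depth u)"]
    by (simp_all add: less_node)
  have "eval_tm M s t \<prec> w" "eval_tm M s u \<prec> w" "?\<sigma> \<prec> w"
    using tu pair_ge sr.le_less_trans unfolding entry_def by blast+
  moreover have "pair M (eval_tm M s (Mult t u)) ?\<sigma> \<prec> w"
    using pair_less_grow[OF eval_le_grow[OF Mult.prems(2)] le_grow] Mult.prems(3) sr.less_trans by blast
  ultimately show ?case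
    unfolding table_entry[OF assms Mult.prems(1)] unfolding tm_code.simps clause_node
    using tu by auto
qed

end

text \<open>Doubling under \<open>Ex\<close> pays for the bound variable. If the body of a bounded
  quantifier has depth \<open>d\<close>, then \<open>d\<close> applications of \<open>grow\<close>
  dominate the assignment code extended by a value below the bound, and the body needs
  \<open>d\<close> more.\<close>

primrec fm_depth :: "fm \<Rightarrow> nat" where
  "fm_depth (Eq t u) = Suc (max (tm_depth t) (tm_depth u))"
| "fm_depth (Less t u) = Suc (max (tm_depth t) (tm_depth u))"
| "fm_depth (Neg \<phi>) = fm_depth \<phi>"
| "fm_depth (And \<phi> \<psi>) = max (fm_depth \<phi>) (fm_depth \<psi>)"
| "fm_depth (Ex \<phi>) = Suc (fm_depth \<phi> + fm_depth \<phi>)"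

context model
begin

lemma grow_less: "grow M n x \<prec> w \<Longrightarrow> m \<le> n \<Longrightarrow> grow M m x \<prec> w"
  using grow_mono_index sr.le_less_trans by blast

text \<open>That the common value is below \<open>w\<close> is the information which the guard later
  extracts from a table.\<close>

lemma entry_Eq:
  assumes "table M w H n" "fm_code M (Eq t u) \<prec> n" "free_vars (Eq t u) \<subseteq> {..<k}"
  shows "entry M w H (fm_code M (Eq t u)) (asg_code M k s) \<Longrightarrow>
    eval_tm M s t = eval_tm M s u \<and> eval_tm M s t \<prec> w"
    and "grow M (fm_depth (Eq t u)) (asg_code M k s) \<prec> w \<Longrightarrow> eval_tm M s t = eval_tm M s u \<Longrightarrow>
      entry M w H (fm_code M (Eq t u)) (asg_code M k s)"
proof -
  let ?\<sigma> = "asg_code M k s"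
  have tu: "tm_code M t \<prec> n" "tm_code M u \<prec> n"
    using assms(2) less_node[of 7] sr.less_trans by fastforce+
  have vars: "vars_tm t \<subseteq> {..<k}" "vars_tm u \<subseteq> {..<k}" using assms(3) by auto
  note sound = entry_tm_sound[OF assms(1) tu(1) vars(1)] entry_tm_sound[OF assms(1) tu(2) vars(2)]
  show "eval_tm M s t = eval_tm M s u \<and> eval_tm M s t \<prec> w" if "entry M w H (fm_code M (Eq t u)) ?\<sigma>"
    using that sound unfolding table_entry[OF assms(1,2)] unfolding fm_code.simps clause_node by metis
  show "entry M w H (fm_code M (Eq t u)) ?\<sigma>"
    if w: "grow M (fm_depth (Eq t u)) ?\<sigma> \<prec> w" and eq: "eval_tm M s t = eval_tm M s u"
  proof -
    have "entry M w H (tm_code M t) (pair M (eval_tm M s t) ?\<sigma>)"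
      "entry M w H (tm_code M u) (pair M (eval_tm M s u) ?\<sigma>)"
      using entry_tm_complete[OF assms(1) tu(1) vars(1) grow_less[OF w]]
        entry_tm_complete[OF assms(1) tu(2) vars(2) grow_less[OF w]] by simp_all
    moreover from this have "eval_tm M s t \<prec> w" "?\<sigma> \<prec> w"
      unfolding entry_def using pair_ge sr.le_less_trans by blast+
    ultimately show ?thesis
      unfolding table_entry[OF assms(1,2)] unfolding fm_code.simps clause_node using eq by auto
  qed
qed

lemma entry_Less:
  assumes "table M w H n" "fm_code M (Less t u) \<prec> n" "free_vars (Less t u) \<subseteq> {..<k}"
  shows "entry M w H (fm_code M (Less t u)) (asg_code M k s) \<Longrightarrow> eval_tm M s t \<prec> eval_tm M s u"
    and "grow M (fm_depth (Less t u)) (asg_code M k s) \<prec> w \<Longrightarrow> eval_tm M s t \<prec> eval_tm M s u \<Longrightarrow>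
      entry M w H (fm_code M (Less t u)) (asg_code M k s)"
proof -
  let ?\<sigma> = "asg_code M k s"
  have tu: "tm_code M t \<prec> n" "tm_code M u \<prec> n"
    using assms(2) less_node[of 8] sr.less_trans by fastforce+
  have vars: "vars_tm t \<subseteq> {..<k}" "vars_tm u \<subseteq> {..<k}" using assms(3) by auto
  note sound = entry_tm_sound[OF assms(1) tu(1) vars(1)] entry_tm_sound[OF assms(1) tu(2) vars(2)]
  show "eval_tm M s t \<prec> eval_tm M s u" if "entry M w H (fm_code M (Less t u)) ?\<sigma>"
    using that sound unfolding table_entry[OF assms(1,2)] unfolding fm_code.simps clause_node by metis
  show "entry M w H (fm_code M (Less t u)) ?\<sigma>"
    if w: "grow M (fm_depth (Less t u)) ?\<sigma> \<prec> w" and less: "eval_tm M s t \<prec> eval_tm M s u"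
  proof -
    have "entry M w H (tm_code M t) (pair M (eval_tm M s t) ?\<sigma>)"
      "entry M w H (tm_code M u) (pair M (eval_tm M s u) ?\<sigma>)"
      using entry_tm_complete[OF assms(1) tu(1) vars(1) grow_less[OF w]]
        entry_tm_complete[OF assms(1) tu(2) vars(2) grow_less[OF w]] by simp_all
    moreover from this have "eval_tm M s t \<prec> w" "eval_tm M s u \<prec> w" "?\<sigma> \<prec> w"
      unfolding entry_def using pair_ge sr.le_less_trans by blast+
    ultimately show ?thesis
      unfolding table_entry[OF assms(1,2)] unfolding fm_code.simps clause_node using less by auto
  qed
qed

lemma entry_fm:
  assumes "table M w H n"
  shows "Delta0 \<phi> \<Longrightarrow> fm_code M \<phi> \<prec> n \<Longrightarrow> free_vars \<phi> \<subseteq> {..<k} \<Longrightarrow>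
    grow M (fm_depth \<phi>) (asg_code M k s) \<prec> w \<Longrightarrow>
    entry M w H (fm_code M \<phi>) (asg_code M k s) \<longleftrightarrow> sat M s \<phi>"
proof (induction arbitrary: k s rule: Delta0.induct)
  case (Eq t u)
  then show ?case using entry_Eq[OF assms Eq(1,2)] by auto
next
  case (Less t u)
  then show ?case using entry_Less[OF assms Less(1,2)] by auto
next
  case (Neg \<phi>)
  have "fm_code M \<phi> \<prec> n" using Neg.prems(1) less_node[of 9] sr.less_trans by fastforce
  then have "entry M w H (fm_code M \<phi>) (asg_code M k s) \<longleftrightarrow> sat M s \<phi>"
    using Neg.IH[of k s] Neg.prems by simp
  moreover have "asg_code M k s \<prec> w" using Neg.prems(3) le_grow sr.le_less_trans by blast
  ultimately show ?case
    unfolding table_entry[OF assms Neg.prems(1)] unfolding fm_code.simps clause_node by simp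
next
  case (And \<phi> \<psi>)
  have n: "fm_code M \<phi> \<prec> n" "fm_code M \<psi> \<prec> n"
    using And.prems(1) less_node[of 10] sr.less_trans by fastforce+
  have "entry M w H (fm_code M \<phi>) (asg_code M k s) \<longleftrightarrow> sat M s \<phi>"
    using And.IH(1)[OF n(1) _ grow_less[OF And.prems(3)]] And.prems by simp
  moreover have "entry M w H (fm_code M \<psi>) (asg_code M k s) \<longleftrightarrow> sat M s \<psi>"
    using And.IH(2)[OF n(2) _ grow_less[OF And.prems(3)]] And.prems by simp
  moreover have "asg_code M k s \<prec> w" using And.prems(3) le_grow sr.le_less_trans by blast
  ultimately show ?case
    unfolding table_entry[OF assms And.prems(1)] unfolding fm_code.simps clause_node by simp
next
  case (Bex \<phi> t)
  let ?\<sigma> = "asg_code M k s" and ?L = "fm.Less (Var 0) (lift_tm t)"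
  let ?d = "fm_depth (fm.And ?L \<phi>)"
  have n1: "fm_code M (fm.And ?L \<phi>) \<prec> n"
    using Bex.prems(1) less_node[of 11] sr.less_trans by fastforce
  then have n: "fm_code M ?L \<prec> n" "fm_code M \<phi> \<prec> n"
    using less_node[of 10] sr.less_trans by fastforce+
  have vars: "vars_tm t \<subseteq> {..<k}" "free_vars ?L \<subseteq> {..<Suc k}" "free_vars \<phi> \<subseteq> {..<Suc k}"
  proof -
    have "m < Suc k" if "m \<in> free_vars \<phi>" for m
      using Bex.prems(2) that by (cases m) auto
    then show "free_vars \<phi> \<subseteq> {..<Suc k}" by auto
    show "vars_tm t \<subseteq> {..<k}" using Bex.prems(2) by (auto simp: vars_lift_tm)
    then show "free_vars ?L \<subseteq> {..<Suc k}" by (auto simp: vars_lift_tm)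
  qed
  have "?\<sigma> \<prec> w" using Bex.prems(3) le_grow sr.le_less_trans by blast
  have big: "grow M ?d (pair M v ?\<sigma>) \<prec> w" if "v \<prec> eval_tm M s t" for v
  proof -
    have "v \<preceq> grow M (tm_depth t) ?\<sigma>"
      using that eval_le_grow[OF vars(1)] sr.less_imp_le sr.order_trans by blast
    then have "pair M v ?\<sigma> \<preceq> grow M (Suc (tm_depth t)) ?\<sigma>"
      using pair_less_grow le_grow sr.less_imp_le by blast
    then have "grow M ?d (pair M v ?\<sigma>) \<preceq> grow M (?d + Suc (tm_depth t)) ?\<sigma>"
      using grow_mono grow_add by metis
    moreover have "grow M (?d + Suc (tm_depth t)) ?\<sigma> \<prec> w"
      by (rule grow_less[OF Bex.prems(3)]) simp
    ultimately show ?thesis using sr.le_less_trans by blast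
  qed
  have \<phi>: "entry M w H (fm_code M \<phi>) (pair M v ?\<sigma>) \<longleftrightarrow> sat M (case_nat v s) \<phi>"
    if "v \<prec> eval_tm M s t" for v
    using Bex.IH[OF n(2) vars(3), of "case_nat v s"] grow_less[OF big[OF that]] by simp
  have L: "v \<prec> eval_tm M s t" if "entry M w H (fm_code M ?L) (pair M v ?\<sigma>)" for v
    using entry_Less(1)[OF assms n(1) vars(2), of "case_nat v s"] that by simp
  have L': "entry M w H (fm_code M ?L) (pair M v ?\<sigma>)" if "v \<prec> eval_tm M s t" for v
  proof -
    have "grow M (fm_depth ?L) (asg_code M (Suc k) (case_nat v s)) \<prec> w"
      using grow_less[OF big[OF that], of "fm_depth ?L"] by (simp del: grow.simps)
    from entry_Less(2)[OF assms n(1) vars(2) this] that show ?thesis by simp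
  qed
  \<comment> \<open>The conjunct \<open>?L\<close> confines \<open>v\<close> below the value of the
    bound. There the table is wide enough for \<open>\<phi>\<close>; elsewhere both sides are
    false.\<close>
  have "entry M w H (fm_code M (fm.And ?L \<phi>)) (pair M v ?\<sigma>) \<longleftrightarrow>
      v \<prec> eval_tm M s t \<and> sat M (case_nat v s) \<phi>" for v
    unfolding table_entry[OF assms n1] unfolding fm_code.simps clause_node
    unfolding fm_code.simps[symmetric] using L L' \<phi> by (metis entry_def)
  moreover have "v \<prec> w" if "v \<prec> eval_tm M s t" for v
    using L'[OF that] pair_ge sr.le_less_trans unfolding entry_def by blast
  ultimately show ?case
    using \<open>?\<sigma> \<prec> w\<close> unfolding table_entry[OF assms Bex.prems(1)] unfolding fm_code.simps clause_node
    by (auto simp: carrier_UNIV)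
qed

end

section \<open>The truth predicate and the universal relation\<close>

definition pair_tm :: "tm \<Rightarrow> tm \<Rightarrow> tm" where
  "pair_tm t u = Add (Mult (Add t u) (Add t u)) t"

text \<open>Assignment codes and \<open>grow\<close> are polynomial in the assignment, so a term can
  name the width that a formula requires.\<close>

primrec asg_tm :: "nat \<Rightarrow> tm" where
  "asg_tm 0 = Zero"
| "asg_tm (Suc k) = pair_tm (Var 0) (lift_tm (asg_tm k))"

primrec grow_tm :: "nat \<Rightarrow> tm \<Rightarrow> tm" where
  "grow_tm 0 t = t"
| "grow_tm (Suc n) t = Add (pair_tm (grow_tm n t) (grow_tm n t)) One"

lemma eval_lift_shift: "eval_tm M s (lift_tm t) = eval_tm M (\<lambda>n. s (Suc n)) t"
  by (induction t) auto

lemma eval_asg_tm: "eval_tm M s (asg_tm k) = asg_code M k s"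
  by (induction k arbitrary: s) (auto simp: pair_tm_def pair_def eval_lift_shift)

lemma eval_grow_tm: "eval_tm M s (grow_tm n t) = grow M n (eval_tm M s t)"
  by (induction n) (auto simp: pair_tm_def pair_def)

lemma vars_asg_tm: "vars_tm (asg_tm k) \<subseteq> {..<k}"
  by (induction k) (auto simp: pair_tm_def vars_lift_tm)

lemma vars_grow_tm: "vars_tm (grow_tm n t) = vars_tm t"
  by (induction n) (auto simp: pair_tm_def)

definition truth :: "'a arith_struct \<Rightarrow> 'a \<Rightarrow> 'a \<Rightarrow> bool" where
  "truth M e x \<longleftrightarrow> (\<exists>w H. table M w H (e \<oplus>\<^bsub>M\<^esub> \<one>\<^bsub>M\<^esub>) \<and> entry M w H e x)"

lemma S1_truth: "S1 (\<lambda>M s. truth M (s 0) (s 1))"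
  unfolding truth_def by (intro S1_intros S1_D1[OF D1_table] S1_D1[OF D1_entry] F1_intros)

text \<open>
  A table evaluates \<open>\<phi>\<close> correctly only if it is wide enough. The conjunct \<open>b = b\<close> holds in a table
  only if the value of \<open>b\<close> is below its width.
\<close>

definition guarded :: "nat \<Rightarrow> fm \<Rightarrow> fm" where
  "guarded k \<phi> = (let b = grow_tm (fm_depth \<phi>) (asg_tm k) in And \<phi> (Eq b b))"

lemma (in model) truth_guarded:
  assumes "Delta0 \<phi>" "free_vars \<phi> \<subseteq> {..<k}"
  shows "truth M (fm_code M (guarded k \<phi>)) (asg_code M k s) \<longleftrightarrow> sat M s \<phi>"
proof -
  let ?\<sigma> = "asg_code M k s" and ?b = "grow_tm (fm_depth \<phi>) (asg_tm k)"
  let ?e = "fm_code M (guarded k \<phi>)"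
  have e: "?e = fm_code M (fm.And \<phi> (fm.Eq ?b ?b))" by (simp add: guarded_def Let_def)
  have less: "?e \<prec> ?e \<oplus> \<one>" by (simp add: less_Suc)
  have sub: "fm_code M \<phi> \<prec> ?e \<oplus> \<one>" "fm_code M (fm.Eq ?b ?b) \<prec> ?e \<oplus> \<one>"
    unfolding e using less[unfolded e] less_node[of 10] sr.less_trans by fastforce+
  have vars: "free_vars (fm.Eq ?b ?b) \<subseteq> {..<k}" using vars_asg_tm by (simp add: vars_grow_tm)
  have b: "eval_tm M s ?b = grow M (fm_depth \<phi>) ?\<sigma>" by (simp add: eval_grow_tm eval_asg_tm)
  have clause: "entry M w H ?e ?\<sigma> \<longleftrightarrow> ?\<sigma> \<prec> w \<and> entry M w H (fm_code M \<phi>) ?\<sigma> \<and>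
      entry M w H (fm_code M (fm.Eq ?b ?b)) ?\<sigma>" if "table M w H (?e \<oplus> \<one>)" for w H
    unfolding table_entry[OF that less] unfolding e fm_code.simps clause_node ..
  show ?thesis
  proof
    assume "truth M ?e ?\<sigma>"
    then obtain w H where t: "table M w H (?e \<oplus> \<one>)" and ent: "entry M w H ?e ?\<sigma>"
      unfolding truth_def by blast
    then have "grow M (fm_depth \<phi>) ?\<sigma> \<prec> w"
      using entry_Eq(1)[OF t sub(2) vars, of s] clause[OF t] b by simp
    from entry_fm[OF t assms(1) sub(1) assms(2) this] show "sat M s \<phi>"
      using ent clause[OF t] by blast
  next
    assume "sat M s \<phi>"
    let ?x = "grow M (fm_depth \<phi>) ?\<sigma>" and ?y = "grow M (fm_depth (fm.Eq ?b ?b)) ?\<sigma>"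
    obtain w where w: "?x \<prec> w" "?y \<prec> w" using ub2 by blast
    obtain H where t: "table M w H (?e \<oplus> \<one>)" using table_ex by blast
    have "entry M w H (fm_code M \<phi>) ?\<sigma>"
      using entry_fm[OF t assms(1) sub(1) assms(2) w(1)] \<open>sat M s \<phi>\<close> by simp
    moreover have "entry M w H (fm_code M (fm.Eq ?b ?b)) ?\<sigma>"
      using entry_Eq(2)[OF t sub(2) vars w(2)] by simp
    moreover have "?\<sigma> \<prec> w" using w(1) le_grow sr.le_less_trans by blast
    ultimately show "truth M ?e ?\<sigma>" unfolding truth_def using t clause[OF t] by blast
  qed
qed

text \<open>\<open>k\<close> packs a formula code with a parameter, and \<open>w\<close> bounds a
  witness together with its verification. The two halves of the last condition differ in strength: a
  witness of \<open>P\<close> gives some \<open>w\<close>, while every \<open>w\<close> bounds a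
  witness of \<open>P\<close>. Reading \<open>b\<close> for \<open>w\<close> in \<open>N\<close>
  thus yields a witness below \<open>b\<close>. The formula \<open>\<psi>\<close> does not depend on
  the model.\<close>

definition universal :: "('a arith_struct \<Rightarrow> 'a \<Rightarrow> 'a \<Rightarrow> 'a \<Rightarrow> bool) \<Rightarrow> bool" where
  "universal V \<longleftrightarrow> D1 (\<lambda>M s. V M (s 0) (s 1) (s 2)) \<and>
    (\<forall>M k y w w'. model M \<longrightarrow> V M k y w \<longrightarrow> w \<preceq>\<^bsub>M\<^esub> w' \<longrightarrow> V M k y w') \<and>
    (\<forall>P. D0 (\<lambda>M s. P M (s 0) (s 1) (s 2)) \<longrightarrow> (\<exists>\<psi>. \<forall>M i y. model M \<longrightarrow>
      ((\<exists>z. P M i y z) \<longrightarrow> (\<exists>w. V M (pair M (fm_code M \<psi>) i) y w)) \<and>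
      (\<forall>w. V M (pair M (fm_code M \<psi>) i) y w \<longrightarrow> (\<exists>z. z \<prec>\<^bsub>M\<^esub> w \<and> P M i y z))))"

lemma universal_ex: "\<exists>V :: 'a arith_struct \<Rightarrow> 'a \<Rightarrow> 'a \<Rightarrow> 'a \<Rightarrow> bool. universal V"
proof -
  obtain Q :: "'a rel" where Q: "D0 Q"
    "\<And>M s. model M \<Longrightarrow> truth M (s 0) (s 1) = (\<exists>z. Q M (case_nat z s))"
    using S1_truth unfolding S1_def by auto
  define T where "T M e x z = Q M (case_nat z (case_nat e (\<lambda>_. x)))" for M e x z
  have T: "truth M e x \<longleftrightarrow> (\<exists>z. T M e x z)" if "model M" for M e x
    using Q(2)[OF that, of "case_nat e (\<lambda>_. x)"] by (simp add: T_def)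
  have "D0 (\<lambda>M s. T M (s 0) (s 1) (s 2))"
    unfolding T_def
    apply (rule D0_renI[OF Q(1), of "case_nat 2 (case_nat 0 (\<lambda>_. 1))"])
    apply (auto split: nat.split)
    done
  note D1_T = D1_subst3[where P = T, OF D1_D0[OF this]]
  \<comment> \<open>The components of \<open>k\<close> are sought below
    \<open>k \<oplus> \<one>\<close>, which suffices by \<open>pair_ge\<close> and keeps
    \<open>V\<close> Delta1. The hidden witness of \<open>truth\<close> is
    \<open>z'\<close>.\<close>
  define V where "V M k y w \<longleftrightarrow> (\<exists>z. z \<prec>\<^bsub>M\<^esub> w \<and>
    (\<exists>e. e \<prec>\<^bsub>M\<^esub> k \<oplus>\<^bsub>M\<^esub> \<one>\<^bsub>M\<^esub> \<and> (\<exists>i. i \<prec>\<^bsub>M\<^esub> k \<oplus>\<^bsub>M\<^esub> \<one>\<^bsub>M\<^esub> \<and> k = pair M e i \<and>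
      (\<exists>z'. z' \<prec>\<^bsub>M\<^esub> w \<and> T M e (pair M i (pair M y (pair M z \<zero>\<^bsub>M\<^esub>))) z'))))" for M k y w
  have "universal V"
    unfolding universal_def
  proof (intro conjI allI impI)
    show "D1 (\<lambda>M s. V M (s 0) (s 1) (s 2))"
      unfolding V_def by (intro D1_intros D1_T F1_pair F1_intros)
  next
    fix M :: "'a arith_struct" and k y w w'
    assume "model M" "V M k y w" "w \<preceq>\<^bsub>M\<^esub> w'"
    moreover interpret model M by fact
    have "z \<prec>\<^bsub>M\<^esub> w'" if "z \<prec>\<^bsub>M\<^esub> w" for z using that \<open>w \<preceq>\<^bsub>M\<^esub> w'\<close> sr.less_le_trans by blast
    ultimately show "V M k y w'" unfolding V_def by blast
  next
    fix P :: "'a arith_struct \<Rightarrow> 'a \<Rightarrow> 'a \<Rightarrow> 'a \<Rightarrow> bool"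
    assume "D0 (\<lambda>M s. P M (s 0) (s 1) (s 2))"
    then obtain \<phi> where \<phi>: "Delta0 \<phi>" "\<And>M s. model M \<Longrightarrow> P M (s 0) (s 1) (s 2) = sat M s \<phi>"
      unfolding D0_def by blast
    \<comment> \<open>The formula behind \<open>P\<close> may mention further variables, on which
      \<open>P\<close> does not depend. Setting them to \<open>Zero\<close> leaves at most three
      free variables, so an assignment code of length 3 suffices.\<close>
    define \<phi>' where "\<phi>' = subst_fm \<phi> (\<lambda>n. if n < 3 then Var n else Zero)"
    have "Delta0 \<phi>'" unfolding \<phi>'_def by (rule Delta0_subst_fm[OF \<phi>(1)])
    have "free_vars \<phi>' \<subseteq> {..<3}" by (auto simp: \<phi>'_def free_vars_subst_fm split: if_splits)
    have \<phi>': "P M (s 0) (s 1) (s 2) = sat M s \<phi>'" if "model M" for M s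
      using \<phi>(2)[OF that, of "\<lambda>n. eval_tm M s (if n < 3 then Var n else Zero)"]
      by (simp add: \<phi>'_def sat_subst_fm)
    have "((\<exists>z. P M i y z) \<longrightarrow> (\<exists>w. V M (pair M (fm_code M (guarded 3 \<phi>')) i) y w)) \<and>
      (\<forall>w. V M (pair M (fm_code M (guarded 3 \<phi>')) i) y w \<longrightarrow> (\<exists>z. z \<prec>\<^bsub>M\<^esub> w \<and> P M i y z))"
      if M: "model M" for M i y
    proof -
      interpret model M by (rule M)
      let ?e = "fm_code M (guarded 3 \<phi>')"
      have tr: "truth M ?e (pair M i (pair M y (pair M z \<zero>\<^bsub>M\<^esub>))) \<longleftrightarrow> P M i y z" for z
        using truth_guarded[OF \<open>Delta0 \<phi>'\<close> \<open>free_vars \<phi>' \<subseteq> {..<3}\<close>, of "(!) [i, y, z]"]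
          \<phi>'[OF M, of "(!) [i, y, z]"] by (simp add: numeral_3_eq_3)
      show ?thesis
      proof (intro conjI impI allI)
        assume "\<exists>z. P M i y z"
        then obtain z where "P M i y z" by blast
        then obtain z' where z': "T M ?e (pair M i (pair M y (pair M z \<zero>\<^bsub>M\<^esub>))) z'"
          using tr T[OF M] by blast
        obtain w where "z \<prec>\<^bsub>M\<^esub> w" "z' \<prec>\<^bsub>M\<^esub> w" using ub2 by blast
        with z' have "V M (pair M ?e i) y w"
          unfolding V_def less_Suc using pair_ge by blast
        then show "\<exists>w. V M (pair M ?e i) y w" by blast
      next
        fix w assume "V M (pair M ?e i) y w"
        then obtain z z' where "z \<prec>\<^bsub>M\<^esub> w" "T M ?e (pair M i (pair M y (pair M z \<zero>\<^bsub>M\<^esub>))) z'"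
          unfolding V_def by auto
        then show "\<exists>z. z \<prec>\<^bsub>M\<^esub> w \<and> P M i y z" using tr T[OF M] by blast
      qed
    qed
    then show "\<exists>\<psi>. \<forall>M i y. model M \<longrightarrow>
      ((\<exists>z. P M i y z) \<longrightarrow> (\<exists>w. V M (pair M (fm_code M \<psi>) i) y w)) \<and>
      (\<forall>w. V M (pair M (fm_code M \<psi>) i) y w \<longrightarrow> (\<exists>z. z \<prec>\<^bsub>M\<^esub> w \<and> P M i y z))"
      by blast
  qed
  then show ?thesis by (intro exI)
qed

section \<open>Back and forth\<close>

context model
begin

text \<open>Otherwise the Sigma1 relation \<open>P\<close> would define exactly \<open>I\<close>, a
  proper subset containing zero and closed under successor.\<close>

lemma overspill:
  assumes "S1 (\<lambda>M s. P M (s 0) (\<lambda>n. s (Suc n)))" "\<zero> \<in> I" "\<And>x. x \<in> I \<Longrightarrow> x \<oplus> \<one> \<in> I"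
    "I \<noteq> UNIV" "\<And>k. k \<in> I \<Longrightarrow> P M k s"
  shows "\<exists>k. k \<notin> I \<and> P M k s"
proof (rule ccontr)
  assume *: "\<not> ?thesis"
  have "P M k s" for k
  proof (rule S1_induct[where P = P, OF assms(1)])
    show "P M \<zero> s" using assms(2,5) by blast
    show "P M (x \<oplus> \<one>) s" if "P M x s" for x using that * assms(3,5) by blast
  qed
  with * assms(4) show False by blast
qed

text \<open>The least element satisfying \<open>P\<close> cannot lie outside \<open>I\<close>: it
  would be a successor whose predecessor is outside \<open>I\<close> too and satisfies
  \<open>P\<close>.\<close>

lemma underspill:
  assumes "S1 (\<lambda>M s. P M (s 0) (\<lambda>n. s (Suc n)))" "\<zero> \<in> I" "\<And>x. x \<in> I \<Longrightarrow> x \<oplus> \<one> \<in> I"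
    "I \<noteq> UNIV" "\<And>k. k \<notin> I \<Longrightarrow> P M k s"
  shows "\<exists>k. k \<in> I \<and> P M k s"
proof -
  obtain e where "e \<notin> I" using assms(4) by blast
  then obtain x where x: "P M x s" "\<And>y. y \<prec> x \<Longrightarrow> \<not> P M y s"
    using S1_least[of P e s] assms(1,5) by blast
  have "x \<in> I"
  proof (rule ccontr)
    assume "x \<notin> I"
    then obtain y where y: "x = y \<oplus> \<one>" using zero_or_Suc[of x] assms(2) by auto
    then have "y \<notin> I" using assms(3) \<open>x \<notin> I\<close> by blast
    moreover have "y \<prec> x" using y by (simp add: less_Suc)
    ultimately show False using assms(5) x(2) by blast
  qed
  with x(1) show ?thesis by blast
qed

end

section \<open>Two models sharing a cut that is closed under exponentiation\<close>

locale shared_models = M: model M + N: model N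
  for M N :: "'a arith_struct" +
  fixes I :: "'a set"
  assumes shared: "shared_cut I M N" and exp_closed: "closed_under_exp I M"
begin

lemma cut_M: "cut I M" and cut_N: "cut I N" and proper: "I \<noteq> UNIV"
  using shared M.carrier_UNIV unfolding shared_cut_def proper_cut_def by auto

lemma initial_M: "initial_segment I M" and initial_N: "initial_segment I N"
  using cut_M cut_N unfolding cut_def by auto

lemma down_M: "x \<in> I \<Longrightarrow> y \<prec>\<^bsub>M\<^esub> x \<Longrightarrow> y \<in> I"
  using initial_M M.carrier_UNIV unfolding initial_segment_def by blast

lemma down_N: "x \<in> I \<Longrightarrow> y \<prec>\<^bsub>N\<^esub> x \<Longrightarrow> y \<in> I"
  using initial_N N.carrier_UNIV unfolding initial_segment_def by blast

lemma nonempty: "I \<noteq> {}"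
  using initial_M unfolding initial_segment_def by blast

lemma no_max: "x \<in> I \<Longrightarrow> \<exists>y\<in>I. x \<prec>\<^bsub>M\<^esub> y"
  using cut_M unfolding cut_def by blast

lemma down_le: "x \<in> I \<Longrightarrow> y \<preceq>\<^bsub>M\<^esub> x \<Longrightarrow> y \<in> I"
  using down_M unfolding le_def by blast

lemma zero_in: "\<zero>\<^bsub>M\<^esub> \<in> I" "\<zero>\<^bsub>N\<^esub> \<in> I"
  using nonempty down_M down_N M.zero_le N.zero_le unfolding le_def by blast+

lemma Suc_in: "x \<in> I \<Longrightarrow> x \<oplus>\<^bsub>M\<^esub> \<one>\<^bsub>M\<^esub> \<in> I"
  using no_max M.Suc_le down_le by blast

lemma zero_eq: "\<zero>\<^bsub>M\<^esub> = \<zero>\<^bsub>N\<^esub>"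
  using shared zero_in unfolding shared_cut_def same_structure_on_def by blast

lemma one_in: "\<one>\<^bsub>M\<^esub> \<in> I"
  using Suc_in[OF zero_in(1)] by simp

lemma one_eq: "\<one>\<^bsub>M\<^esub> = \<one>\<^bsub>N\<^esub>"
  using shared one_in unfolding shared_cut_def same_structure_on_def by blast

lemma less_eq: "x \<in> I \<Longrightarrow> y \<in> I \<Longrightarrow> x \<prec>\<^bsub>M\<^esub> y \<longleftrightarrow> x \<prec>\<^bsub>N\<^esub> y"
  using shared unfolding shared_cut_def same_structure_on_def by blast

lemma exp_in: "x \<in> I \<Longrightarrow> exp2 M x \<in> I"
  using exp_closed M.exp_graph_eq unfolding closed_under_exp_def by auto

text \<open>A cut need not be closed under addition. Closure under exponentiation supplies this and
  then products, by comparison with powers of two.\<close>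

lemma double_in: assumes "x \<in> I" shows "x \<oplus>\<^bsub>M\<^esub> x \<in> I"
proof -
  have "x \<oplus>\<^bsub>M\<^esub> x \<prec>\<^bsub>M\<^esub> exp2 M (x \<oplus>\<^bsub>M\<^esub> \<one>\<^bsub>M\<^esub>)"
    unfolding M.exp2_Suc by (intro M.sr.add_strict_mono M.less_exp2)
  then show ?thesis using exp_in Suc_in assms down_M by blast
qed

lemma ub_in: assumes "x \<in> I" "y \<in> I" obtains z where "z \<in> I" "x \<preceq>\<^bsub>M\<^esub> z" "y \<preceq>\<^bsub>M\<^esub> z"
  using assms M.sr.le_cases M.sr.order.refl by metis

lemma add_in: assumes "x \<in> I" "y \<in> I" shows "x \<oplus>\<^bsub>M\<^esub> y \<in> I"
proof -
  obtain z where "z \<in> I" "x \<preceq>\<^bsub>M\<^esub> z" "y \<preceq>\<^bsub>M\<^esub> z" using assms by (rule ub_in)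
  then show ?thesis using double_in down_le M.sr.add_mono by blast
qed

lemma mult_in: assumes "x \<in> I" "y \<in> I" shows "x \<otimes>\<^bsub>M\<^esub> y \<in> I"
proof -
  obtain z where z: "z \<in> I" "x \<preceq>\<^bsub>M\<^esub> z" "y \<preceq>\<^bsub>M\<^esub> z" using assms by (rule ub_in)
  have "x \<preceq>\<^bsub>M\<^esub> exp2 M z" "y \<preceq>\<^bsub>M\<^esub> exp2 M z"
    using z M.less_exp2 M.sr.less_imp_le M.sr.order_trans by blast+
  then have "x \<otimes>\<^bsub>M\<^esub> y \<preceq>\<^bsub>M\<^esub> exp2 M (z \<oplus>\<^bsub>M\<^esub> z)"
    unfolding M.exp2_add by (intro M.sr.mult_mono) auto
  then show ?thesis using exp_in double_in z(1) down_le by blast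
qed

lemma add_eq: "x \<in> I \<Longrightarrow> y \<in> I \<Longrightarrow> x \<oplus>\<^bsub>M\<^esub> y = x \<oplus>\<^bsub>N\<^esub> y"
  using shared add_in unfolding shared_cut_def same_structure_on_def by metis

lemma mult_eq: "x \<in> I \<Longrightarrow> y \<in> I \<Longrightarrow> x \<otimes>\<^bsub>M\<^esub> y = x \<otimes>\<^bsub>N\<^esub> y"
  using shared mult_in unfolding shared_cut_def same_structure_on_def by metis

lemma Suc_in_N: "x \<in> I \<Longrightarrow> x \<oplus>\<^bsub>N\<^esub> \<one>\<^bsub>N\<^esub> \<in> I"
  using Suc_in add_eq one_in one_eq by metis

lemma pair_in: "x \<in> I \<Longrightarrow> y \<in> I \<Longrightarrow> pair M x y \<in> I"
  unfolding pair_def by (intro add_in mult_in)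

lemma pair_eq: "x \<in> I \<Longrightarrow> y \<in> I \<Longrightarrow> pair M x y = pair N x y"
  unfolding pair_def by (simp add: add_eq[symmetric] mult_eq[symmetric] add_in mult_in)

text \<open>Relates a value computed in \<open>M\<close> to one computed in \<open>N\<close>;
  membership in \<open>I\<close> and equality have to go through the recursion on codes
  together.\<close>

definition same :: "'a \<Rightarrow> 'a \<Rightarrow> bool" where
  "same x y \<longleftrightarrow> x \<in> I \<and> x = y"

lemma same_zero: "same \<zero>\<^bsub>M\<^esub> \<zero>\<^bsub>N\<^esub>"
  using zero_in zero_eq by (simp add: same_def)

lemma same_num: "same (num M k) (num N k)"
proof (induction k)
  case (Suc k)
  then show ?case using Suc_in add_eq[OF _ one_in] one_eq by (auto simp: same_def)
qed (simp add: same_zero)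

lemma same_node: "same x x' \<Longrightarrow> same y y' \<Longrightarrow> same (node M k x y) (node N k x' y')"
  using same_num[of k] pair_in pair_eq unfolding same_def node_def by metis

lemma same_var_code: "same (var_code M n) (var_code N n)"
  by (induction n) (auto simp only: var_code.simps intro!: same_node same_zero)

lemma same_tm_code: "same (tm_code M t) (tm_code N t)"
  by (induction t) (auto simp only: tm_code.simps intro!: same_node same_zero same_var_code)

lemma same_fm_code: "same (fm_code M \<phi>) (fm_code N \<phi>)"
  by (induction \<phi>) (auto simp only: fm_code.simps intro!: same_node same_zero same_tm_code)

lemma below_outside_M: "x \<in> I \<Longrightarrow> k \<notin> I \<Longrightarrow> x \<prec>\<^bsub>M\<^esub> k"
  using down_le M.sr.not_le by blast

lemma below_outside_N: "x \<in> I \<Longrightarrow> k \<notin> I \<Longrightarrow> x \<prec>\<^bsub>N\<^esub> k"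
  using down_N N.sr.less_linear by blast

text \<open>Comprehension up to \<open>k\<close> yields a code below \<open>exp2 M k\<close>, and
  closure under exponentiation keeps that code in \<open>I\<close>.\<close>

lemma trace_in:
  assumes "k \<in> I"
  shows "\<exists>t\<in>I. \<forall>x. x \<prec>\<^bsub>M\<^esub> k \<longrightarrow> (ack_mem M x t \<longleftrightarrow> ack_mem M x s)"
proof -
  have "S1 (\<lambda>M s. ack_mem M (s 0) (s (Suc 0)))" by (intro S1_D1[OF D1_ack] F1_intros)
  from M.S1_comprehension[of "\<lambda>M x s. ack_mem M x (s 0)", OF this, of k "\<lambda>_. s"]
  show ?thesis using exp_in[OF assms] down_M by blast
qed

end

section \<open>Preservation of Sigma1 properties with witnesses below \<open>b\<close>\<close>

locale type_transfer = shared_models M N I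
  for M N :: "'a arith_struct" and I +
  fixes b :: 'a
begin

text \<open>Tuples are packed into single elements by \<open>pair\<close>, so \<open>u\<close> and
  \<open>v\<close> stand for all elements chosen so far. \<open>P\<close> ranges over uniformly
  definable relations instead of formulas, so that the same \<open>P\<close> is evaluated in
  \<open>M\<close> and in \<open>N\<close>.\<close>

definition preserves :: "'a \<Rightarrow> 'a \<Rightarrow> bool" where
  "preserves u v \<longleftrightarrow> (\<forall>i\<in>I. \<forall>P. D0 (\<lambda>M s. P M (s 0) (s 1) (s 2)) \<longrightarrow>
    (\<exists>z. P M i u z) \<longrightarrow> (\<exists>z. z \<prec>\<^bsub>N\<^esub> b \<and> P N i v z))"

lemma preservesD:
  assumes "preserves u v" "D0 (\<lambda>M s. P M (s 0) (s 1) (s 2))" "i \<in> I" "\<exists>z. P M i u z"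
  shows "\<exists>z. z \<prec>\<^bsub>N\<^esub> b \<and> P N i v z"
  by (rule assms(1)[unfolded preserves_def, rule_format, OF assms(3,2,4)])

text \<open>The witness handed over is an element above both \<open>t\<close> and the hidden witness
  of \<open>Q\<close>. Its counterpart in \<open>N\<close> is below \<open>b\<close>, and therefore
  so is \<open>t'\<close>.\<close>

lemma preserves_S1:
  assumes "preserves u v" "S1 (\<lambda>M s. Q M (s 0) (s 1) (s 2))" "i \<in> I" "Q M i u t"
  shows "\<exists>t'. t' \<prec>\<^bsub>N\<^esub> b \<and> Q N i v t'"
proof -
  obtain Q' where Q': "D0 Q'" "\<And>M s. model M \<Longrightarrow> Q M (s 0) (s 1) (s 2) = (\<exists>z. Q' M (case_nat z s))"
    using assms(2) unfolding S1_def by auto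
  define R where "R M z i u t = Q' M (case_nat z (case_nat i (case_nat u (\<lambda>_. t))))" for M z i u t
  have QR: "Q M i u t \<longleftrightarrow> (\<exists>z. R M z i u t)" if "model M" for M i u t
    using Q'(2)[OF that, of "case_nat i (case_nat u (\<lambda>_. t))"]
    by (simp add: R_def numeral_2_eq_2)
  let ?P = "\<lambda>M i u z. \<exists>t. t \<prec>\<^bsub>M\<^esub> z \<and> (\<exists>z'. z' \<prec>\<^bsub>M\<^esub> z \<and> R M z' i u t)"
  have "D0 (\<lambda>M s. ?P M (s 0) (s 1) (s 2))"
    unfolding R_def
    apply (intro D0_bex trm_intros)
    apply (rule D0_renI[OF Q'(1), of "case_nat 0 (case_nat 2 (case_nat 3 (\<lambda>_. 1)))"])
    apply (auto split: nat.split simp: eval_nat_numeral)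
    done
  moreover have "\<exists>z. ?P M i u z"
    using assms(4) QR[OF M.model_axioms] M.ub2 by meson
  ultimately obtain z where z: "z \<prec>\<^bsub>N\<^esub> b" "?P N i v z"
    using preservesD[OF assms(1), of ?P i] assms(3) by blast
  then obtain t' z' where "t' \<prec>\<^bsub>N\<^esub> z" "R N z' i v t'" by blast
  then show ?thesis using z(1) QR[OF N.model_axioms] N.sr.less_trans by blast
qed

lemma preserves_S1_pair:
  assumes "preserves u v" "S1 (\<lambda>M s. Q M (s 0) (s 1) (s 2) (s 3))" "i \<in> I" "j \<in> I" "Q M i j u t"
  shows "\<exists>t'. t' \<prec>\<^bsub>N\<^esub> b \<and> Q N i j v t'"
proof -
  let ?Q = "\<lambda>M k u t. \<exists>i j. k = pair M i j \<and> Q M i j u t"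
  have "S1 (\<lambda>M s. ?Q M (s 0) (s 1) (s 2))"
    by (intro S1_intros S1_subst4[where P = Q, OF assms(2)] F1_pair F1_intros)
  moreover have "?Q M (pair M i j) u t" using assms(5) by blast
  ultimately obtain t' where "t' \<prec>\<^bsub>N\<^esub> b" "?Q N (pair M i j) v t'"
    using preserves_S1[OF assms(1), of ?Q] pair_in assms(3,4) by blast
  then show ?thesis using pair_eq[OF assms(3,4)] by auto
qed

text \<open>Both \<open>ack_mem\<close> and its negation are Sigma1, so preservation in one
  direction gives the equivalence.\<close>

lemma ack_mem_eq:
  assumes "preserves u v" "x \<in> I" "y \<in> I"
  shows "ack_mem M x y \<longleftrightarrow> ack_mem N x y"
proof -
  have "S1 (\<lambda>M s. ack_mem M (s 0) (s 1))" "S1 (\<lambda>M s. \<not> ack_mem M (s 0) (s 1))"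
    using D1_ack_aux unfolding D1_def by auto
  then show ?thesis
    using preserves_S1_pair[OF assms(1) _ assms(2,3), of "\<lambda>M i j u t. ack_mem M i j"]
      preserves_S1_pair[OF assms(1) _ assms(2,3), of "\<lambda>M i j u t. \<not> ack_mem M i j"] by blast
qed

end

locale back_and_forth = type_transfer M N I b
  for M N :: "'a arith_struct" and I b +
  fixes V :: "'a arith_struct \<Rightarrow> 'a \<Rightarrow> 'a \<Rightarrow> 'a \<Rightarrow> bool"
  assumes same_SSy: "SSy I M = SSy I N" and V: "universal V"
begin

lemma V_D1: "D1 (\<lambda>M s. V M (s 0) (s 1) (s 2))"
  using V unfolding universal_def by simp

lemmas V_mono = V[unfolded universal_def, THEN conjunct2, THEN conjunct1, rule_format]
  and V_universal = V[unfolded universal_def, THEN conjunct2, THEN conjunct2, rule_format]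

lemmas D1_V = D1_subst3[where P = V, OF V_D1]

lemma SSy_M_N: "\<exists>s'. \<forall>x\<in>I. ack_mem M x s \<longleftrightarrow> ack_mem N x s'"
proof -
  have "ack_ext M s \<inter> I \<in> SSy I M"
    using M.carrier_UNIV unfolding SSy_def by blast
  then have "ack_ext M s \<inter> I \<in> SSy I N" by (simp only: same_SSy)
  then show ?thesis using M.carrier_UNIV N.carrier_UNIV unfolding SSy_def ack_ext_def by auto
qed

lemma SSy_N_M: "\<exists>s. \<forall>x\<in>I. ack_mem M x s \<longleftrightarrow> ack_mem N x s'"
proof -
  have "ack_ext N s' \<inter> I \<in> SSy I N"
    using N.carrier_UNIV unfolding SSy_def by blast
  then have "ack_ext N s' \<inter> I \<in> SSy I M" by (simp only: same_SSy)
  then show ?thesis using M.carrier_UNIV N.carrier_UNIV unfolding SSy_def ack_ext_def by auto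
qed

text \<open>The indices \<open>pair M (fm_code M \<psi>) i\<close> lie in \<open>I\<close> and are
  the same in both models, so one subset of \<open>I\<close> represents all formulas with all
  parameters. Such subsets are what the common standard system can transfer.\<close>

lemma preservesI:
  assumes "\<And>x. x \<in> I \<Longrightarrow> (\<exists>w. V M x u w) \<Longrightarrow> V N x v b"
  shows "preserves u v"
  unfolding preserves_def
proof (intro ballI allI impI)
  fix i P assume i: "i \<in> I" and P: "D0 (\<lambda>M s. P M (s 0) (s 1) (s 2))" "\<exists>z. P M i u z"
  from V_universal[OF P(1)] obtain \<psi> where \<psi>: "\<And>M i y. model M \<Longrightarrow>
      ((\<exists>z. P M i y z) \<longrightarrow> (\<exists>w. V M (pair M (fm_code M \<psi>) i) y w)) \<and>
      (\<forall>w. V M (pair M (fm_code M \<psi>) i) y w \<longrightarrow> (\<exists>z. z \<prec>\<^bsub>M\<^esub> w \<and> P M i y z))"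
    by blast
  let ?k = "pair M (fm_code M \<psi>) i"
  have k: "?k \<in> I" "?k = pair N (fm_code N \<psi>) i"
    using same_fm_code[of \<psi>] pair_in[OF _ i] pair_eq[OF _ i] unfolding same_def by metis+
  have "\<exists>w. V M ?k u w" using \<psi>[OF M.model_axioms] P(2) by blast
  then have "V N ?k v b" by (rule assms[OF k(1)])
  then show "\<exists>z. z \<prec>\<^bsub>N\<^esub> b \<and> P N i v z" using \<psi>[OF N.model_axioms] unfolding k(2) by blast
qed

text \<open>
  The set of all \<open>x\<close> with \<open>\<exists>w. V x (u, m) w\<close> has a code on \<open>I\<close>, which is shared by \<open>N\<close>. Each of its
  initial pieces is coded by an element of \<open>I\<close>, so that \<open>\<exists>m\<close> realizing it is a formula with
  parameters in \<open>I\<close> and passes from \<open>M\<close> to \<open>N\<close>; overspill in \<open>N\<close> realizes the whole set.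
\<close>

lemma forth_step:
  assumes "preserves u v" shows "\<exists>m'. preserves (pair M u m) (pair N v m')"
proof -
  obtain e where e: "e \<notin> I" using proper by blast
  have "S1 (\<lambda>M s. \<exists>w. V M (s 0) (pair M (s (Suc 0)) (s (Suc 1))) w)"
    by (intro S1_intros S1_D1[OF D1_V] F1_pair F1_intros)
  from M.S1_comprehension[of "\<lambda>M x s. \<exists>w. V M x (pair M (s 0) (s 1)) w", OF this, of e "(!) [u, m]"]
  obtain S where "\<And>x. x \<prec>\<^bsub>M\<^esub> e \<Longrightarrow> ack_mem M x S \<longleftrightarrow> (\<exists>w. V M x (pair M u m) w)" by auto
  then have S: "ack_mem M x S \<longleftrightarrow> (\<exists>w. V M x (pair M u m) w)" if "x \<in> I" for x
    using that below_outside_M e by blast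
  obtain S' where S': "\<And>x. x \<in> I \<Longrightarrow> ack_mem M x S \<longleftrightarrow> ack_mem N x S'" using SSy_M_N by blast
  let ?P = "\<lambda>N k s. \<exists>m'. \<forall>x. x \<prec>\<^bsub>N\<^esub> k \<longrightarrow> (ack_mem N x (s 0) \<longrightarrow> V N x (pair N (s 1) m') (s 2))"
  let ?s = "(!) [S', v, b]"
  have "\<exists>k. k \<notin> I \<and> ?P N k ?s"
  proof (rule N.overspill[where P = ?P])
    show "S1 (\<lambda>M s. ?P M (s 0) (\<lambda>n. s (Suc n)))"
      by (intro S1_intros D1_ack S1_D1[OF D1_V] F1_pair F1_intros)
    show "\<zero>\<^bsub>N\<^esub> \<in> I" "I \<noteq> UNIV" "x \<in> I \<Longrightarrow> x \<oplus>\<^bsub>N\<^esub> \<one>\<^bsub>N\<^esub> \<in> I" for x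
      using zero_in proper Suc_in_N by blast+
    fix k assume k: "k \<in> I"
    obtain t where t: "t \<in> I" "\<And>x. x \<prec>\<^bsub>M\<^esub> k \<Longrightarrow> ack_mem M x t \<longleftrightarrow> ack_mem M x S"
      using trace_in[OF k] by blast
    \<comment> \<open>\<open>r\<close> packs \<open>m\<close> with the bound \<open>w\<close>.
      Preservation puts \<open>r\<close> below \<open>b\<close>, hence \<open>w\<close> is at most
      \<open>b\<close>, and monotonicity of \<open>V\<close> replaces \<open>w\<close> by
      \<open>b\<close>.\<close>
    let ?Q = "\<lambda>M t k u r. \<exists>m w. r = pair M m w \<and>
      (\<forall>x. x \<prec>\<^bsub>M\<^esub> k \<longrightarrow> (ack_mem M x t \<longrightarrow> V M x (pair M u m) w))"
    have "S1 (\<lambda>M s. ?Q M (s 0) (s 1) (s 2) (s 3))"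
      by (intro S1_intros D1_ack S1_D1[OF D1_V] F1_pair F1_intros)
    moreover have "\<exists>w. ?Q M t k u (pair M m w)"
    proof -
      \<comment> \<open>Collection bounds the witnesses for all \<open>x\<close> below
        \<open>k\<close>, and monotonicity of \<open>V\<close> makes the bound a common
        witness.\<close>
      let ?R = "\<lambda>M x w s. ack_mem M x (s 0) \<longrightarrow> V M x (pair M (s 1) (s 2)) w"
      have "S1 (\<lambda>M s. ?R M (s 0) (s 1) (\<lambda>n. s (Suc (Suc n))))"
        by (intro S1_intros D1_ack S1_D1[OF D1_V] F1_pair F1_intros)
      moreover have "\<exists>w. ?R M x w ((!) [t, u, m])" if "x \<prec>\<^bsub>M\<^esub> k" for x
        using S[of x] t(2)[OF that] down_M[OF k that] by auto
      ultimately obtain B where B: "\<forall>x. x \<prec>\<^bsub>M\<^esub> k \<longrightarrow> (\<exists>w. w \<prec>\<^bsub>M\<^esub> B \<and> ?R M x w ((!) [t, u, m]))"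
        using M.S1_collection[of ?R k "(!) [t, u, m]"] by blast
      have "V M x (pair M u m) B" if "x \<prec>\<^bsub>M\<^esub> k" "ack_mem M x t" for x
        using B that V_mono[OF M.model_axioms] M.sr.less_imp_le by fastforce
      then show ?thesis by blast
    qed
    ultimately obtain r where r: "r \<prec>\<^bsub>N\<^esub> b" "?Q N t k v r"
      using preserves_S1_pair[OF assms, of ?Q, OF _ t(1) k] by blast
    then obtain m' w where w: "r = pair N m' w"
      "\<And>x. x \<prec>\<^bsub>N\<^esub> k \<Longrightarrow> ack_mem N x t \<Longrightarrow> V N x (pair N v m') w" by blast
    have "w \<preceq>\<^bsub>N\<^esub> b"
      using r(1) w(1) N.pair_ge(2) N.sr.le_less_trans N.sr.less_imp_le by blast
    have "V N x (pair N v m') b" if x: "x \<prec>\<^bsub>N\<^esub> k" "ack_mem N x S'" for x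
    proof -
      have "x \<in> I" "x \<prec>\<^bsub>M\<^esub> k" using down_N[OF k x(1)] less_eq k x(1) by auto
      then have "ack_mem N x t" using t S' x(2) ack_mem_eq[OF assms] by blast
      then show ?thesis using w(2) x(1) \<open>w \<preceq>\<^bsub>N\<^esub> b\<close> V_mono[OF N.model_axioms] by blast
    qed
    then show "?P N k ?s" by auto
  qed
  then obtain k m' where "k \<notin> I" "\<And>x. x \<prec>\<^bsub>N\<^esub> k \<Longrightarrow> ack_mem N x S' \<Longrightarrow> V N x (pair N v m') b" by auto
  then have "preserves (pair M u m) (pair N v m')"
    using S S' below_outside_N by (intro preservesI) blast
  then show ?thesis ..
qed

text \<open>
  Dually, the set of all \<open>x\<close> for which \<open>V x (v, n) b\<close> fails has to be avoided by \<open>(u, m)\<close> in \<open>M\<close>. If no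
  \<open>m < u\<close> avoids some initial piece, then \<open>\<Sigma>\<^sub>1\<close> collection bounds the witnesses and the bound passes
  to \<open>N\<close>, which contradicts the choice of \<open>n\<close>. Here \<open>m < u\<close> is no restriction, since \<open>u\<close> codes a
  tuple containing an upper bound.
\<close>

lemma back_step:
  assumes "preserves u v" "n \<prec>\<^bsub>N\<^esub> v" shows "\<exists>m. preserves (pair M u m) (pair N v n)"
proof -
  obtain e where e: "e \<notin> I" using proper by blast
  have "S1 (\<lambda>M s. \<not> V M (s 0) (pair M (s (Suc 0)) (s (Suc 1))) (s (Suc 2)))"
    by (intro S1_intros D1_V F1_pair F1_intros)
  from N.S1_comprehension[of "\<lambda>M x s. \<not> V M x (pair M (s 0) (s 1)) (s 2)", OF this, of e "(!) [v, n, b]"]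
  obtain S' where "\<And>x. x \<prec>\<^bsub>N\<^esub> e \<Longrightarrow> ack_mem N x S' \<longleftrightarrow> \<not> V N x (pair N v n) b" by auto
  then have S': "ack_mem N x S' \<longleftrightarrow> \<not> V N x (pair N v n) b" if "x \<in> I" for x
    using that below_outside_N e by blast
  obtain S where S: "\<And>x. x \<in> I \<Longrightarrow> ack_mem M x S \<longleftrightarrow> ack_mem N x S'" using SSy_N_M by blast
  \<comment> \<open>\<open>?P\<close> says that the piece of \<open>S\<close> below \<open>k\<close>
    excludes every \<open>m\<close> below \<open>u\<close>. This is the Sigma1 statement here, not
    the existence of a good \<open>m\<close>; hence underspill: if it held for all \<open>k\<close>
    outside \<open>I\<close>, it would hold for some \<open>k\<close> in \<open>I\<close>.\<close>
  let ?P = "\<lambda>M k s. \<forall>m. m \<prec>\<^bsub>M\<^esub> s 1 \<longrightarrow>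
    (\<exists>x. x \<prec>\<^bsub>M\<^esub> k \<and> ack_mem M x (s 0) \<and> (\<exists>w. V M x (pair M (s 1) m) w))"
  let ?s = "(!) [S, u]"
  have S1_P: "S1 (\<lambda>M s. ?P M (s 0) (\<lambda>n. s (Suc n)))"
    by (intro S1_intros S1_D1[OF D1_ack] S1_D1[OF D1_V] F1_pair F1_intros)
  have "\<exists>k. k \<notin> I \<and> \<not> ?P M k ?s"
  proof (rule ccontr)
    assume "\<not> ?thesis"
    then obtain k where k: "k \<in> I" "?P M k ?s"
      using M.underspill[where P = ?P and I = I and s = ?s, OF S1_P] zero_in proper Suc_in by blast
    obtain t where t: "t \<in> I" "\<And>x. x \<prec>\<^bsub>M\<^esub> k \<Longrightarrow> ack_mem M x t \<longleftrightarrow> ack_mem M x S"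
      using trace_in[OF k(1)] by blast
    let ?Q = "\<lambda>M t k u w. \<forall>m. m \<prec>\<^bsub>M\<^esub> u \<longrightarrow>
      (\<exists>x. x \<prec>\<^bsub>M\<^esub> k \<and> ack_mem M x t \<and> V M x (pair M u m) w)"
    have "S1 (\<lambda>M s. ?Q M (s 0) (s 1) (s 2) (s 3))"
      by (intro S1_intros S1_D1[OF D1_ack] S1_D1[OF D1_V] F1_pair F1_intros)
    moreover have "\<exists>w. ?Q M t k u w"
    proof -
      let ?R = "\<lambda>M m w s. \<exists>x. x \<prec>\<^bsub>M\<^esub> s 1 \<and> ack_mem M x (s 0) \<and> V M x (pair M (s 2) m) w"
      have "S1 (\<lambda>M s. ?R M (s 0) (s 1) (\<lambda>n. s (Suc (Suc n))))"
        by (intro S1_intros S1_D1[OF D1_ack] S1_D1[OF D1_V] F1_pair F1_intros)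
      moreover have "\<exists>w. ?R M m w ((!) [t, k, u])" if m: "m \<prec>\<^bsub>M\<^esub> u" for m
      proof -
        obtain x w where "x \<prec>\<^bsub>M\<^esub> k" "ack_mem M x S" "V M x (pair M u m) w"
          using k(2) m by auto
        then show ?thesis using t(2) by auto
      qed
      ultimately obtain B where B: "\<forall>m. m \<prec>\<^bsub>M\<^esub> u \<longrightarrow> (\<exists>w. w \<prec>\<^bsub>M\<^esub> B \<and> ?R M m w ((!) [t, k, u]))"
        using M.S1_collection[of ?R u "(!) [t, k, u]"] by blast
      have "?Q M t k u B"
        using B V_mono[OF M.model_axioms] M.sr.less_imp_le by fastforce
      then show ?thesis by blast
    qed
    ultimately obtain w where w: "w \<prec>\<^bsub>N\<^esub> b" "?Q N t k v w"
      using preserves_S1_pair[OF assms(1), of ?Q, OF _ t(1) k(1)] by blast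
    then obtain x where x: "x \<prec>\<^bsub>N\<^esub> k" "ack_mem N x t" "V N x (pair N v n) w" using assms(2) by blast
    then have "V N x (pair N v n) b" using w(1) V_mono[OF N.model_axioms] N.sr.less_imp_le by blast
    moreover have "x \<in> I" "x \<prec>\<^bsub>M\<^esub> k" using down_N[OF k(1) x(1)] less_eq k(1) x(1) by auto
    then have "ack_mem N x S'" using t S x(2) ack_mem_eq[OF assms(1)] by blast
    ultimately show False using S' \<open>x \<in> I\<close> by blast
  qed
  then obtain k m where k: "k \<notin> I"
    "\<And>x w. x \<prec>\<^bsub>M\<^esub> k \<Longrightarrow> ack_mem M x S \<Longrightarrow> \<not> V M x (pair M u m) w" by auto
  then have "preserves (pair M u m) (pair N v n)"
    using S S' below_outside_M by (intro preservesI) blast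
  then show ?thesis ..
qed

end

section \<open>Enumerating both models\<close>

primrec peel :: "'a arith_struct \<Rightarrow> nat \<Rightarrow> 'a \<Rightarrow> 'a \<Rightarrow> bool" where
  "peel M 0 u x \<longleftrightarrow> u = x"
| "peel M (Suc k) u x \<longleftrightarrow> (\<exists>u' y. u = pair M u' y \<and> peel M k u' x)"

lemma S1_peel_aux: "S1 (\<lambda>M s. peel M k (s 0) (s 1))"
proof (induction k)
  case 0
  show ?case unfolding peel.simps by (intro S1_intros F1_intros)
next
  case (Suc k)
  show ?case
    unfolding peel.simps
    by (intro S1_intros S1_subst2[where P = "\<lambda>M. peel M k", OF Suc] F1_pair F1_intros)
qed

lemmas S1_peel = S1_subst2[where P = "\<lambda>M. peel M k" for k, OF S1_peel_aux]

lemma (in model) peel_unique: "peel M k u x \<Longrightarrow> peel M k u y \<Longrightarrow> x = y"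
  by (induction k arbitrary: u) auto

lemma peel_sequence:
  assumes "\<And>n. U (Suc n) = pair M (U n) (m n)"
  shows "peel M k (U (k + n)) (U n)"
  using assms by (induction k) auto

context back_and_forth
begin

text \<open>Each stage pairs the previous one with a new element, so stage \<open>p + q + r\<close>
  contains the three given stages and \<open>peel\<close> recovers them. A relation between three
  stages thereby becomes a relation on one, to which preservation applies.\<close>

lemma sequence_transfer:
  assumes U: "\<And>n. U (Suc n) = pair M (U n) (m n)" and W: "\<And>n. W (Suc n) = pair N (W n) (m' n)"
    and pres: "\<And>n. preserves (U n) (W n)" and i: "i \<in> I"
    and R: "S1 (\<lambda>M s. R M (s 0) (s 1) (s 2) (s 3))" "R M i (U p) (U q) (U r)"
  shows "R N i (W p) (W q) (W r)"
proof -
  let ?Q = "\<lambda>M i u t. \<exists>x y z. peel M (q + r) u x \<and> peel M (p + r) u y \<and> peel M (p + q) u z \<and> R M i x y z"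
  let ?n = "p + q + r"
  have "S1 (\<lambda>M s. ?Q M (s 0) (s 1) (s 2))"
    by (intro S1_intros S1_peel S1_subst4[where P = R, OF R(1)] F1_intros)
  moreover have peel: "peel M (q + r) (U ?n) (U p)" "peel M (p + r) (U ?n) (U q)"
    "peel M (p + q) (U ?n) (U r)" "peel N (q + r) (W ?n) (W p)" "peel N (p + r) (W ?n) (W q)"
    "peel N (p + q) (W ?n) (W r)"
    using peel_sequence[of U M m "q + r" p] peel_sequence[of U M m "p + r" q]
      peel_sequence[of U M m "p + q" r] peel_sequence[of W N m' "q + r" p]
      peel_sequence[of W N m' "p + r" q] peel_sequence[of W N m' "p + q" r] U W
    by (simp_all add: ac_simps)
  ultimately obtain t where "?Q N i (W ?n) t"
    using preserves_S1[OF pres, of ?Q i ?n] i R(2) by blast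
  then show ?thesis using peel N.peel_unique by blast
qed

end

lemma back_and_forth_embedding:
  fixes M N :: "nat arith_struct"
  assumes "back_and_forth M N I V" and "type_transfer.preserves M N I b c a"
  shows "\<exists>j. proper_initial_embedding M N j \<and> j c = a \<and> (\<forall>x. j x \<prec>\<^bsub>N\<^esub> b) \<and> (\<forall>i\<in>I. j i = i)"
proof -
  interpret back_and_forth M N I b V by fact
  let ?P = "\<lambda>n (u, v). preserves u v \<and> (n = 0 \<longrightarrow> u = c \<and> v = a)"
  \<comment> \<open>Even stages take in the elements of \<open>M\<close> in turn. Odd stages propose
    an element of \<open>N\<close> decoded from a pair, so that each is proposed infinitely often.
    It is accepted if it is below the current \<open>v\<close>; otherwise the stage adds some
    element of \<open>M\<close>.\<close>
  let ?Q = "\<lambda>n (u, v) (u', v'). \<exists>m m'. u' = pair M u m \<and> v' = pair N v m' \<and>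
    (even n \<longrightarrow> m = n div 2) \<and>
    (odd n \<longrightarrow> fst (prod_decode (n div 2)) \<prec>\<^bsub>N\<^esub> v \<longrightarrow> m' = fst (prod_decode (n div 2)))"
  have "\<exists>f. \<forall>n. ?P n (f n) \<and> ?Q n (f n) (f (Suc n))"
  proof (rule dependent_nat_choice)
    show "\<exists>x. ?P 0 x" using assms(2) by auto
    fix x :: "nat \<times> nat" and n :: nat assume x: "?P n x"
    obtain u v where uv: "x = (u, v)" "preserves u v" using x by (cases x) auto
    show "\<exists>y. ?P (Suc n) y \<and> ?Q n x y"
    proof (cases "odd n \<and> fst (prod_decode (n div 2)) \<prec>\<^bsub>N\<^esub> v")
      case True
      then obtain m where "preserves (pair M u m) (pair N v (fst (prod_decode (n div 2))))"
        using back_step[OF uv(2)] by blast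
      then show ?thesis using uv True
        by (intro exI[of _ "(pair M u m, pair N v (fst (prod_decode (n div 2))))"]) auto
    next
      case False
      obtain m' where "preserves (pair M u (n div 2)) (pair N v m')"
        using forth_step[OF uv(2)] by blast
      then show ?thesis using uv False
        by (intro exI[of _ "(pair M u (n div 2), pair N v m')"]) auto
    qed
  qed
  then obtain f where f: "\<forall>n. ?P n (f n) \<and> ?Q n (f n) (f (Suc n))" ..
  note f = f[rule_format, THEN conjunct1] f[rule_format, THEN conjunct2]
  define U where "U n = fst (f n)" for n
  define W where "W n = snd (f n)" for n
  have pres: "preserves (U n) (W n)" for n using f(1)[of n] by (auto simp: U_def W_def split: prod.splits)
  have init: "U 0 = c" "W 0 = a" using f(1)[of 0] by (auto simp: U_def W_def split: prod.splits)
  have "\<exists>m m'. U (Suc n) = pair M (U n) m \<and> W (Suc n) = pair N (W n) m' \<and>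
    (even n \<longrightarrow> m = n div 2) \<and>
    (odd n \<longrightarrow> fst (prod_decode (n div 2)) \<prec>\<^bsub>N\<^esub> W n \<longrightarrow> m' = fst (prod_decode (n div 2)))" for n
    using f(2)[of n] by (auto simp: U_def W_def split: prod.splits)
  then obtain m m' where U: "\<And>n. U (Suc n) = pair M (U n) (m n)"
    and W: "\<And>n. W (Suc n) = pair N (W n) (m' n)"
    and even: "\<And>n. even n \<Longrightarrow> m n = n div 2"
    and odd: "\<And>n. odd n \<Longrightarrow> fst (prod_decode (n div 2)) \<prec>\<^bsub>N\<^esub> W n \<Longrightarrow> m' n = fst (prod_decode (n div 2))"
    by metis
  note transfer = sequence_transfer[of U m W m', OF U W pres]
  have transfer_m: "R N i (m' p) (m' q) (m' r)"
    if R: "S1 (\<lambda>M s. R M (s 0) (s 1) (s 2) (s 3))" "R M i (m p) (m q) (m r)" and i: "i \<in> I" for R i p q r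
  proof -
    let ?R = "\<lambda>M i x y z. \<exists>x' y' z' m1 m2 m3. x = pair M x' m1 \<and> y = pair M y' m2 \<and> z = pair M z' m3 \<and> R M i m1 m2 m3"
    have "S1 (\<lambda>M s. ?R M (s 0) (s 1) (s 2) (s 3))"
      by (intro S1_intros S1_subst4[where P = R, OF R(1)] F1_pair F1_intros)
    moreover have "?R M i (U (Suc p)) (U (Suc q)) (U (Suc r))" unfolding U using R(2) by blast
    ultimately have "?R N i (W (Suc p)) (W (Suc q)) (W (Suc r))"
      using transfer[OF i, where R = ?R and p = "Suc p" and q = "Suc q" and r = "Suc r"] by blast
    then show ?thesis unfolding W by auto
  qed
  define j where "j x = m' (2 * x)" for x
  have m: "m (2 * x) = x" for x using even[of "2 * x"] by simp
  have j_add: "j (x \<oplus>\<^bsub>M\<^esub> y) = j x \<oplus>\<^bsub>N\<^esub> j y" for x y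
  proof -
    have S1: "S1 (\<lambda>M s. s 3 = s 1 \<oplus>\<^bsub>M\<^esub> s 2)" by (intro S1_intros F1_intros)
    show ?thesis
      using transfer_m[of "\<lambda>M i x y z. z = x \<oplus>\<^bsub>M\<^esub> y" "\<zero>\<^bsub>M\<^esub>" "2 * x" "2 * y" "2 * (x \<oplus>\<^bsub>M\<^esub> y)", OF S1 _ zero_in(1)] by (simp add: m j_def)
  qed
  have j_mult: "j (x \<otimes>\<^bsub>M\<^esub> y) = j x \<otimes>\<^bsub>N\<^esub> j y" for x y
  proof -
    have S1: "S1 (\<lambda>M s. s 3 = s 1 \<otimes>\<^bsub>M\<^esub> s 2)" by (intro S1_intros F1_intros)
    show ?thesis
      using transfer_m[of "\<lambda>M i x y z. z = x \<otimes>\<^bsub>M\<^esub> y" "\<zero>\<^bsub>M\<^esub>" "2 * x" "2 * y" "2 * (x \<otimes>\<^bsub>M\<^esub> y)", OF S1 _ zero_in(1)] by (simp add: m j_def)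
  qed
  have j_less: "j x \<prec>\<^bsub>N\<^esub> j y" if "x \<prec>\<^bsub>M\<^esub> y" for x y
  proof -
    have S1: "S1 (\<lambda>M s. s 1 \<prec>\<^bsub>M\<^esub> s 2)" by (intro S1_intros F1_intros)
    show ?thesis
      using transfer_m[of "\<lambda>M i x y z. x \<prec>\<^bsub>M\<^esub> y" "\<zero>\<^bsub>M\<^esub>" "2 * x" "2 * y" 0, OF S1 _ zero_in(1)] that by (simp add: m j_def)
  qed
  have j_I: "j i = i" if "i \<in> I" for i
  proof -
    have S1: "S1 (\<lambda>M s. s 1 = s 0)" by (intro S1_intros F1_intros)
    show ?thesis
      using transfer_m[of "\<lambda>M i x y z. x = i" i "2 * i" 0 0, OF S1 _ that] by (simp add: m j_def)
  qed
  \<comment> \<open>An element of \<open>M\<close> supplied by a back step occurs again at its own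
    even stage, and the equality of the two occurrences is transferred.\<close>
  have j_eq: "m' n = j (m n)" for n
  proof -
    have S1: "S1 (\<lambda>M s. s 1 = s 2)" by (intro S1_intros F1_intros)
    show ?thesis
      using transfer_m[of "\<lambda>M i x y z. x = y" "\<zero>\<^bsub>M\<^esub>" "n" "2 * m n" 0, OF S1 _ zero_in(1)] by (simp add: m j_def)
  qed
  have j_c: "j c = a"
  proof -
    \<comment> \<open>\<open>c\<close> is stage 0 and also the last component of stage
      \<open>Suc (2 * c)\<close>. This coincidence is transferred.\<close>
    let ?R = "\<lambda>M i x y z. \<exists>w. y = pair M w x"
    have "S1 (\<lambda>M s. ?R M (s 0) (s 1) (s 2) (s 3))" by (intro S1_intros F1_pair F1_intros)
    moreover have "?R M \<zero>\<^bsub>M\<^esub> (U 0) (U (Suc (2 * c))) (U 0)" unfolding init U m by blast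
    ultimately have "?R N \<zero>\<^bsub>M\<^esub> (W 0) (W (Suc (2 * c))) (W 0)"
      using transfer[OF zero_in(1), where R = ?R and p = 0 and q = "Suc (2 * c)" and r = 0] by blast
    then show ?thesis unfolding init W j_def by simp
  qed
  have j_b: "j x \<prec>\<^bsub>N\<^esub> b" for x
  proof -
    \<comment> \<open>The last component of a stage is presented as the auxiliary witness of
      \<open>preserves_S1\<close>, which ends up below \<open>b\<close>.\<close>
    let ?Q = "\<lambda>M i u t. \<exists>w. u = pair M w t"
    have "S1 (\<lambda>M s. ?Q M (s 0) (s 1) (s 2))" by (intro S1_intros F1_pair F1_intros)
    moreover have "?Q M \<zero>\<^bsub>M\<^esub> (U (Suc (2 * x))) (m (2 * x))" unfolding U by blast
    ultimately obtain t where "t \<prec>\<^bsub>N\<^esub> b" "?Q N \<zero>\<^bsub>M\<^esub> (W (Suc (2 * x))) t"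
      using preserves_S1[OF pres, of ?Q "\<zero>\<^bsub>M\<^esub>" "Suc (2 * x)"] zero_in by blast
    then show ?thesis unfolding W j_def by simp
  qed
  have W_mono: "W n \<preceq>\<^bsub>N\<^esub> W (n + k)" for n k
  proof (induction k)
    case (Suc k)
    then show ?case using N.pair_ge(1) N.sr.order_trans unfolding add_Suc_right W by blast
  qed simp
  have j_initial: "y \<in> range j" if y: "y \<prec>\<^bsub>N\<^esub> j x" for x y
  proof -
    \<comment> \<open>An odd stage that proposes \<open>y\<close>. The second component of the pair
      delays it until \<open>j x\<close> has been taken in, so that \<open>W n\<close> is at least
      \<open>j x\<close>.\<close>
    define n where "n = Suc (2 * prod_encode (y, Suc (2 * x)))"
    have n: "odd n" "n div 2 = prod_encode (y, Suc (2 * x))" by (simp_all add: n_def)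
    have "Suc (2 * x) \<le> n" using le_prod_encode_2[of "Suc (2 * x)" y] by (simp add: n_def)
    then obtain k where "n = Suc (2 * x) + k" using le_Suc_ex by blast
    then have "W (Suc (2 * x)) \<preceq>\<^bsub>N\<^esub> W n" using W_mono[of "Suc (2 * x)" k] by (simp only:)
    moreover have "j x \<preceq>\<^bsub>N\<^esub> W (Suc (2 * x))" unfolding W j_def by (rule N.pair_ge)
    ultimately have "y \<prec>\<^bsub>N\<^esub> W n" using y N.sr.less_le_trans N.sr.order_trans by blast
    then have "m' n = y" using odd[OF n(1)] n(2) by simp
    then show ?thesis using j_eq[of n] by blast
  qed
  have less_iff: "x \<prec>\<^bsub>M\<^esub> y \<longleftrightarrow> j x \<prec>\<^bsub>N\<^esub> j y" for x y
    using j_less M.sr.less_linear N.sr.less_asym N.sr.less_irrefl by metis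
  have "inj j"
    using j_less M.sr.less_linear N.sr.less_irrefl by (metis injI)
  moreover have "j \<zero>\<^bsub>M\<^esub> = \<zero>\<^bsub>N\<^esub>" "j \<one>\<^bsub>M\<^esub> = \<one>\<^bsub>N\<^esub>"
    using j_I zero_in(1) zero_eq one_in one_eq by metis+
  ultimately have "embedding M N j"
    unfolding embedding_def M.carrier_UNIV N.carrier_UNIV using j_add j_mult less_iff by auto
  moreover have "initial_segment (range j) N"
    unfolding initial_segment_def N.carrier_UNIV using j_initial by auto
  moreover have "b \<notin> range j" using j_b N.sr.less_irrefl by blast
  ultimately have "proper_initial_embedding M N j"
    unfolding proper_initial_embedding_def M.carrier_UNIV N.carrier_UNIV by blast
  then show ?thesis using j_c j_b j_I by blast
qed

section \<open>Initial embeddings preserve definable relations\<close>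

locale initial_embedding = M: model M + N: model N
  for M N :: "'a arith_struct" +
  fixes j :: "'a \<Rightarrow> 'a"
  assumes emb: "embedding M N j" and init: "initial_segment (range j) N"
begin

lemma hom:
  "j \<zero>\<^bsub>M\<^esub> = \<zero>\<^bsub>N\<^esub>" "j \<one>\<^bsub>M\<^esub> = \<one>\<^bsub>N\<^esub>"
  "j (x \<oplus>\<^bsub>M\<^esub> y) = j x \<oplus>\<^bsub>N\<^esub> j y" "j (x \<otimes>\<^bsub>M\<^esub> y) = j x \<otimes>\<^bsub>N\<^esub> j y"
  "j x \<prec>\<^bsub>N\<^esub> j y \<longleftrightarrow> x \<prec>\<^bsub>M\<^esub> y" "j x = j y \<longleftrightarrow> x = y"
  using emb unfolding embedding_def M.carrier_UNIV by (auto dest: injD)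

lemma below_range: "y \<prec>\<^bsub>N\<^esub> j x \<Longrightarrow> \<exists>x'. y = j x'"
  using init unfolding initial_segment_def N.carrier_UNIV by blast

lemma eval_tm_j: "eval_tm N (\<lambda>n. j (s n)) t = j (eval_tm M s t)"
  by (induction t) (auto simp: hom)

lemma Delta0_absolute: "Delta0 \<delta> \<Longrightarrow> sat N (\<lambda>n. j (s n)) \<delta> \<longleftrightarrow> sat M s \<delta>"
proof (induction arbitrary: s rule: Delta0.induct)
  case (Bex \<phi> t)
  have case_j: "case_nat (j x) (\<lambda>n. j (s n)) = (\<lambda>n. j (case_nat x s n))" for x
    by (auto split: nat.split)
  have "(\<exists>y. y \<prec>\<^bsub>N\<^esub> j (eval_tm M s t) \<and> sat N (case_nat y (\<lambda>n. j (s n))) \<phi>) \<longleftrightarrow>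
      (\<exists>x. x \<prec>\<^bsub>M\<^esub> eval_tm M s t \<and> sat M (case_nat x s) \<phi>)"
  proof
    assume "\<exists>y. y \<prec>\<^bsub>N\<^esub> j (eval_tm M s t) \<and> sat N (case_nat y (\<lambda>n. j (s n))) \<phi>"
    then obtain y where y: "y \<prec>\<^bsub>N\<^esub> j (eval_tm M s t)" "sat N (case_nat y (\<lambda>n. j (s n))) \<phi>" by blast
    then obtain x where "y = j x" using below_range by blast
    with y show "\<exists>x. x \<prec>\<^bsub>M\<^esub> eval_tm M s t \<and> sat M (case_nat x s) \<phi>"
      using Bex.IH[of "case_nat x s"] by (auto simp: hom case_j)
  next
    assume "\<exists>x. x \<prec>\<^bsub>M\<^esub> eval_tm M s t \<and> sat M (case_nat x s) \<phi>"
    then obtain x where "x \<prec>\<^bsub>M\<^esub> eval_tm M s t" "sat M (case_nat x s) \<phi>" by blast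
    then have "j x \<prec>\<^bsub>N\<^esub> j (eval_tm M s t)" "sat N (case_nat (j x) (\<lambda>n. j (s n))) \<phi>"
      using Bex.IH[of "case_nat x s"] by (auto simp: hom case_j)
    then show "\<exists>y. y \<prec>\<^bsub>N\<^esub> j (eval_tm M s t) \<and> sat N (case_nat y (\<lambda>n. j (s n))) \<phi>" by blast
  qed
  then show ?case by (simp add: M.carrier_UNIV N.carrier_UNIV eval_tm_j)
qed (auto simp: eval_tm_j hom)

lemma S1_upward:
  assumes "S1 P" "P M s" shows "P N (\<lambda>n. j (s n))"
proof -
  obtain Q where Q: "D0 Q" "\<And>M s. model M \<Longrightarrow> P M s = (\<exists>z. Q M (case_nat z s))"
    using assms(1) unfolding S1_def by auto
  obtain \<phi> where \<phi>: "Delta0 \<phi>" "\<And>M s. model M \<Longrightarrow> Q M s = sat M s \<phi>"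
    using Q(1) unfolding D0_def by metis
  obtain z where "sat M (case_nat z s) \<phi>"
    using assms(2) Q(2)[OF M.model_axioms] \<phi>(2)[OF M.model_axioms] by auto
  then have "sat N (\<lambda>n. j (case_nat z s n)) \<phi>" using Delta0_absolute[OF \<phi>(1)] by simp
  moreover have "(\<lambda>n. j (case_nat z s n)) = case_nat (j z) (\<lambda>n. j (s n))"
    by (auto split: nat.split)
  ultimately show ?thesis
    using Q(2)[OF N.model_axioms] \<phi>(2)[OF N.model_axioms] by auto
qed

text \<open>A Delta1 relation passes upward together with its negation, hence also downward.\<close>

lemma ack_mem_j: "ack_mem N (j x) (j y) \<longleftrightarrow> ack_mem M x y"
  using S1_upward[of "\<lambda>M s. ack_mem M (s 0) (s 1)" "case_nat x (\<lambda>_. y)"]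
    S1_upward[of "\<lambda>M s. \<not> ack_mem M (s 0) (s 1)" "case_nat x (\<lambda>_. y)"] D1_ack_aux
  unfolding D1_def by auto

lemma exp2_j: "j (exp2 M x) = exp2 N (j x)"
proof -
  have "S1 (\<lambda>M s. s 0 = exp2 M (s 1))" by (intro S1_intros F1_exp2 F1_intros)
  from S1_upward[OF this, of "case_nat (exp2 M x) (\<lambda>_. x)"] show ?thesis by simp
qed

lemma SSy_eq:
  assumes "proper_cut I M" "\<And>i. i \<in> I \<Longrightarrow> j i = i" shows "SSy I M = SSy I N"
proof
  have I: "I \<noteq> UNIV" "\<And>x y. x \<in> I \<Longrightarrow> y \<prec>\<^bsub>M\<^esub> x \<Longrightarrow> y \<in> I"
    using assms(1) unfolding proper_cut_def cut_def initial_segment_def M.carrier_UNIV by auto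
  show "SSy I M \<subseteq> SSy I N"
  proof
    fix X assume "X \<in> SSy I M"
    then obtain c where "X = ack_ext M c \<inter> I" unfolding SSy_def by blast
    also have "\<dots> = ack_ext N (j c) \<inter> I"
      unfolding ack_ext_def M.carrier_UNIV N.carrier_UNIV using assms(2) ack_mem_j by force
    finally show "X \<in> SSy I N" unfolding SSy_def N.carrier_UNIV by blast
  qed
  show "SSy I N \<subseteq> SSy I M"
  proof
    fix X assume "X \<in> SSy I N"
    then obtain c where X: "X = ack_ext N c \<inter> I" unfolding SSy_def by blast
    obtain e where e: "e \<notin> I" using I(1) by blast
    have "S1 (\<lambda>M s. ack_mem M (s 0) (s (Suc 0)))" by (intro S1_D1[OF D1_ack] F1_intros)
    from N.S1_comprehension[of "\<lambda>M x s. ack_mem M x (s 0)", OF this, of "j e" "\<lambda>_. c"]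
    obtain d where d: "d \<prec>\<^bsub>N\<^esub> exp2 N (j e)" "\<And>x. x \<prec>\<^bsub>N\<^esub> j e \<Longrightarrow> ack_mem N x d \<longleftrightarrow> ack_mem N x c"
      by blast
    then obtain c' where c': "d = j c'" using below_range exp2_j by metis
    have "ack_mem N x c \<longleftrightarrow> ack_mem M x c'" if "x \<in> I" for x
    proof -
      have "x \<prec>\<^bsub>M\<^esub> e" using I(2) that e M.sr.neq_iff by blast
      then have "x \<prec>\<^bsub>N\<^esub> j e" using hom(5)[of x e] assms(2)[OF that] by simp
      then show ?thesis using d(2) ack_mem_j[of x c'] assms(2)[OF that] c' by simp
    qed
    then have "X = ack_ext M c' \<inter> I" unfolding X ack_ext_def M.carrier_UNIV N.carrier_UNIV by auto
    then show "X \<in> SSy I M" unfolding SSy_def M.carrier_UNIV by blast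
  qed
qed

end

section \<open>The equivalence for structures on the natural numbers\<close>

definition embeddable ::
    "'a arith_struct \<Rightarrow> 'a arith_struct \<Rightarrow> 'a set \<Rightarrow> 'a \<Rightarrow> 'a \<Rightarrow> 'a \<Rightarrow> bool" where
  "embeddable M N I a b c \<longleftrightarrow>
    (\<exists>j. proper_initial_embedding M N j \<and> j c = a \<and>
      (\<forall>x\<in>carrier M. j x \<prec>\<^bsub>N\<^esub> b) \<and> (\<forall>i\<in>I. j i = i))"

definition formulas_preserved ::
    "'a arith_struct \<Rightarrow> 'a arith_struct \<Rightarrow> 'a set \<Rightarrow> 'a \<Rightarrow> 'a \<Rightarrow> 'a \<Rightarrow> bool" where
  "formulas_preserved M N I a b c \<longleftrightarrow>
    (\<forall>i\<in>I. \<forall>\<delta>. Delta0 \<delta> \<and> free_vars \<delta> \<subseteq> {0, 1, 2} \<longrightarrow>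
      (\<exists>z\<in>carrier M. sat M ((!) [i, c, z]) \<delta>) \<longrightarrow>
      (\<exists>z\<in>carrier N. z \<prec>\<^bsub>N\<^esub> b \<and> sat N ((!) [i, a, z]) \<delta>))"

lemma embeddable_iff:
  fixes M N :: "nat arith_struct"
  assumes "model M" "model N" "shared_cut I M N" "closed_under_exp I M"
  shows "embeddable M N I a b c \<longleftrightarrow> SSy I M = SSy I N \<and> formulas_preserved M N I a b c"
proof
  interpret M: model M by fact
  interpret N: model N by fact
  assume "embeddable M N I a b c"
  then obtain j where j: "proper_initial_embedding M N j" "j c = a" "\<And>x. j x \<prec>\<^bsub>N\<^esub> b"
    "\<And>i. i \<in> I \<Longrightarrow> j i = i" unfolding embeddable_def M.carrier_UNIV by blast
  interpret initial_embedding M N j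
    using j(1) by unfold_locales (auto simp: proper_initial_embedding_def M.carrier_UNIV)
  have "SSy I M = SSy I N"
    using SSy_eq j(4) assms(3) unfolding shared_cut_def by blast
  moreover have "formulas_preserved M N I a b c"
    unfolding formulas_preserved_def
  proof (intro ballI allI impI)
    fix i \<delta> assume i: "i \<in> I" and \<delta>: "Delta0 \<delta> \<and> free_vars \<delta> \<subseteq> {0, 1, 2}"
      and "\<exists>z\<in>carrier M. sat M ((!) [i, c, z]) \<delta>"
    then obtain z where "sat M ((!) [i, c, z]) \<delta>" by blast
    then have "sat N (\<lambda>n. j ([i, c, z] ! n)) \<delta>" using Delta0_absolute \<delta> by blast
    \<comment> \<open>Past the end of the lists the values are unspecified and need not correspond
      under \<open>j\<close>; they do not matter because the free variables of
      \<open>\<delta>\<close> are bounded.\<close>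
    moreover have "sat N (\<lambda>n. j ([i, c, z] ! n)) \<delta> \<longleftrightarrow> sat N ((!) [i, a, j z]) \<delta>"
      using \<delta> i j(2,4) by (intro sat_cong) auto
    ultimately show "\<exists>z\<in>carrier N. z \<prec>\<^bsub>N\<^esub> b \<and> sat N ((!) [i, a, z]) \<delta>"
      using j(3) N.carrier_UNIV by blast
  qed
  ultimately show "SSy I M = SSy I N \<and> formulas_preserved M N I a b c" ..
next
  interpret M: model M by fact
  interpret N: model N by fact
  assume *: "SSy I M = SSy I N \<and> formulas_preserved M N I a b c"
  obtain V :: "nat arith_struct \<Rightarrow> nat \<Rightarrow> nat \<Rightarrow> nat \<Rightarrow> bool" where "universal V"
    using universal_ex by blast
  interpret back_and_forth M N I b V
    using * assms(3,4) \<open>universal V\<close> by unfold_locales simp_all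
  have "preserves c a"
    unfolding preserves_def
  proof (intro ballI allI impI)
    fix i and P :: "nat arith_struct \<Rightarrow> nat \<Rightarrow> nat \<Rightarrow> nat \<Rightarrow> bool"
    assume i: "i \<in> I" and P: "D0 (\<lambda>M s. P M (s 0) (s 1) (s 2))" "\<exists>z. P M i c z"
    obtain \<phi> where \<phi>: "Delta0 \<phi>" "\<And>M s. model M \<Longrightarrow> P M (s 0) (s 1) (s 2) = sat M s \<phi>"
      using P(1) unfolding D0_def by blast
    \<comment> \<open>The remaining variables are set to \<open>Zero\<close> to meet the restriction
      on free variables.\<close>
    define \<phi>' where "\<phi>' = subst_fm \<phi> (\<lambda>n. if n < 3 then Var n else Zero)"
    have "Delta0 \<phi>'" unfolding \<phi>'_def by (rule Delta0_subst_fm[OF \<phi>(1)])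
    moreover have "free_vars \<phi>' \<subseteq> {0, 1, 2}"
      by (auto simp: \<phi>'_def free_vars_subst_fm split: if_splits)
    moreover have \<phi>': "P M i y z \<longleftrightarrow> sat M ((!) [i, y, z]) \<phi>'" if "model M" for M y z
      using \<phi>(2)[OF that, of "\<lambda>n. eval_tm M ((!) [i, y, z]) (if n < 3 then Var n else Zero)"]
      by (simp add: \<phi>'_def sat_subst_fm)
    moreover obtain z where "P M i c z" using P(2) by blast
    then have "\<exists>z\<in>carrier M. sat M ((!) [i, c, z]) \<phi>'"
      using \<phi>'[OF assms(1)] M.carrier_UNIV by blast
    ultimately obtain z' where "z' \<prec>\<^bsub>N\<^esub> b" "sat N ((!) [i, a, z']) \<phi>'"
      using * i unfolding formulas_preserved_def by blast
    then show "\<exists>z. z \<prec>\<^bsub>N\<^esub> b \<and> P N i a z" using \<phi>'[OF assms(2)] by blast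
  qed
  from back_and_forth_embedding[OF back_and_forth_axioms this]
  show "embeddable M N I a b c" unfolding embeddable_def by blast
qed

section \<open>Reduction to structures on the natural numbers\<close>

lemma (in PA_minus) less_add_one: "x \<in> carrier M \<Longrightarrow> x \<prec> x \<oplus> \<one>"
  by (metis add_comm add_mono add_zero one_closed zero_closed zero_less_one)

lemma (in PA_minus) infinite_if_Suc_closed:
  assumes "J \<subseteq> carrier M" "a \<in> J" "\<And>x. x \<in> J \<Longrightarrow> x \<oplus> \<one> \<in> J"
  shows "infinite J"
proof -
  let ?s = "\<lambda>n. ((\<lambda>x. x \<oplus> \<one>) ^^ n) a"
  have J: "?s n \<in> J" for n using assms(2,3) by (induction n) auto
  then have C: "?s n \<in> carrier M" for n using assms(1) by blast
  have less: "?s n \<prec> ?s (Suc (n + k))" for n k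
  proof (induction k)
    case (Suc k)
    then show ?case
      using less_trans[OF C C C, of n "Suc (n + k)" "Suc (n + Suc k)"] less_add_one[OF C, of "Suc (n + k)"] by simp
  qed (simp add: less_add_one[OF C])
  have "inj ?s"
  proof (rule injI)
    fix m n assume eq: "?s m = ?s n"
    show "m = n"
    proof (rule ccontr)
      assume "m \<noteq> n"
      then have "(\<exists>k. n = Suc (m + k)) \<or> (\<exists>k. m = Suc (n + k))"
        by (metis less_imp_Suc_add linorder_neqE_nat)
      then show False using less eq less_irrefl[OF C] by metis
    qed
  qed
  moreover have "range ?s \<subseteq> J" using J by blast
  ultimately show ?thesis using infinite_super range_inj_infinite by blast
qed

text \<open>Both parts have to be infinite for \<open>nat_bijection_extending\<close> to exhaust the
  even and the odd numbers.\<close>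

lemma (in PA_minus) infinite_cut:
  assumes "proper_cut I M" shows "infinite I" "infinite (carrier M - I)"
proof -
  have I: "I \<subseteq> carrier M" "I \<noteq> {}" "I \<noteq> carrier M" "\<And>x. x \<in> I \<Longrightarrow> \<exists>y\<in>I. x \<prec> y"
    "\<And>x y. x \<in> I \<Longrightarrow> y \<in> carrier M \<Longrightarrow> y \<prec> x \<Longrightarrow> y \<in> I"
    using assms unfolding proper_cut_def cut_def initial_segment_def by simp_all
  have "x \<oplus> \<one> \<in> I" if x: "x \<in> I" for x
  proof -
    obtain y where y: "y \<in> I" "x \<prec> y" using I(4) x by blast
    then obtain z where z: "z \<in> carrier M" "x \<oplus> z = y" using less_diff I(1) x by blast
    have "z \<noteq> \<zero>" using z y x I(1) add_zero less_irrefl by auto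
    then have "z = \<one> \<or> \<one> \<prec> z" using discrete zero_least z(1) by blast
    then have "x \<oplus> \<one> = y \<or> x \<oplus> \<one> \<prec> y"
      using add_mono[OF one_closed z(1), of x] add_comm one_closed z x I(1) by auto
    then show ?thesis using I(1,5) x y(1) add_closed one_closed by blast
  qed
  then show "infinite I" using infinite_if_Suc_closed I(1,2) by blast
  obtain e where e: "e \<in> carrier M - I" using I(1,3) by blast
  have "x \<oplus> \<one> \<in> carrier M - I" if "x \<in> carrier M - I" for x
    using that less_add_one I(5) add_closed one_closed by blast
  then show "infinite (carrier M - I)" using infinite_if_Suc_closed[OF _ e] by blast
qed

text \<open>\<open>I\<close> goes to the even numbers and its complement to the odd ones. On
  \<open>I\<close> the map depends on \<open>I\<close> alone, so the maps obtained for two carriers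
  agree there.\<close>

lemma nat_bijection_extending:
  assumes "countable C" "I \<subseteq> C" "infinite I" "infinite (C - I)"
  obtains f :: "'a \<Rightarrow> nat" and g where "\<And>x. x \<in> C \<Longrightarrow> g (f x) = x" "\<And>n. f (g n) = n"
    "\<And>n. g n \<in> C" "\<And>x. x \<in> I \<Longrightarrow> f x = 2 * to_nat_on I x"
proof
  let ?f = "\<lambda>x. if x \<in> I then 2 * to_nat_on I x else Suc (2 * to_nat_on (C - I) x)"
  let ?g = "\<lambda>n. if even n then from_nat_into I (n div 2) else from_nat_into (C - I) (n div 2)"
  have c: "countable I" "countable (C - I)" using assms(1,2) countable_subset by blast+
  have ne: "I \<noteq> {}" "C - I \<noteq> {}" using assms(3,4) by (metis finite.emptyI)+
  show "?g (?f x) = x" if "x \<in> C" for x using that c by simp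
  show "?g n \<in> C" for n using from_nat_into[OF ne(1), of "n div 2"] from_nat_into[OF ne(2), of "n div 2"] assms(2) by auto
  show "?f (?g n) = n" for n
    using from_nat_into[OF ne(1), of "n div 2"] from_nat_into[OF ne(2), of "n div 2"] c assms(3,4)
    by (auto elim!: evenE oddE)
qed simp

section \<open>Transport of a model along a bijection of its carrier\<close>

definition image_struct ::
    "('a \<Rightarrow> 'b) \<Rightarrow> ('b \<Rightarrow> 'a) \<Rightarrow> 'a arith_struct \<Rightarrow> 'b arith_struct" where
  "image_struct f g M = \<lparr> carrier = UNIV, zero = f \<zero>\<^bsub>M\<^esub>, one = f \<one>\<^bsub>M\<^esub>,
    add = (\<lambda>x y. f (g x \<oplus>\<^bsub>M\<^esub> g y)), mult = (\<lambda>x y. f (g x \<otimes>\<^bsub>M\<^esub> g y)),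
    less = (\<lambda>x y. g x \<prec>\<^bsub>M\<^esub> g y) \<rparr>"

locale transport = ISigma1 M for M :: "'a arith_struct" (structure) +
  fixes f :: "'a \<Rightarrow> 'b" and g :: "'b \<Rightarrow> 'a"
  assumes gf: "x \<in> carrier M \<Longrightarrow> g (f x) = x" and fg: "f (g n) = n" and g_in: "g n \<in> carrier M"
begin

abbreviation "M' \<equiv> image_struct f g M"

lemma image_simps [simp]:
  "carrier M' = UNIV" "\<zero>\<^bsub>M'\<^esub> = f \<zero>" "\<one>\<^bsub>M'\<^esub> = f \<one>"
  "x \<oplus>\<^bsub>M'\<^esub> y = f (g x \<oplus> g y)" "x \<otimes>\<^bsub>M'\<^esub> y = f (g x \<otimes> g y)" "x \<prec>\<^bsub>M'\<^esub> y \<longleftrightarrow> g x \<prec> g y"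
  by (simp_all add: image_struct_def)

lemmas closed = zero_closed one_closed add_closed mult_closed g_in

lemma g_eq_iff: "x = y \<longleftrightarrow> g x = g y"
  using fg by metis

lemma ex_iff: "(\<exists>n. P (g n)) \<longleftrightarrow> (\<exists>x\<in>carrier M. P x)"
  using gf g_in by metis

lemma all_iff: "(\<forall>n. P (g n)) \<longleftrightarrow> (\<forall>x\<in>carrier M. P x)"
  using gf g_in by metis

lemma eval_tm_closed: "(\<And>n. s n \<in> carrier M) \<Longrightarrow> eval_tm M s t \<in> carrier M"
  by (induction t) (auto simp: closed)

lemma eval_tm_image: "g (eval_tm M' s t) = eval_tm M (\<lambda>n. g (s n)) t"
  by (induction t) (auto simp: gf closed eval_tm_closed)

lemma sat_image: "sat M' s \<phi> \<longleftrightarrow> sat M (\<lambda>n. g (s n)) \<phi>"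
proof (induction \<phi> arbitrary: s)
  case (Eq t u)
  show ?case unfolding sat.simps eval_tm_image[symmetric] by (rule g_eq_iff)
next
  case (Ex \<phi>)
  have "(\<lambda>n. g (case_nat x s n)) = case_nat (g x) (\<lambda>n. g (s n))" for x
    by (auto split: nat.split)
  then have "sat M' s (fm.Ex \<phi>) \<longleftrightarrow> (\<exists>x. sat M (case_nat (g x) (\<lambda>n. g (s n))) \<phi>)"
    using Ex by simp
  also have "\<dots> \<longleftrightarrow> sat M (\<lambda>n. g (s n)) (fm.Ex \<phi>)"
    using ex_iff[of "\<lambda>y. sat M (case_nat y (\<lambda>n. g (s n))) \<phi>"] by simp
  finally show ?case .
qed (auto simp: eval_tm_image)

lemma model_image: "model M'"
proof -
  have case_g: "(\<lambda>n. g (case_nat x s n)) = case_nat (g x) (\<lambda>n. g (s n))" for x s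
    by (auto split: nat.split)
  have "PA_minus M'"
  proof
    fix x y z
    show "x \<oplus>\<^bsub>M'\<^esub> y \<oplus>\<^bsub>M'\<^esub> z = x \<oplus>\<^bsub>M'\<^esub> (y \<oplus>\<^bsub>M'\<^esub> z)" by (simp add: gf closed add_assoc)
    show "x \<oplus>\<^bsub>M'\<^esub> y = y \<oplus>\<^bsub>M'\<^esub> x" by (simp add: closed add_comm)
    show "x \<otimes>\<^bsub>M'\<^esub> y \<otimes>\<^bsub>M'\<^esub> z = x \<otimes>\<^bsub>M'\<^esub> (y \<otimes>\<^bsub>M'\<^esub> z)" by (simp add: gf closed mult_assoc)
    show "x \<otimes>\<^bsub>M'\<^esub> y = y \<otimes>\<^bsub>M'\<^esub> x" by (simp add: closed mult_comm)
    show "x \<otimes>\<^bsub>M'\<^esub> (y \<oplus>\<^bsub>M'\<^esub> z) = x \<otimes>\<^bsub>M'\<^esub> y \<oplus>\<^bsub>M'\<^esub> x \<otimes>\<^bsub>M'\<^esub> z" by (simp add: gf closed distrib)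
    show "x \<oplus>\<^bsub>M'\<^esub> \<zero>\<^bsub>M'\<^esub> = x" "x \<otimes>\<^bsub>M'\<^esub> \<zero>\<^bsub>M'\<^esub> = \<zero>\<^bsub>M'\<^esub>" "x \<otimes>\<^bsub>M'\<^esub> \<one>\<^bsub>M'\<^esub> = x"
      by (simp_all add: gf fg closed add_zero mult_zero mult_one)
    show "x \<prec>\<^bsub>M'\<^esub> y \<Longrightarrow> y \<prec>\<^bsub>M'\<^esub> z \<Longrightarrow> x \<prec>\<^bsub>M'\<^esub> z" using less_trans[OF g_in g_in g_in] by simp
    show "\<not> x \<prec>\<^bsub>M'\<^esub> x" by (simp add: less_irrefl closed)
    show "x \<prec>\<^bsub>M'\<^esub> y \<or> x = y \<or> y \<prec>\<^bsub>M'\<^esub> x" using less_linear[OF g_in g_in] g_eq_iff[of x y] by auto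
    show "x \<prec>\<^bsub>M'\<^esub> y \<Longrightarrow> x \<oplus>\<^bsub>M'\<^esub> z \<prec>\<^bsub>M'\<^esub> y \<oplus>\<^bsub>M'\<^esub> z" by (simp add: gf closed add_mono)
    show "\<zero>\<^bsub>M'\<^esub> \<prec>\<^bsub>M'\<^esub> z \<Longrightarrow> x \<prec>\<^bsub>M'\<^esub> y \<Longrightarrow> x \<otimes>\<^bsub>M'\<^esub> z \<prec>\<^bsub>M'\<^esub> y \<otimes>\<^bsub>M'\<^esub> z"
      by (simp add: gf closed mult_mono)
    show "x \<prec>\<^bsub>M'\<^esub> y \<Longrightarrow> \<exists>z\<in>carrier M'. x \<oplus>\<^bsub>M'\<^esub> z = y"
      using less_diff[OF g_in g_in, of x y] fg gf by simp metis
    show "\<zero>\<^bsub>M'\<^esub> \<prec>\<^bsub>M'\<^esub> x \<Longrightarrow> x = \<one>\<^bsub>M'\<^esub> \<or> \<one>\<^bsub>M'\<^esub> \<prec>\<^bsub>M'\<^esub> x"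
      using discrete[OF g_in, of x] by (auto simp: gf closed g_eq_iff[of x])
    show "x = \<zero>\<^bsub>M'\<^esub> \<or> \<zero>\<^bsub>M'\<^esub> \<prec>\<^bsub>M'\<^esub> x"
      using zero_least[OF g_in, of x] by (auto simp: gf closed g_eq_iff[of x])
    show "\<zero>\<^bsub>M'\<^esub> \<prec>\<^bsub>M'\<^esub> \<one>\<^bsub>M'\<^esub>" by (simp add: gf closed zero_less_one)
  qed simp_all
  have ind: "sat M' (case_nat x s) \<phi>"
    if \<phi>: "Sigma1 \<phi>" and "sat M' (case_nat \<zero>\<^bsub>M'\<^esub> s) \<phi>"
      and step: "\<And>x. sat M' (case_nat x s) \<phi> \<Longrightarrow> sat M' (case_nat (x \<oplus>\<^bsub>M'\<^esub> \<one>\<^bsub>M'\<^esub>) s) \<phi>" for \<phi> s x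
  proof -
    have "sat M (case_nat \<zero> (\<lambda>n. g (s n))) \<phi>"
      using that(2) unfolding sat_image case_g by (simp add: gf closed)
    moreover have "sat M (case_nat (y \<oplus> \<one>) (\<lambda>n. g (s n))) \<phi>"
      if "y \<in> carrier M" "sat M (case_nat y (\<lambda>n. g (s n))) \<phi>" for y
      using step[of "f y"] that unfolding sat_image case_g by (simp add: gf closed)
    ultimately show ?thesis
      unfolding sat_image case_g using Sigma1_induction[OF \<phi>, of "\<lambda>n. g (s n)"] g_in by blast
  qed
  show ?thesis
  proof (intro model.intro ISigma1.intro model_axioms.intro ISigma1_axioms.intro)
    show "PA_minus M'" by fact
    fix \<phi> s x
    assume *: "Sigma1 \<phi>" "sat M' (case_nat \<zero>\<^bsub>M'\<^esub> s) \<phi>"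
      "\<And>x. x \<in> carrier M' \<Longrightarrow> sat M' (case_nat x s) \<phi> \<Longrightarrow>
        sat M' (case_nat (x \<oplus>\<^bsub>M'\<^esub> \<one>\<^bsub>M'\<^esub>) s) \<phi>"
    show "sat M' (case_nat x s) \<phi>"
      by (rule ind[OF *(1,2)]) (rule *(3), simp, assumption)
  qed simp
qed

lemma beta_graph_image: "beta_graph M' a b i r \<longleftrightarrow> beta_graph M (g a) (g b) (g i) (g r)"
  unfolding beta_graph_def Let_def
  using ex_iff[of "\<lambda>q. g a = q \<otimes> (\<one> \<oplus> (g i \<oplus> \<one>) \<otimes> g b) \<oplus> g r"]
  by (simp add: gf closed g_eq_iff[of a])

lemma exp_graph_image: "exp_graph M' x y \<longleftrightarrow> exp_graph M (g x) (g y)"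
proof -
  have "exp_graph M' x y \<longleftrightarrow> (\<exists>a b. beta_graph M (g a) (g b) \<zero> \<one> \<and>
    (\<forall>i. g i \<prec> g x \<longrightarrow> (\<exists>u. beta_graph M (g a) (g b) (g i) (g u) \<and>
      beta_graph M (g a) (g b) (g i \<oplus> \<one>) (g u \<oplus> g u))) \<and> beta_graph M (g a) (g b) (g x) (g y))"
    unfolding exp_graph_def by (simp add: beta_graph_image gf closed)
  also have "\<dots> \<longleftrightarrow> exp_graph M (g x) (g y)"
    unfolding exp_graph_def ex_iff[symmetric] all_iff[symmetric] by simp
  finally show ?thesis .
qed

lemma ack_mem_image: "ack_mem M' x y \<longleftrightarrow> ack_mem M (g x) (g y)"
proof -
  have "ack_mem M' x y \<longleftrightarrow> (\<exists>p q r. exp_graph M (g x) (g p) \<and> g r \<prec> g p \<and>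
      g y = (g q \<oplus> g q \<oplus> \<one>) \<otimes> g p \<oplus> g r)"
    unfolding ack_mem_def by (simp add: exp_graph_image gf closed g_eq_iff[of y])
  also have "\<dots> \<longleftrightarrow> ack_mem M (g x) (g y)"
    unfolding ack_mem_def ex_iff[symmetric] by simp
  finally show ?thesis .
qed

lemma f_eq_iff: "x \<in> carrier M \<Longrightarrow> y \<in> carrier M \<Longrightarrow> f x = f y \<longleftrightarrow> x = y"
  using gf by metis

lemma embedding_f: "embedding M M' f" "f ` carrier M = carrier M'"
  unfolding embedding_def using fg g_in
  by (auto simp: gf intro: inj_on_inverseI[of _ g]) (metis image_eqI)

lemma embedding_g: "embedding M' M g" "g ` carrier M' = carrier M"
  unfolding embedding_def using gf
  by (auto simp: closed gf fg intro: inj_on_inverseI[of _ f]) (metis gf rangeI)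

lemma SSy_image: assumes "I \<subseteq> carrier M" shows "SSy (f ` I) M' = (`) f ` SSy I M"
proof -
  have "ack_ext M' n \<inter> f ` I = f ` (ack_ext M (g n) \<inter> I)" for n
    using assms by (auto simp: ack_ext_def ack_mem_image gf subset_iff)
  then have "SSy (f ` I) M' = {f ` (ack_ext M (g n) \<inter> I) | n. True}"
    unfolding SSy_def by simp
  also have "\<dots> = (`) f ` SSy I M"
    unfolding SSy_def using gf g_in by (auto simp: image_iff) metis
  finally show ?thesis .
qed

lemma proper_cut_image: assumes "proper_cut I M" shows "proper_cut (f ` I) M'"
proof -
  have I: "I \<subseteq> carrier M" "I \<noteq> {}" "I \<noteq> carrier M" "\<And>x. x \<in> I \<Longrightarrow> \<exists>y\<in>I. x \<prec> y"
    "\<And>x y. x \<in> I \<Longrightarrow> y \<in> carrier M \<Longrightarrow> y \<prec> x \<Longrightarrow> y \<in> I"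
    using assms unfolding proper_cut_def cut_def initial_segment_def by simp_all
  have gfI: "g (f x) = x" if "x \<in> I" for x using gf I(1) that by blast
  obtain e where "e \<in> carrier M" "e \<notin> I" using I(1,3) by blast
  then have "f e \<notin> f ` I" using gf gfI by (metis imageE)
  moreover have "y \<in> f ` I" if "x \<in> I" "g y \<prec> x" for x y
    using I(5)[OF that(1) g_in that(2)] fg by (metis imageI)
  ultimately show ?thesis
    unfolding proper_cut_def cut_def initial_segment_def using I(2,4) gfI by auto
qed

end

text \<open>The maps \<open>p\<close> and \<open>q\<close> are isomorphisms. Both directions of the
  reduction conjugate an embedding in this way.\<close>

lemma proper_initial_embedding_compose:
  assumes p: "embedding A M p" "p ` carrier A = carrier M"
    and j: "proper_initial_embedding M N j"
    and q: "embedding N B q" "q ` carrier N = carrier B"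
  shows "proper_initial_embedding A B (\<lambda>x. q (j (p x)))"
proof -
  have emb: "embedding M N j" and init: "initial_segment (j ` carrier M) N"
    and proper: "j ` carrier M \<noteq> carrier N"
    using j unfolding proper_initial_embedding_def by auto
  have p_in: "p x \<in> carrier M" if "x \<in> carrier A" for x using p(2) that by blast
  have j_in: "j x \<in> carrier N" if "x \<in> carrier M" for x using emb that unfolding embedding_def by blast
  have inj: "inj_on p (carrier A)" "inj_on j (carrier M)" "inj_on q (carrier N)"
    using p(1) emb q(1) unfolding embedding_def by auto
  have image: "(\<lambda>x. q (j (p x))) ` carrier A = q ` j ` carrier M"
    unfolding p(2)[symmetric] by (simp add: image_image)
  have sub: "j ` carrier M \<subseteq> carrier N" using j_in by blast
  have "embedding A B (\<lambda>x. q (j (p x)))"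
    unfolding embedding_def
  proof (intro conjI ballI)
    show "(\<lambda>x. q (j (p x))) \<in> carrier A \<rightarrow> carrier B" using p_in j_in q(2) by blast
    show "inj_on (\<lambda>x. q (j (p x))) (carrier A)"
      by (rule inj_onI) (metis inj inj_onD p_in j_in)
  qed (use p(1) emb q(1) p_in j_in in \<open>auto simp: embedding_def\<close>)
  moreover have "initial_segment (q ` j ` carrier M) B"
    unfolding initial_segment_def
  proof (intro conjI ballI impI)
    show "q ` j ` carrier M \<subseteq> carrier B" using sub q(2) by blast
    show "q ` j ` carrier M \<noteq> {}" using init unfolding initial_segment_def by blast
    fix x y assume "x \<in> q ` j ` carrier M" "y \<in> carrier B" and less: "y \<prec>\<^bsub>B\<^esub> x"
    then obtain x' y' where xy: "x = q x'" "y = q y'" "x' \<in> j ` carrier M" "y' \<in> carrier N"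
      using q(2) by blast
    then have "y' \<prec>\<^bsub>N\<^esub> x'" using less q(1) sub unfolding embedding_def by blast
    then show "y \<in> q ` j ` carrier M" using xy init unfolding initial_segment_def by blast
  qed
  moreover have "q ` j ` carrier M \<noteq> carrier B"
    unfolding q(2)[symmetric] using proper inj_on_image_eq_iff[OF inj(3) sub] by simp
  ultimately show ?thesis unfolding proper_initial_embedding_def image by blast
qed

theorem theorem3p3:
  fixes M N :: "'a arith_struct" and I :: "'a set" and a b c :: 'a
  assumes "ISigma1 M" and "countable (carrier M)" and "nonstandard M"
    and "ISigma1 N" and "countable (carrier N)" and "nonstandard N"
    and "c \<in> carrier M" and "a \<in> carrier N" and "b \<in> carrier N"
    and "shared_cut I M N" and "closed_under_exp I M"
  shows
    "(\<exists>j. proper_initial_embedding M N j \<and> j c = a \<and>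
          (\<forall>x\<in>carrier M. j x \<prec>\<^bsub>N\<^esub> b) \<and> (\<forall>i\<in>I. j i = i))
     \<longleftrightarrow>
     (SSy I M = SSy I N \<and>
      (\<forall>i\<in>I. \<forall>\<delta>. Delta0 \<delta> \<and> free_vars \<delta> \<subseteq> {0, 1, 2} \<longrightarrow>
         (\<exists>z\<in>carrier M. sat M ((!) [i, c, z]) \<delta>) \<longrightarrow>
         (\<exists>z\<in>carrier N. z \<prec>\<^bsub>N\<^esub> b \<and> sat N ((!) [i, a, z]) \<delta>)))"
proof -
  interpret M: ISigma1 M by fact
  interpret N: ISigma1 N by fact
  have cuts: "proper_cut I M" "proper_cut I N" and same: "same_structure_on I M N"
    using assms(10) unfolding shared_cut_def by simp_all
  have sub: "I \<subseteq> carrier M" "I \<subseteq> carrier N"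
    using cuts unfolding proper_cut_def cut_def initial_segment_def by simp_all
  obtain f :: "'a \<Rightarrow> nat" and g where f: "\<And>x. x \<in> carrier M \<Longrightarrow> g (f x) = x" "\<And>n. f (g n) = n"
    "\<And>n. g n \<in> carrier M" "\<And>x. x \<in> I \<Longrightarrow> f x = 2 * to_nat_on I x"
    by (rule nat_bijection_extending[OF assms(2) sub(1) M.infinite_cut[OF cuts(1)]]) (rule that; assumption)
  obtain f' :: "'a \<Rightarrow> nat" and g' where f': "\<And>x. x \<in> carrier N \<Longrightarrow> g' (f' x) = x" "\<And>n. f' (g' n) = n"
    "\<And>n. g' n \<in> carrier N" "\<And>x. x \<in> I \<Longrightarrow> f' x = 2 * to_nat_on I x"
    by (rule nat_bijection_extending[OF assms(5) sub(2) N.infinite_cut[OF cuts(2)]]) (rule that; assumption)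
  interpret MT: transport M f g by unfold_locales (rule f; assumption)+
  interpret NT: transport N f' g' by unfold_locales (rule f'; assumption)+
  let ?M = "image_struct f g M" and ?N = "image_struct f' g' N" and ?I = "f ` I"
  have ff': "f' x = f x" if "x \<in> I" for x using f(4) f'(4) that by simp
  then have I_eq: "f' ` I = ?I" by simp
  have g_I: "g (f x) = x" "g' (f x) = x" if "x \<in> I" for x
    using that f(1) f'(1)[of x] sub ff' by auto
  have "shared_cut ?I ?M ?N"
    unfolding shared_cut_def
  proof (intro conjI)
    show "proper_cut ?I ?M" by (rule MT.proper_cut_image[OF cuts(1)])
    show "proper_cut ?I ?N" using NT.proper_cut_image[OF cuts(2)] unfolding I_eq .
    \<comment> \<open>An operation may lead out of \<open>I\<close>, where \<open>f\<close> and
      \<open>f'\<close> are unrelated. Only comparisons with the image of an element of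
      \<open>I\<close> are required, and there the two maps agree.\<close>
    have eq: "f u = f z \<longleftrightarrow> u = z" "f' v = f z \<longleftrightarrow> v = z"
      if "z \<in> I" "u \<in> carrier M" "v \<in> carrier N" for u v z
      using that MT.f_eq_iff[of u z] NT.f_eq_iff[of v z] ff' sub by auto
    show "same_structure_on ?I ?M ?N"
      unfolding same_structure_on_def
    proof (intro conjI ballI)
      fix x y z assume "x \<in> ?I" "y \<in> ?I" "z \<in> ?I"
      then obtain x' y' z' where xyz: "x = f x'" "y = f y'" "z = f z'" "x' \<in> I" "y' \<in> I" "z' \<in> I" by auto
      then have in_M: "x' \<in> carrier M" "y' \<in> carrier M" and in_N: "x' \<in> carrier N" "y' \<in> carrier N"
        using sub by auto
      show "x = \<zero>\<^bsub>?M\<^esub> \<longleftrightarrow> x = \<zero>\<^bsub>?N\<^esub>" "x = \<one>\<^bsub>?M\<^esub> \<longleftrightarrow> x = \<one>\<^bsub>?N\<^esub>"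
        using same eq[OF xyz(4) M.zero_closed N.zero_closed] eq[OF xyz(4) M.one_closed N.one_closed]
          xyz(1,4) unfolding same_structure_on_def by (simp_all add: eq_commute)
      show "x \<prec>\<^bsub>?M\<^esub> y \<longleftrightarrow> x \<prec>\<^bsub>?N\<^esub> y"
        using same xyz g_I unfolding same_structure_on_def by simp
      show "x \<oplus>\<^bsub>?M\<^esub> y = z \<longleftrightarrow> x \<oplus>\<^bsub>?N\<^esub> y = z"
        using same xyz g_I eq[OF xyz(6) M.add_closed[OF in_M] N.add_closed[OF in_N]]
        unfolding same_structure_on_def by simp
      show "x \<otimes>\<^bsub>?M\<^esub> y = z \<longleftrightarrow> x \<otimes>\<^bsub>?N\<^esub> y = z"
        using same xyz g_I eq[OF xyz(6) M.mult_closed[OF in_M] N.mult_closed[OF in_N]]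
        unfolding same_structure_on_def by simp
    qed
  qed
  moreover have "closed_under_exp ?I ?M"
    using assms(11) g_I unfolding closed_under_exp_def by (simp add: MT.exp_graph_image)
  ultimately have main: "embeddable ?M ?N ?I (f' a) (f' b) (f c) \<longleftrightarrow>
      SSy ?I ?M = SSy ?I ?N \<and> formulas_preserved ?M ?N ?I (f' a) (f' b) (f c)"
    by (rule embeddable_iff[OF MT.model_image NT.model_image])
  have "SSy ?I ?M = SSy ?I ?N \<longleftrightarrow> SSy I M = SSy I N"
  proof -
    have "SSy ?I ?N = (`) f ` SSy I N"
    proof -
      have "f' ` X = f ` X" if "X \<in> SSy I N" for X
        using that ff' unfolding SSy_def by (auto simp: image_iff)
      then show ?thesis using NT.SSy_image[OF sub(2)] unfolding I_eq by auto
    qed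
    \<comment> \<open>The members of both standard systems are subsets of \<open>I\<close>, where
      \<open>f\<close> is injective, so equality of the images gives equality of the
      systems.\<close>
    moreover have "inj_on ((`) f) (SSy I M \<union> SSy I N)"
    proof (rule inj_onI)
      fix X Y assume "X \<in> SSy I M \<union> SSy I N" "Y \<in> SSy I M \<union> SSy I N" and eq: "f ` X = f ` Y"
      then have "X \<subseteq> I" "Y \<subseteq> I" unfolding SSy_def by auto
      moreover have "inj_on f I" using g_I(1) by (rule inj_on_inverseI)
      ultimately show "X = Y" using eq inj_on_image_eq_iff by metis
    qed
    ultimately show ?thesis
      using MT.SSy_image[OF sub(1)] inj_on_image_eq_iff[of "(`) f" "SSy I M \<union> SSy I N" "SSy I M" "SSy I N"]
      by simp
  qed
  moreover have "formulas_preserved ?M ?N ?I (f' a) (f' b) (f c) \<longleftrightarrow> formulas_preserved M N I a b c"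
  proof -
    have satM: "(\<exists>z\<in>carrier ?M. sat ?M ((!) [f i, f c, z]) \<delta>) \<longleftrightarrow> (\<exists>z\<in>carrier M. sat M ((!) [i, c, z]) \<delta>)"
      if "i \<in> I" "free_vars \<delta> \<subseteq> {0, 1, 2}" for i \<delta>
    proof -
      have "sat ?M ((!) [f i, f c, z]) \<delta> \<longleftrightarrow> sat M ((!) [i, c, g z]) \<delta>" for z
        unfolding MT.sat_image using that g_I f(1) assms(7) by (intro sat_cong) auto
      then show ?thesis using MT.ex_iff[of "\<lambda>z. sat M ((!) [i, c, z]) \<delta>"] by simp
    qed
    have satN: "(\<exists>z\<in>carrier ?N. z \<prec>\<^bsub>?N\<^esub> f' b \<and> sat ?N ((!) [f i, f' a, z]) \<delta>) \<longleftrightarrow>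
        (\<exists>z\<in>carrier N. z \<prec>\<^bsub>N\<^esub> b \<and> sat N ((!) [i, a, z]) \<delta>)"
      if "i \<in> I" "free_vars \<delta> \<subseteq> {0, 1, 2}" for i \<delta>
    proof -
      have "sat ?N ((!) [f i, f' a, z]) \<delta> \<longleftrightarrow> sat N ((!) [i, a, g' z]) \<delta>" for z
        unfolding NT.sat_image using that g_I f'(1) assms(8) by (intro sat_cong) auto
      then show ?thesis
        using NT.ex_iff[of "\<lambda>z. z \<prec>\<^bsub>N\<^esub> b \<and> sat N ((!) [i, a, z]) \<delta>"] f'(1) assms(9) by simp
    qed
    show ?thesis
      unfolding formulas_preserved_def using satM satN by (auto simp del: MT.image_simps NT.image_simps)
  qed
  moreover have "embeddable ?M ?N ?I (f' a) (f' b) (f c) \<longleftrightarrow> embeddable M N I a b c"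
  proof
    assume "embeddable ?M ?N ?I (f' a) (f' b) (f c)"
    then obtain j where j: "proper_initial_embedding ?M ?N j" "j (f c) = f' a"
      "\<And>x. g' (j x) \<prec>\<^bsub>N\<^esub> b" "\<And>i. i \<in> I \<Longrightarrow> j (f i) = f i"
      unfolding embeddable_def using f'(1) assms(9) by auto
    have "proper_initial_embedding M N (\<lambda>x. g' (j (f x)))"
      by (rule proper_initial_embedding_compose[OF MT.embedding_f j(1) NT.embedding_g])
    moreover have "g' (j (f c)) = a" using j(2) f'(1) assms(8) by simp
    moreover have "g' (j (f i)) = i" if "i \<in> I" for i using j(4) g_I that by simp
    ultimately show "embeddable M N I a b c"
      unfolding embeddable_def using j(3) by (intro exI[of _ "\<lambda>x. g' (j (f x))"]) auto
  next
    assume "embeddable M N I a b c"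
    then obtain j where j: "proper_initial_embedding M N j" "j c = a"
      "\<And>x. x \<in> carrier M \<Longrightarrow> j x \<prec>\<^bsub>N\<^esub> b" "\<And>i. i \<in> I \<Longrightarrow> j i = i"
      unfolding embeddable_def by blast
    have j_in: "j x \<in> carrier N" if "x \<in> carrier M" for x
      using j(1) that unfolding proper_initial_embedding_def embedding_def by blast
    have "proper_initial_embedding ?M ?N (\<lambda>n. f' (j (g n)))"
      by (rule proper_initial_embedding_compose[OF MT.embedding_g j(1) NT.embedding_f])
    moreover have "f' (j (g (f c))) = f' a" using j(2) f(1) assms(7) by simp
    moreover have "f' (j (g i)) = i" if "i \<in> ?I" for i using that j(4) g_I ff' by auto
    moreover have "f' (j (g x)) \<prec>\<^bsub>?N\<^esub> f' b" for x
      using j(3) f(3) f'(1) assms(9) j_in by simp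
    ultimately show "embeddable ?M ?N ?I (f' a) (f' b) (f c)"
      unfolding embeddable_def by (intro exI[of _ "\<lambda>n. f' (j (g n))"]) auto
  qed
  ultimately have "embeddable M N I a b c \<longleftrightarrow> SSy I M = SSy I N \<and> formulas_preserved M N I a b c"
    using main by simp
  then show ?thesis unfolding embeddable_def formulas_preserved_def .
qed

end
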